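(* Let $C$ be a closed symmetric monoidal quasi-abelian category. If $0\to V_1\to V_2\to V_3\to0$ is a strict short exact sequence in $\mathrm{Ind}(C)$ and $V_1$ and $V_3$ are nuclear, then $V_2$ is nuclear as well.
   Context: Let $C$ have monoidal product $\overline{\otimes}$, unit $e$ and internal Hom $\underline{\mathrm{Hom}}$; the main example is $C=\mathrm{Ban}_R$, the category of Banach modules over a Banach ring $R$ with bounded $R$-linear maps and the completed projective tensor product. $\mathrm{Ind}(C)$ is the ind-completion of $C$ with the extended closed symmetric monoidal structure $(\text{``}\mathrm{colim}"_iE_i)\overline{\otimes}(\text{``}\mathrm{colim}"_jF_j)=\text{``}\mathrm{colim}"_{(i,j)}E_i\overline{\otimes}F_j$ and $\underline{\mathrm{Hom}}(\text{``}\mathrm{colim}"_iE_i,\text{``}\mathrm{colim}"_jF_j)=\lim_i\text{``}\mathrm{colim}"_j\underline{\mathrm{Hom}}(E_i,F_j)$. For an object $W$ of $C$, $W^\vee=\underline{\mathrm{Hom}}(W,e)$. An object $V$ of $\mathrm{Ind}(C)$ is nuclear if for every object $W$ of $C$ the natural morphism $W^\vee\overline{\otimes}V\to\underline{\mathrm{Hom}}(W,V)$ is an isomorphism. A morphism $f$ is strict if $\mathrm{coim}(f)\to\mathrm{im}(f)$ is an isomorphism; $0\to V_1\to V_2\to V_3\to0$ is strict short exact if $V_1\to V_2$ is a kernel of $V_2\to V_3$ and $V_2\to V_3$ is a cokernel of $V_1\to V_2$. An additive category with kernels and cokernels is quasi-abelian if strict epimorphisms are stable under pullback and strict monomorphisms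 are stable under pushout. *)

theory Defs
  imports "HOL-Algebra.Group"
begin

record ('o, 'a) cat =
  Obj :: "'o set"
  Arr :: "'a set"
  Dom :: "'a \<Rightarrow> 'o"
  Cod :: "'a \<Rightarrow> 'o"
  Id :: "'o \<Rightarrow> 'a"
  Comp :: "'a \<Rightarrow> 'a \<Rightarrow> 'a" (infixr "\<cdot>\<index>" 75)

definition Hom :: "('o, 'a, 'z) cat_scheme \<Rightarrow> 'o \<Rightarrow> 'o \<Rightarrow> 'a set" where
  "Hom C X Y = {f \<in> Arr C. Dom C f = X \<and> Cod C f = Y}"

locale category =
  fixes C :: "('o, 'a, 'z) cat_scheme" (structure)
  assumes Dom_Obj: "f \<in> Arr C \<Longrightarrow> Dom C f \<in> Obj C"
    and Cod_Obj: "f \<in> Arr C \<Longrightarrow> Cod C f \<in> Obj C"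
    and Id_Hom: "X \<in> Obj C \<Longrightarrow> Id C X \<in> Hom C X X"
    and Comp_Hom: "f \<in> Hom C X Y \<Longrightarrow> g \<in> Hom C Y Z \<Longrightarrow> g \<cdot> f \<in> Hom C X Z"
    and Comp_Id: "f \<in> Hom C X Y \<Longrightarrow> f \<cdot> Id C X = f"
    and Id_Comp: "f \<in> Hom C X Y \<Longrightarrow> Id C Y \<cdot> f = f"
    and Comp_assoc: "f \<in> Hom C W X \<Longrightarrow> g \<in> Hom C X Y \<Longrightarrow> h \<in> Hom C Y Z \<Longrightarrow>
      (h \<cdot> g) \<cdot> f = h \<cdot> (g \<cdot> f)"

definition is_functor ::
  "('i, 'm, 'y) cat_scheme \<Rightarrow> ('o, 'a, 'z) cat_scheme \<Rightarrow> ('i \<Rightarrow> 'o) \<Rightarrow> ('m \<Rightarrow> 'a) \<Rightarrow> bool" where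
  "is_functor J C F0 F1 \<longleftrightarrow>
     (\<forall>i\<in>Obj J. F0 i \<in> Obj C \<and> F1 (Id J i) = Id C (F0 i)) \<and>
     (\<forall>m\<in>Arr J. F1 m \<in> Hom C (F0 (Dom J m)) (F0 (Cod J m))) \<and>
     (\<forall>m\<in>Arr J. \<forall>n\<in>Arr J. Dom J n = Cod J m \<longrightarrow> F1 (n \<cdot>\<^bsub>J\<^esub> m) = F1 n \<cdot>\<^bsub>C\<^esub> F1 m)"

definition is_iso :: "('o, 'a, 'z) cat_scheme \<Rightarrow> 'a \<Rightarrow> bool" where
  "is_iso C f \<longleftrightarrow> f \<in> Arr C \<and>
     (\<exists>g \<in> Hom C (Cod C f) (Dom C f). g \<cdot>\<^bsub>C\<^esub> f = Id C (Dom C f) \<and> f \<cdot>\<^bsub>C\<^esub> g = Id C (Cod C f))"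

definition is_mono :: "('o, 'a, 'z) cat_scheme \<Rightarrow> 'a \<Rightarrow> bool" where
  "is_mono C f \<longleftrightarrow> f \<in> Arr C \<and>
     (\<forall>X\<in>Obj C. \<forall>g\<in>Hom C X (Dom C f). \<forall>h\<in>Hom C X (Dom C f).
        f \<cdot>\<^bsub>C\<^esub> g = f \<cdot>\<^bsub>C\<^esub> h \<longrightarrow> g = h)"

definition is_epi :: "('o, 'a, 'z) cat_scheme \<Rightarrow> 'a \<Rightarrow> bool" where
  "is_epi C f \<longleftrightarrow> f \<in> Arr C \<and>
     (\<forall>X\<in>Obj C. \<forall>g\<in>Hom C (Cod C f) X. \<forall>h\<in>Hom C (Cod C f) X.
        g \<cdot>\<^bsub>C\<^esub> f = h \<cdot>\<^bsub>C\<^esub> f \<longrightarrow> g = h)"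

definition zero_object :: "('o, 'a, 'z) cat_scheme \<Rightarrow> 'o \<Rightarrow> bool" where
  "zero_object C Z \<longleftrightarrow> Z \<in> Obj C \<and>
     (\<forall>X\<in>Obj C. (\<exists>!f. f \<in> Hom C X Z) \<and> (\<exists>!f. f \<in> Hom C Z X))"

definition zero_arrow :: "('o, 'a, 'z) cat_scheme \<Rightarrow> 'a \<Rightarrow> bool" where
  "zero_arrow C f \<longleftrightarrow> f \<in> Arr C \<and>
     (\<exists>Z a b. zero_object C Z \<and> a \<in> Hom C (Dom C f) Z \<and> b \<in> Hom C Z (Cod C f) \<and> f = b \<cdot>\<^bsub>C\<^esub> a)"

text \<open>In \<open>is_kernel C f k\<close> the arrow \<open>k\<close> is a kernel of \<open>f\<close>; in \<open>is_cokernel C f q\<close> the arrow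
  \<open>q\<close> is a cokernel of \<open>f\<close>.\<close>

definition is_kernel :: "('o, 'a, 'z) cat_scheme \<Rightarrow> 'a \<Rightarrow> 'a \<Rightarrow> bool" where
  "is_kernel C f k \<longleftrightarrow> f \<in> Arr C \<and> k \<in> Arr C \<and> Cod C k = Dom C f \<and> zero_arrow C (f \<cdot>\<^bsub>C\<^esub> k) \<and>
     (\<forall>X\<in>Obj C. \<forall>h\<in>Hom C X (Dom C f). zero_arrow C (f \<cdot>\<^bsub>C\<^esub> h) \<longrightarrow>
        (\<exists>!u. u \<in> Hom C X (Dom C k) \<and> k \<cdot>\<^bsub>C\<^esub> u = h))"

definition is_cokernel :: "('o, 'a, 'z) cat_scheme \<Rightarrow> 'a \<Rightarrow> 'a \<Rightarrow> bool" where
  "is_cokernel C f q \<longleftrightarrow> f \<in> Arr C \<and> q \<in> Arr C \<and> Dom C q = Cod C f \<and> zero_arrow C (q \<cdot>\<^bsub>C\<^esub> f) \<and>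
     (\<forall>X\<in>Obj C. \<forall>h\<in>Hom C (Cod C f) X. zero_arrow C (h \<cdot>\<^bsub>C\<^esub> f) \<longrightarrow>
        (\<exists>!u. u \<in> Hom C (Cod C q) X \<and> u \<cdot>\<^bsub>C\<^esub> q = h))"

definition strict_short_exact :: "('o, 'a, 'z) cat_scheme \<Rightarrow> 'a \<Rightarrow> 'a \<Rightarrow> bool" where
  "strict_short_exact C f g \<longleftrightarrow> is_kernel C g f \<and> is_cokernel C f g"

text \<open>Here \<open>c : Dom f \<rightarrow> coim f\<close> is the cokernel of a kernel \<open>k\<close> of \<open>f\<close>, \<open>m : im f \<rightarrow> Cod f\<close> is the
  kernel of a cokernel \<open>q\<close> of \<open>f\<close>, and \<open>u\<close> is the canonical arrow \<open>coim f \<rightarrow> im f\<close>.\<close>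

definition is_strict :: "('o, 'a, 'z) cat_scheme \<Rightarrow> 'a \<Rightarrow> bool" where
  "is_strict C f \<longleftrightarrow>
     (\<exists>k c q m u. is_kernel C f k \<and> is_cokernel C k c \<and> is_cokernel C f q \<and> is_kernel C q m \<and>
        u \<in> Hom C (Cod C c) (Dom C m) \<and> f = m \<cdot>\<^bsub>C\<^esub> u \<cdot>\<^bsub>C\<^esub> c \<and> is_iso C u)"

text \<open>The square consists of \<open>f : X \<rightarrow> Z\<close>, \<open>g : Y \<rightarrow> Z\<close> and \<open>g' : P \<rightarrow> X\<close>, \<open>f' : P \<rightarrow> Y\<close>, so that \<open>f'\<close> is
  the base change of \<open>f\<close> along \<open>g\<close>. Dually for push-outs.\<close>

definition is_pullback :: "('o, 'a, 'z) cat_scheme \<Rightarrow> 'a \<Rightarrow> 'a \<Rightarrow> 'a \<Rightarrow> 'a \<Rightarrow> bool" where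
  "is_pullback C f g f' g' \<longleftrightarrow>
     f \<in> Arr C \<and> g \<in> Arr C \<and> f' \<in> Arr C \<and> g' \<in> Arr C \<and>
     Cod C f = Cod C g \<and> Dom C f' = Dom C g' \<and> Cod C f' = Dom C g \<and> Cod C g' = Dom C f \<and>
     f \<cdot>\<^bsub>C\<^esub> g' = g \<cdot>\<^bsub>C\<^esub> f' \<and>
     (\<forall>T\<in>Obj C. \<forall>a\<in>Hom C T (Dom C f). \<forall>b\<in>Hom C T (Dom C g). f \<cdot>\<^bsub>C\<^esub> a = g \<cdot>\<^bsub>C\<^esub> b \<longrightarrow>
        (\<exists>!u. u \<in> Hom C T (Dom C f') \<and> g' \<cdot>\<^bsub>C\<^esub> u = a \<and> f' \<cdot>\<^bsub>C\<^esub> u = b))"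

definition is_pushout :: "('o, 'a, 'z) cat_scheme \<Rightarrow> 'a \<Rightarrow> 'a \<Rightarrow> 'a \<Rightarrow> 'a \<Rightarrow> bool" where
  "is_pushout C f g f' g' \<longleftrightarrow>
     f \<in> Arr C \<and> g \<in> Arr C \<and> f' \<in> Arr C \<and> g' \<in> Arr C \<and>
     Dom C f = Dom C g \<and> Cod C f' = Cod C g' \<and> Dom C f' = Cod C g \<and> Dom C g' = Cod C f \<and>
     g' \<cdot>\<^bsub>C\<^esub> f = f' \<cdot>\<^bsub>C\<^esub> g \<and>
     (\<forall>T\<in>Obj C. \<forall>a\<in>Hom C (Cod C f) T. \<forall>b\<in>Hom C (Cod C g) T. a \<cdot>\<^bsub>C\<^esub> f = b \<cdot>\<^bsub>C\<^esub> g \<longrightarrow>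
        (\<exists>!u. u \<in> Hom C (Cod C f') T \<and> u \<cdot>\<^bsub>C\<^esub> g' = a \<and> u \<cdot>\<^bsub>C\<^esub> f' = b))"

locale preadditive_category = category C
  for C :: "('o, 'a, 'z) cat_scheme" (structure) +
  fixes add :: "'a \<Rightarrow> 'a \<Rightarrow> 'a" and zero :: "'o \<Rightarrow> 'o \<Rightarrow> 'a"
  assumes Hom_comm_group: "X \<in> Obj C \<Longrightarrow> Y \<in> Obj C \<Longrightarrow>
      comm_group \<lparr>carrier = Hom C X Y, mult = add, one = zero X Y\<rparr>"
    and Comp_add: "f \<in> Hom C X Y \<Longrightarrow> g \<in> Hom C Y Z \<Longrightarrow> g' \<in> Hom C Y Z \<Longrightarrow>
      add g g' \<cdot> f = add (g \<cdot> f) (g' \<cdot> f)"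
    and add_Comp: "f \<in> Hom C X Y \<Longrightarrow> f' \<in> Hom C X Y \<Longrightarrow> g \<in> Hom C Y Z \<Longrightarrow>
      g \<cdot> add f f' = add (g \<cdot> f) (g \<cdot> f')"

definition is_product :: "('o, 'a, 'z) cat_scheme \<Rightarrow> 'o \<Rightarrow> 'o \<Rightarrow> 'a \<Rightarrow> 'a \<Rightarrow> bool" where
  "is_product C X Y p q \<longleftrightarrow>
     p \<in> Arr C \<and> q \<in> Arr C \<and> Dom C p = Dom C q \<and> Cod C p = X \<and> Cod C q = Y \<and>
     (\<forall>T\<in>Obj C. \<forall>a\<in>Hom C T X. \<forall>b\<in>Hom C T Y.
        \<exists>!u. u \<in> Hom C T (Dom C p) \<and> p \<cdot>\<^bsub>C\<^esub> u = a \<and> q \<cdot>\<^bsub>C\<^esub> u = b)"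

text \<open>The group structure on the \<open>Hom\<close> sets of an additive category is determined by the
  category, so it is quantified existentially instead of being part of the data.\<close>

definition additive_category :: "('o, 'a, 'z) cat_scheme \<Rightarrow> bool" where
  "additive_category C \<longleftrightarrow>
     (\<exists>add zero. preadditive_category C add zero) \<and>
     (\<exists>Z. zero_object C Z) \<and>
     (\<forall>X\<in>Obj C. \<forall>Y\<in>Obj C. \<exists>p q. is_product C X Y p q)"

definition quasi_abelian :: "('o, 'a, 'z) cat_scheme \<Rightarrow> bool" where
  "quasi_abelian C \<longleftrightarrow>
     additive_category C \<and>
     (\<forall>f\<in>Arr C. (\<exists>k. is_kernel C f k) \<and> (\<exists>q. is_cokernel C f q)) \<and>
     (\<forall>f g f' g'. is_pullback C f g f' g' \<and> is_strict C f \<and> is_epi C f \<longrightarrow>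
        is_strict C f' \<and> is_epi C f') \<and>
     (\<forall>f g f' g'. is_pushout C f g f' g' \<and> is_strict C f \<and> is_mono C f \<longrightarrow>
        is_strict C f' \<and> is_mono C f')"

record ('o, 'a) csm_cat = "('o, 'a) cat" +
  tens :: "'o \<Rightarrow> 'o \<Rightarrow> 'o" (infixr "\<otimes>\<^sub>o\<index>" 77)
  tens_arr :: "'a \<Rightarrow> 'a \<Rightarrow> 'a" (infixr "\<otimes>\<^sub>a\<index>" 77)
  munit :: 'o
  massoc :: "'o \<Rightarrow> 'o \<Rightarrow> 'o \<Rightarrow> 'a"
  lunit :: "'o \<Rightarrow> 'a"
  runit :: "'o \<Rightarrow> 'a"
  braid :: "'o \<Rightarrow> 'o \<Rightarrow> 'a"
  ihom :: "'o \<Rightarrow> 'o \<Rightarrow> 'o"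
  ev :: "'o \<Rightarrow> 'o \<Rightarrow> 'a"

locale closed_symmetric_monoidal_category = category C
  for C :: "('o, 'a, 'z) csm_cat_scheme" (structure) +
  assumes tens_Obj: "X \<in> Obj C \<Longrightarrow> Y \<in> Obj C \<Longrightarrow> X \<otimes>\<^sub>o Y \<in> Obj C"
    and tens_Hom: "f \<in> Hom C X X' \<Longrightarrow> g \<in> Hom C Y Y' \<Longrightarrow> f \<otimes>\<^sub>a g \<in> Hom C (X \<otimes>\<^sub>o Y) (X' \<otimes>\<^sub>o Y')"
    and tens_Id: "X \<in> Obj C \<Longrightarrow> Y \<in> Obj C \<Longrightarrow> Id C X \<otimes>\<^sub>a Id C Y = Id C (X \<otimes>\<^sub>o Y)"
    and tens_Comp: "f \<in> Hom C X X' \<Longrightarrow> f' \<in> Hom C X' X'' \<Longrightarrow> g \<in> Hom C Y Y' \<Longrightarrow> g' \<in> Hom C Y' Y'' \<Longrightarrow>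
      (f' \<cdot> f) \<otimes>\<^sub>a (g' \<cdot> g) = (f' \<otimes>\<^sub>a g') \<cdot> (f \<otimes>\<^sub>a g)"
    and munit_Obj: "munit C \<in> Obj C"
    and massoc_Hom: "X \<in> Obj C \<Longrightarrow> Y \<in> Obj C \<Longrightarrow> Z \<in> Obj C \<Longrightarrow>
      massoc C X Y Z \<in> Hom C ((X \<otimes>\<^sub>o Y) \<otimes>\<^sub>o Z) (X \<otimes>\<^sub>o (Y \<otimes>\<^sub>o Z))"
    and massoc_iso: "X \<in> Obj C \<Longrightarrow> Y \<in> Obj C \<Longrightarrow> Z \<in> Obj C \<Longrightarrow> is_iso C (massoc C X Y Z)"
    and massoc_natural: "f \<in> Hom C X X' \<Longrightarrow> g \<in> Hom C Y Y' \<Longrightarrow> h \<in> Hom C Z Z' \<Longrightarrow>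
      massoc C X' Y' Z' \<cdot> ((f \<otimes>\<^sub>a g) \<otimes>\<^sub>a h) = (f \<otimes>\<^sub>a (g \<otimes>\<^sub>a h)) \<cdot> massoc C X Y Z"
    and lunit_Hom: "X \<in> Obj C \<Longrightarrow> lunit C X \<in> Hom C (munit C \<otimes>\<^sub>o X) X"
    and lunit_iso: "X \<in> Obj C \<Longrightarrow> is_iso C (lunit C X)"
    and lunit_natural: "f \<in> Hom C X Y \<Longrightarrow> lunit C Y \<cdot> (Id C (munit C) \<otimes>\<^sub>a f) = f \<cdot> lunit C X"
    and runit_Hom: "X \<in> Obj C \<Longrightarrow> runit C X \<in> Hom C (X \<otimes>\<^sub>o munit C) X"
    and runit_iso: "X \<in> Obj C \<Longrightarrow> is_iso C (runit C X)"
    and runit_natural: "f \<in> Hom C X Y \<Longrightarrow> runit C Y \<cdot> (f \<otimes>\<^sub>a Id C (munit C)) = f \<cdot> runit C X"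
    and braid_Hom: "X \<in> Obj C \<Longrightarrow> Y \<in> Obj C \<Longrightarrow> braid C X Y \<in> Hom C (X \<otimes>\<^sub>o Y) (Y \<otimes>\<^sub>o X)"
    and braid_natural: "f \<in> Hom C X X' \<Longrightarrow> g \<in> Hom C Y Y' \<Longrightarrow>
      braid C X' Y' \<cdot> (f \<otimes>\<^sub>a g) = (g \<otimes>\<^sub>a f) \<cdot> braid C X Y"
    and pentagon: "W \<in> Obj C \<Longrightarrow> X \<in> Obj C \<Longrightarrow> Y \<in> Obj C \<Longrightarrow> Z \<in> Obj C \<Longrightarrow>
      massoc C W X (Y \<otimes>\<^sub>o Z) \<cdot> massoc C (W \<otimes>\<^sub>o X) Y Z =
      (Id C W \<otimes>\<^sub>a massoc C X Y Z) \<cdot> massoc C W (X \<otimes>\<^sub>o Y) Z \<cdot> (massoc C W X Y \<otimes>\<^sub>a Id C Z)"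
    and triangle: "X \<in> Obj C \<Longrightarrow> Y \<in> Obj C \<Longrightarrow>
      (Id C X \<otimes>\<^sub>a lunit C Y) \<cdot> massoc C X (munit C) Y = runit C X \<otimes>\<^sub>a Id C Y"
    and hexagon: "X \<in> Obj C \<Longrightarrow> Y \<in> Obj C \<Longrightarrow> Z \<in> Obj C \<Longrightarrow>
      massoc C Y Z X \<cdot> braid C X (Y \<otimes>\<^sub>o Z) \<cdot> massoc C X Y Z =
      (Id C Y \<otimes>\<^sub>a braid C X Z) \<cdot> massoc C Y X Z \<cdot> (braid C X Y \<otimes>\<^sub>a Id C Z)"
    and symmetry: "X \<in> Obj C \<Longrightarrow> Y \<in> Obj C \<Longrightarrow> braid C Y X \<cdot> braid C X Y = Id C (X \<otimes>\<^sub>o Y)"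
    and ihom_Obj: "X \<in> Obj C \<Longrightarrow> Y \<in> Obj C \<Longrightarrow> ihom C X Y \<in> Obj C"
    and ev_Hom: "X \<in> Obj C \<Longrightarrow> Y \<in> Obj C \<Longrightarrow> ev C X Y \<in> Hom C (ihom C X Y \<otimes>\<^sub>o X) Y"
    and ev_universal: "X \<in> Obj C \<Longrightarrow> Y \<in> Obj C \<Longrightarrow> Z \<in> Obj C \<Longrightarrow> f \<in> Hom C (Z \<otimes>\<^sub>o X) Y \<Longrightarrow>
      \<exists>!g. g \<in> Hom C Z (ihom C X Y) \<and> ev C X Y \<cdot> (g \<otimes>\<^sub>a Id C X) = f"

definition transpose :: "('o, 'a, 'z) csm_cat_scheme \<Rightarrow> 'o \<Rightarrow> 'o \<Rightarrow> 'o \<Rightarrow> 'a \<Rightarrow> 'a" where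
  "transpose C X Y Z f =
     (THE g. g \<in> Hom C Z (ihom C X Y) \<and> ev C X Y \<cdot>\<^bsub>C\<^esub> (g \<otimes>\<^sub>a\<^bsub>C\<^esub> Id C X) = f)"

definition ihom_arr :: "('o, 'a, 'z) csm_cat_scheme \<Rightarrow> 'o \<Rightarrow> 'a \<Rightarrow> 'a" where
  "ihom_arr C W g =
     transpose C W (Cod C g) (ihom C W (Dom C g)) (g \<cdot>\<^bsub>C\<^esub> ev C W (Dom C g))"

definition dual :: "('o, 'a, 'z) csm_cat_scheme \<Rightarrow> 'o \<Rightarrow> 'o" where
  "dual C W = ihom C W (munit C)"

text \<open>The transpose of
  \<open>(W\<^sup>\<or> \<otimes> V) \<otimes> W \<rightarrow> (V \<otimes> W\<^sup>\<or>) \<otimes> W \<rightarrow> V \<otimes> (W\<^sup>\<or> \<otimes> W) \<rightarrow> V \<otimes> e \<rightarrow> V\<close>.\<close>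

definition nuc_arr :: "('o, 'a, 'z) csm_cat_scheme \<Rightarrow> 'o \<Rightarrow> 'o \<Rightarrow> 'a" where
  "nuc_arr C W V =
     transpose C W V (dual C W \<otimes>\<^sub>o\<^bsub>C\<^esub> V)
       (runit C V \<cdot>\<^bsub>C\<^esub> (Id C V \<otimes>\<^sub>a\<^bsub>C\<^esub> ev C W (munit C)) \<cdot>\<^bsub>C\<^esub> massoc C V (dual C W) W \<cdot>\<^bsub>C\<^esub>
        (braid C (dual C W) V \<otimes>\<^sub>a\<^bsub>C\<^esub> Id C W))"

definition filtered :: "('i, 'm, 'y) cat_scheme \<Rightarrow> bool" where
  "filtered J \<longleftrightarrow> category J \<and> Obj J \<noteq> {} \<and>
     (\<forall>i\<in>Obj J. \<forall>j\<in>Obj J. \<exists>k\<in>Obj J. Hom J i k \<noteq> {} \<and> Hom J j k \<noteq> {}) \<and>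
     (\<forall>i\<in>Obj J. \<forall>j\<in>Obj J. \<forall>m\<in>Hom J i j. \<forall>n\<in>Hom J i j.
        \<exists>k\<in>Obj J. \<exists>h\<in>Hom J j k. h \<cdot>\<^bsub>J\<^esub> m = h \<cdot>\<^bsub>J\<^esub> n)"

text \<open>A formal filtered colimit of objects of \<open>C\<close>. The index category has its objects and its
  arrows in the type \<open>'i\<close>; this type plays the role of the universe of small sets. For infinite \<open>'i\<close> the
  ind-objects are those indexed by filtered categories of cardinality at most that of \<open>'i\<close>.\<close>

record ('i, 'o, 'a) ind_obj =
  idx :: "('i, 'i) cat"
  ob :: "'i \<Rightarrow> 'o"
  ar :: "'i \<Rightarrow> 'a"

definition ind_object :: "('o, 'a, 'z) cat_scheme \<Rightarrow> ('i, 'o, 'a) ind_obj \<Rightarrow> bool" where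
  "ind_object C E \<longleftrightarrow> filtered (idx E) \<and> is_functor (idx E) C (ob E) (ar E)"

text \<open>\<open>colim_hom C X F\<close> is the filtered colimit of the sets \<open>Hom(X, F\<^sub>j)\<close>, the quotient of the set of
  all \<open>(j, \<phi>)\<close> with \<open>\<phi> : X \<rightarrow> F\<^sub>j\<close> by the relation \<open>colim_rel C X F\<close>.\<close>

definition colim_rel ::
  "('o, 'a, 'z) cat_scheme \<Rightarrow> 'o \<Rightarrow> ('j, 'o, 'a) ind_obj \<Rightarrow> (('j \<times> 'a) \<times> ('j \<times> 'a)) set" where
  "colim_rel C X F = {((j, \<phi>), (j', \<phi>')).
     j \<in> Obj (idx F) \<and> j' \<in> Obj (idx F) \<and> \<phi> \<in> Hom C X (ob F j) \<and> \<phi>' \<in> Hom C X (ob F j') \<and>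
     (\<exists>k\<in>Obj (idx F). \<exists>u\<in>Hom (idx F) j k. \<exists>v\<in>Hom (idx F) j' k.
        ar F u \<cdot>\<^bsub>C\<^esub> \<phi> = ar F v \<cdot>\<^bsub>C\<^esub> \<phi>')}"

definition colim_hom ::
  "('o, 'a, 'z) cat_scheme \<Rightarrow> 'o \<Rightarrow> ('j, 'o, 'a) ind_obj \<Rightarrow> ('j \<times> 'a) set set" where
  "colim_hom C X F = (SIGMA j:Obj (idx F). Hom C X (ob F j)) // colim_rel C X F"

text \<open>\<open>ind_hom C E F\<close> is the limit over \<open>i\<close> of the sets \<open>colim_hom C E\<^sub>i F\<close>. A morphism is a family
  indexed by \<open>i\<close>, made unique by the value \<open>{}\<close> (which is not a class) outside of the index set.\<close>

definition ind_hom ::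
  "('o, 'a, 'z) cat_scheme \<Rightarrow> ('i, 'o, 'a) ind_obj \<Rightarrow> ('j, 'o, 'a) ind_obj \<Rightarrow>
    ('i \<Rightarrow> ('j \<times> 'a) set) set" where
  "ind_hom C E F = {x.
     (\<forall>i\<in>Obj (idx E). x i \<in> colim_hom C (ob E i) F) \<and>
     (\<forall>i. i \<notin> Obj (idx E) \<longrightarrow> x i = {}) \<and>
     (\<forall>m\<in>Arr (idx E). \<forall>(j, \<phi>)\<in>x (Cod (idx E) m). (j, \<phi> \<cdot>\<^bsub>C\<^esub> ar E m) \<in> x (Dom (idx E) m))}"

definition ind_id ::
  "('o, 'a, 'z) cat_scheme \<Rightarrow> ('i, 'o, 'a) ind_obj \<Rightarrow> 'i \<Rightarrow> ('i \<times> 'a) set" where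
  "ind_id C E i =
     (if i \<in> Obj (idx E) then colim_rel C (ob E i) E `` {(i, Id C (ob E i))} else {})"

definition ind_comp ::
  "('o, 'a, 'z) cat_scheme \<Rightarrow> ('i, 'o, 'a) ind_obj \<Rightarrow> ('k, 'o, 'a) ind_obj \<Rightarrow>
    ('j \<Rightarrow> ('k \<times> 'a) set) \<Rightarrow> ('i \<Rightarrow> ('j \<times> 'a) set) \<Rightarrow> 'i \<Rightarrow> ('k \<times> 'a) set" where
  "ind_comp C E G y x i =
     colim_rel C (ob E i) G `` {(k, \<psi> \<cdot>\<^bsub>C\<^esub> \<phi>) | j \<phi> k \<psi>. (j, \<phi>) \<in> x i \<and> (k, \<psi>) \<in> y j}"

text \<open>\<open>Ind C\<close> consists of the ind-objects with indices in \<open>'i\<close>. The functions \<open>ind_hom\<close> and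
  \<open>ind_comp\<close> also make sense across different index types.\<close>

definition Ind ::
  "('o, 'a, 'z) cat_scheme \<Rightarrow> (('i, 'o, 'a) ind_obj,
    ('i, 'o, 'a) ind_obj \<times> ('i, 'o, 'a) ind_obj \<times> ('i \<Rightarrow> ('i \<times> 'a) set)) cat" where
  "Ind C = \<lparr>
     Obj = {E. ind_object C E},
     Arr = {(E, F, x). ind_object C E \<and> ind_object C F \<and> x \<in> ind_hom C E F},
     Dom = (\<lambda>(E, F, x). E),
     Cod = (\<lambda>(E, F, x). F),
     Id = (\<lambda>E. (E, E, ind_id C E)),
     Comp = (\<lambda>(F, G, y) (E, F', x). (E, G, ind_comp C E G y x))\<rparr>"

definition ind_iso ::
  "('o, 'a, 'z) cat_scheme \<Rightarrow> ('i, 'o, 'a) ind_obj \<Rightarrow> ('j, 'o, 'a) ind_obj \<Rightarrow>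
    ('i \<Rightarrow> ('j \<times> 'a) set) \<Rightarrow> bool" where
  "ind_iso C E F x \<longleftrightarrow> x \<in> ind_hom C E F \<and>
     (\<exists>y\<in>ind_hom C F E. ind_comp C E E y x = ind_id C E \<and> ind_comp C F F x y = ind_id C F)"

definition prod_cat :: "('i, 'm) cat \<Rightarrow> ('j, 'n) cat \<Rightarrow> ('i \<times> 'j, 'm \<times> 'n) cat" where
  "prod_cat I J = \<lparr>
     Obj = Obj I \<times> Obj J,
     Arr = Arr I \<times> Arr J,
     Dom = map_prod (Dom I) (Dom J),
     Cod = map_prod (Cod I) (Cod J),
     Id = map_prod (Id I) (Id J),
     Comp = (\<lambda>(m, n) (m', n'). (m \<cdot>\<^bsub>I\<^esub> m', n \<cdot>\<^bsub>J\<^esub> n'))\<rparr>"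

definition ind_tens ::
  "('o, 'a, 'z) csm_cat_scheme \<Rightarrow> ('i, 'o, 'a) ind_obj \<Rightarrow> ('j, 'o, 'a) ind_obj \<Rightarrow>
    ('i \<times> 'j, 'o, 'a) ind_obj" where
  "ind_tens C E F = \<lparr>
     idx = prod_cat (idx E) (idx F),
     ob = (\<lambda>(i, j). ob E i \<otimes>\<^sub>o\<^bsub>C\<^esub> ob F j),
     ar = (\<lambda>(m, n). ar E m \<otimes>\<^sub>a\<^bsub>C\<^esub> ar F n)\<rparr>"

definition point_cat :: "(unit, unit) cat" where
  "point_cat = \<lparr>Obj = UNIV, Arr = UNIV, Dom = id, Cod = id, Id = id, Comp = (\<lambda>_ _. ())\<rparr>"

definition ind_const :: "('o, 'a, 'z) cat_scheme \<Rightarrow> 'o \<Rightarrow> (unit, 'o, 'a) ind_obj" where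
  "ind_const C W = \<lparr>idx = point_cat, ob = (\<lambda>_. W), ar = (\<lambda>_. Id C W)\<rparr>"

text \<open>The internal Hom from a constant ind-object \<open>W\<close>: in the formula for
  \<open>\<^emph>\<open>Hom\<close>("colim"\<^sub>i E\<^sub>i, "colim"\<^sub>j F\<^sub>j)\<close> as the limit over \<open>i\<close> of \<open>"colim"\<^sub>j \<^emph>\<open>Hom\<close>(E\<^sub>i, F\<^sub>j)\<close>
  the index \<open>i\<close> runs over a point, so that no limit remains. Only this case occurs in the definition of
  nuclearity.\<close>

definition ind_ihom ::
  "('o, 'a, 'z) csm_cat_scheme \<Rightarrow> 'o \<Rightarrow> ('j, 'o, 'a) ind_obj \<Rightarrow> ('j, 'o, 'a) ind_obj" where
  "ind_ihom C W V = \<lparr>idx = idx V, ob = (\<lambda>j. ihom C W (ob V j)), ar = (\<lambda>n. ihom_arr C W (ar V n))\<rparr>"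

text \<open>The morphism \<open>W\<^sup>\<or> \<otimes> V \<rightarrow> \<^emph>\<open>Hom\<close>(W, V)\<close> that is the class of the canonical arrow
  \<open>W\<^sup>\<or> \<otimes> V\<^sub>j \<rightarrow> \<^emph>\<open>Hom\<close>(W, V\<^sub>j)\<close> of \<open>C\<close> at the index \<open>((), j)\<close>.\<close>

definition ind_nuc ::
  "('o, 'a, 'z) csm_cat_scheme \<Rightarrow> 'o \<Rightarrow> ('j, 'o, 'a) ind_obj \<Rightarrow> unit \<times> 'j \<Rightarrow> ('j \<times> 'a) set" where
  "ind_nuc C W V = (\<lambda>(_, j).
     if j \<in> Obj (idx V)
     then colim_rel C (dual C W \<otimes>\<^sub>o\<^bsub>C\<^esub> ob V j) (ind_ihom C W V) `` {(j, nuc_arr C W (ob V j))}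
     else {})"

definition nuclear :: "('o, 'a, 'z) csm_cat_scheme \<Rightarrow> ('j, 'o, 'a) ind_obj \<Rightarrow> bool" where
  "nuclear C V \<longleftrightarrow>
     (\<forall>W\<in>Obj C. ind_iso C (ind_tens C (ind_const C (dual C W)) V) (ind_ihom C W V) (ind_nuc C W V))"

end

theory Submission
  imports Defs
begin

text \<open>Write \<open>F = W\<^sup>\<or> \<otimes> _\<close> and \<open>G = Hom(W, _)\<close>, with the natural transformation \<open>n : F \<rightarrow> G\<close> that defines
  nuclearity. If \<open>Ind C\<close> is known to be quasi-abelian, the theorem is the short five lemma. The row of \<open>G\<close> is left
  exact and the row of \<open>F\<close> is right exact. Since \<open>n\<close> is an isomorphism at \<open>V\<^sub>1\<close> and \<open>V\<^sub>3\<close>, the first arrow of the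
  row of \<open>F\<close> is a strict monomorphism, because it is one when followed by \<open>n\<close>, and the last arrow of the row of \<open>G\<close>
  is a strict epimorphism, because it is one when preceded by \<open>n\<close>.

  The proof below uses only that \<open>C\<close> itself is quasi-abelian, and works with arrows \<open>X \<rightarrow> V\<^sub>j\<close> of \<open>C\<close>. By
  \<open>nuclear_elementwise\<close>, \<open>V\<close> is nuclear if and only if, for all \<open>W\<close>, every \<open>a : X \<rightarrow> F V\<^sub>j\<close> with \<open>n a = 0\<close> vanishes at
  a later index and every \<open>b : X \<rightarrow> G V\<^sub>j\<close> is of the form \<open>n a\<close> at a later index.

  Two facts about \<open>Ind C\<close> are needed. An arrow into \<open>V\<^sub>2\<close> that is killed by \<open>g\<close> comes from \<open>V\<^sub>1\<close>
  (\<open>ind_kernel_factor\<close>). The cokernel property of \<open>g\<close> (\<open>ind_cokernel_presentation\<close>) gives, for every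
  representative \<open>p : V\<^sub>2\<^sub>,\<^sub>j \<rightarrow> V\<^sub>3\<^sub>,\<^sub>k\<close> of \<open>g\<close>, a strict short exact sequence \<open>N \<rightarrow> V\<^sub>2\<^sub>,\<^sub>j\<^sub>' \<rightarrow> Q\<close> of \<open>C\<close> and arrows
  \<open>\<xi> : V\<^sub>3\<^sub>,\<^sub>k \<rightarrow> Q\<close> and \<open>v : Q \<rightarrow> V\<^sub>3\<^sub>,\<^sub>k\<^sub>'\<close>, where \<open>v \<xi>\<close> is a transition arrow, \<open>v \<pi>\<close> represents \<open>g\<close> and \<open>\<xi> p\<close> is
  the transition arrow of \<open>V\<^sub>2\<close> followed by the projection \<open>\<pi>\<close>. It is obtained by applying the universal property to
  the formal colimit of the coimages of all representatives of \<open>g\<close>, through which \<open>g\<close> factors.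

  Injectivity of \<open>n\<close> at \<open>V\<^sub>2\<close> (\<open>nuc_inj_extension\<close>): if \<open>n a = 0\<close>, then \<open>F p a = 0\<close> for some \<open>p\<close>, so \<open>F \<pi>\<close> kills the
  image of \<open>a\<close>. The arrow \<open>N \<rightarrow> V\<^sub>2\<close> factors through \<open>V\<^sub>1\<close>, whose nuclearity gives an arrow from \<open>G N\<close> to \<open>F V\<^sub>1\<close>
  and then to \<open>F V\<^sub>2\<close>. The push-out of \<open>G N \<rightarrow> G V\<^sub>2\<^sub>,\<^sub>j\<^sub>'\<close> along it receives \<open>F V\<^sub>2\<close> by a monomorphism, and in the
  push-out \<open>a\<close> becomes zero because \<open>n a = 0\<close>.

  Surjectivity (\<open>nuc_surj_extension\<close>): the image of \<open>b\<close> in \<open>G V\<^sub>3\<close> is some \<open>n a\<^sub>3\<close>. The pull-back of \<open>F \<pi>\<close>, which is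
  again a cokernel, along \<open>F \<xi> a\<^sub>3\<close> is a strict epimorphism \<open>s\<close>, over which \<open>a\<^sub>3\<close> lifts to \<open>F V\<^sub>2\<close>. The error
  comes from \<open>G V\<^sub>1\<close>, hence from \<open>F V\<^sub>1\<close>, and the resulting solution over \<open>s\<close> descends by injectivity.\<close>

section \<open>Preadditive categories\<close>

context category
begin

lemma Hom_ObjD: "f \<in> Hom C X Y \<Longrightarrow> X \<in> Obj C" "f \<in> Hom C X Y \<Longrightarrow> Y \<in> Obj C"
  using Dom_Obj Cod_Obj by (auto simp: Hom_def)

lemma Hom_self: "f \<in> Arr C \<Longrightarrow> f \<in> Hom C (Dom C f) (Cod C f)"
  by (simp add: Hom_def)

lemma Id_simps [simp]:
  "X \<in> Obj C \<Longrightarrow> Id C X \<in> Arr C" "X \<in> Obj C \<Longrightarrow> Dom C (Id C X) = X"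
  "X \<in> Obj C \<Longrightarrow> Cod C (Id C X) = X"
  using Id_Hom by (auto simp: Hom_def)

lemma Comp_simps [simp]:
  assumes "f \<in> Arr C" "g \<in> Arr C" "Cod C f = Dom C g"
  shows "g \<cdot> f \<in> Arr C" "Dom C (g \<cdot> f) = Dom C f" "Cod C (g \<cdot> f) = Cod C g"
  using Comp_Hom[of f "Dom C f" "Cod C f" g "Cod C g"] assms by (auto simp: Hom_def)

lemma Comp_assoc_simp [simp]:
  assumes "f \<in> Arr C" "g \<in> Arr C" "h \<in> Arr C" "Cod C f = Dom C g" "Cod C g = Dom C h"
  shows "(h \<cdot> g) \<cdot> f = h \<cdot> (g \<cdot> f)"
  using Comp_assoc assms by (auto simp: Hom_def)

lemma Comp_Id_simps [simp]:
  "f \<in> Arr C \<Longrightarrow> Dom C f = X \<Longrightarrow> f \<cdot> Id C X = f"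
  "f \<in> Arr C \<Longrightarrow> Cod C f = X \<Longrightarrow> Id C X \<cdot> f = f"
  using Comp_Id Id_Comp by (auto simp: Hom_def)

text \<open>Rewriting a composable pair inside a right-nested composite.\<close>

lemma Comp_rewrite:
  assumes "g \<cdot> f = k \<cdot> h" "f \<in> Hom C X Y" "g \<in> Hom C Y Z" "h \<in> Hom C X Y'" "k \<in> Hom C Y' Z"
    "x \<in> Hom C U X"
  shows "g \<cdot> f \<cdot> x = k \<cdot> h \<cdot> x"
  using Comp_assoc[OF assms(6,2,3)] Comp_assoc[OF assms(6,4,5)] assms(1) by simp

lemma Comp_rewrite1:
  assumes "g \<cdot> f = k" "f \<in> Hom C X Y" "g \<in> Hom C Y Z" "x \<in> Hom C U X"
  shows "g \<cdot> f \<cdot> x = k \<cdot> x"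
  using Comp_assoc[OF assms(4,2,3)] assms(1) by simp

end

context preadditive_category
begin

text \<open>The abelian group of arrows from \<open>X\<close> to \<open>Y\<close>.\<close>

abbreviation HomGroup where
  "HomGroup X Y \<equiv> \<lparr>carrier = Hom C X Y, mult = add, one = zero X Y\<rparr>"

text \<open>The difference \<open>f - g\<close> of two parallel arrows; the group is read off the first one.\<close>

definition sub :: "'a \<Rightarrow> 'a \<Rightarrow> 'a" where
  "sub f g = add f (inv\<^bsub>HomGroup (Dom C f) (Cod C f)\<^esub> g)"

lemma zero_Hom: "X \<in> Obj C \<Longrightarrow> Y \<in> Obj C \<Longrightarrow> zero X Y \<in> Hom C X Y"
  using Hom_comm_group[THEN comm_group.axioms(2), THEN group.is_monoid, THEN monoid.one_closed, of X Y]
  by simp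

lemma add_Hom: assumes "f \<in> Hom C X Y" "g \<in> Hom C X Y" shows "add f g \<in> Hom C X Y"
proof -
  interpret comm_group "HomGroup X Y" by (rule Hom_comm_group[OF Hom_ObjD(1)[OF assms(1)] Hom_ObjD(2)[OF assms(1)]])
  show ?thesis using m_closed assms by simp
qed

lemma sub_Hom: assumes "f \<in> Hom C X Y" "g \<in> Hom C X Y" shows "sub f g \<in> Hom C X Y"
proof -
  interpret comm_group "HomGroup X Y" by (rule Hom_comm_group[OF Hom_ObjD(1)[OF assms(1)] Hom_ObjD(2)[OF assms(1)]])
  have "Dom C f = X" "Cod C f = Y" using assms by (auto simp: Hom_def)
  then show ?thesis using m_closed[of f "inv\<^bsub>HomGroup X Y\<^esub> g"] inv_closed[of g] assms
    by (simp add: sub_def)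
qed

lemma add_sub: assumes "f \<in> Hom C X Y" "g \<in> Hom C X Y" shows "add (sub f g) g = f"
proof -
  interpret comm_group "HomGroup X Y" by (rule Hom_comm_group[OF Hom_ObjD(1)[OF assms(1)] Hom_ObjD(2)[OF assms(1)]])
  have "Dom C f = X" "Cod C f = Y" using assms by (auto simp: Hom_def)
  then show ?thesis using m_assoc[of f "inv\<^bsub>HomGroup X Y\<^esub> g" g] l_inv[of g] inv_closed[of g] r_one assms
    by (simp add: sub_def)
qed

lemma add_zero: assumes "f \<in> Hom C X Y"
  shows "add (zero X Y) f = f" "add f (zero X Y) = f"
proof -
  interpret comm_group "HomGroup X Y" by (rule Hom_comm_group[OF Hom_ObjD(1)[OF assms] Hom_ObjD(2)[OF assms]])
  show "add (zero X Y) f = f" "add f (zero X Y) = f" using l_one r_one assms by simp_all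
qed

lemma add_right_cancel:
  assumes "f \<in> Hom C X Y" "g \<in> Hom C X Y" "h \<in> Hom C X Y" "add f h = add g h"
  shows "f = g"
proof -
  interpret comm_group "HomGroup X Y" by (rule Hom_comm_group[OF Hom_ObjD(1)[OF assms(1)] Hom_ObjD(2)[OF assms(1)]])
  show ?thesis using right_cancel[of h f g] assms by simp
qed

lemma sub_eq_zero_iff:
  assumes "f \<in> Hom C X Y" "g \<in> Hom C X Y"
  shows "sub f g = zero X Y \<longleftrightarrow> f = g"
proof
  assume "sub f g = zero X Y"
  then show "f = g" using add_sub[OF assms] add_zero[OF assms(2)] by simp
next
  assume "f = g"
  then have "add (sub f g) g = add (zero X Y) g" using add_sub[OF assms] add_zero[OF assms(2)] by simp
  then show "sub f g = zero X Y"
    using add_right_cancel sub_Hom assms zero_Hom Hom_ObjD by metis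
qed

lemma zero_Comp:
  assumes "f \<in> Hom C X Y" "Z \<in> Obj C" shows "zero Y Z \<cdot> f = zero X Z"
proof -
  have z: "zero Y Z \<in> Hom C Y Z" "zero X Z \<in> Hom C X Z" using assms zero_Hom Hom_ObjD by auto
  have m: "zero Y Z \<cdot> f \<in> Hom C X Z" using Comp_Hom[OF assms(1) z(1)] .
  have "add (zero Y Z \<cdot> f) (zero Y Z \<cdot> f) = add (zero X Z) (zero Y Z \<cdot> f)"
    using Comp_add[OF assms(1) z(1) z(1)] add_zero z m by simp
  then show ?thesis using add_right_cancel z(2) m by blast
qed

lemma Comp_zero:
  assumes "f \<in> Hom C Y Z" "X \<in> Obj C" shows "f \<cdot> zero X Y = zero X Z"
proof -
  have z: "zero X Y \<in> Hom C X Y" "zero X Z \<in> Hom C X Z" using assms zero_Hom Hom_ObjD by auto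
  have m: "f \<cdot> zero X Y \<in> Hom C X Z" using Comp_Hom[OF z(1) assms(1)] .
  have "add (f \<cdot> zero X Y) (f \<cdot> zero X Y) = add (zero X Z) (f \<cdot> zero X Y)"
    using add_Comp[OF z(1) z(1) assms(1)] add_zero z m by simp
  then show ?thesis using add_right_cancel z(2) m by blast
qed

lemma sub_Comp:
  assumes "f \<in> Hom C X Y" "g \<in> Hom C Y Z" "g' \<in> Hom C Y Z"
  shows "sub g g' \<cdot> f = sub (g \<cdot> f) (g' \<cdot> f)"
proof -
  have "add (sub g g' \<cdot> f) (g' \<cdot> f) = add (sub (g \<cdot> f) (g' \<cdot> f)) (g' \<cdot> f)"
    using Comp_add[OF assms(1) sub_Hom[OF assms(2,3)] assms(3)] add_sub assms Comp_Hom by metis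
  then show ?thesis using add_right_cancel assms Comp_Hom sub_Hom by meson
qed

lemma Comp_sub:
  assumes "f \<in> Hom C X Y" "f' \<in> Hom C X Y" "g \<in> Hom C Y Z"
  shows "g \<cdot> sub f f' = sub (g \<cdot> f) (g \<cdot> f')"
proof -
  have "add (g \<cdot> sub f f') (g \<cdot> f') = add (sub (g \<cdot> f) (g \<cdot> f')) (g \<cdot> f')"
    using add_Comp[OF sub_Hom[OF assms(1,2)] assms(2,3)] add_sub assms Comp_Hom by metis
  then show ?thesis using add_right_cancel assms Comp_Hom sub_Hom by meson
qed

end

section \<open>Quasi-abelian categories\<close>

text \<open>A quasi-abelian category with a chosen group structure on its \<open>Hom\<close> sets.\<close>

locale quasi_abelian_category = preadditive_category C add zero
  for C :: "('o, 'a, 'z) cat_scheme" (structure) and add zero +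
  assumes qa: "quasi_abelian C"
begin

lemma zero_object_exists: "\<exists>Z. zero_object C Z"
  using qa unfolding quasi_abelian_def additive_category_def by (elim conjE)

text \<open>The zero arrows are the neutral elements of the \<open>Hom\<close> groups. This makes kernels and cokernels
  computable with \<open>zero\<close>.\<close>

lemma zero_arrow_iff:
  assumes "f \<in> Hom C X Y" shows "zero_arrow C f \<longleftrightarrow> f = zero X Y"
proof -
  have XY: "X \<in> Obj C" "Y \<in> Obj C" using assms Hom_ObjD by auto
  have id0: "Id C Z = zero Z Z" if "zero_object C Z" for Z
    using that zero_Hom Id_Hom unfolding zero_object_def by (metis (lifting))
  show ?thesis
  proof
    assume "zero_arrow C f"
    then obtain Z a b where Z: "zero_object C Z" "a \<in> Hom C X Z" "b \<in> Hom C Z Y" "f = b \<cdot> a"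
      using assms unfolding zero_arrow_def Hom_def by auto
    have "a = zero Z Z \<cdot> a" using id0[OF Z(1)] Id_Comp[OF Z(2)] by simp
    then have "a = zero X Z" using zero_Comp[OF Z(2)] Hom_ObjD(2)[OF Z(2)] by simp
    then show "f = zero X Y" using Comp_zero[OF Z(3) XY(1)] Z by simp
  next
    assume f: "f = zero X Y"
    obtain Z where Z: "zero_object C Z" using zero_object_exists by blast
    then have ZO: "Z \<in> Obj C" unfolding zero_object_def by auto
    have "f = zero Z Y \<cdot> zero X Z" using f zero_Comp zero_Hom ZO XY by metis
    then show "zero_arrow C f" unfolding zero_arrow_def using Z ZO XY assms zero_Hom
      by (auto simp: Hom_def intro!: exI[of _ Z])
  qed
qed

lemma kernel_exists: assumes "f \<in> Hom C Y Z" obtains k where "is_kernel C f k"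
proof -
  have "f \<in> Arr C" using assms by (simp add: Hom_def)
  then show ?thesis using that qa[unfolded quasi_abelian_def] by blast
qed

lemma cokernel_exists: assumes "f \<in> Hom C Y Z" obtains q where "is_cokernel C f q"
proof -
  have "f \<in> Arr C" using assms by (simp add: Hom_def)
  then show ?thesis using that qa[unfolded quasi_abelian_def] by blast
qed

lemma is_kernel_iff:
  assumes f: "f \<in> Hom C Y Z"
  shows "is_kernel C f k \<longleftrightarrow> k \<in> Hom C (Dom C k) Y \<and> f \<cdot> k = zero (Dom C k) Z \<and>
    (\<forall>X h. h \<in> Hom C X Y \<longrightarrow> f \<cdot> h = zero X Z \<longrightarrow> (\<exists>!u. u \<in> Hom C X (Dom C k) \<and> k \<cdot> u = h))"
    (is "?L \<longleftrightarrow> ?R")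
proof
  assume L: ?L
  then have k: "k \<in> Hom C (Dom C k) Y" using f unfolding is_kernel_def Hom_def by auto
  have "f \<cdot> k = zero (Dom C k) Z"
    using zero_arrow_iff[OF Comp_Hom[OF k f]] L unfolding is_kernel_def by auto
  moreover have "\<exists>!u. u \<in> Hom C X (Dom C k) \<and> k \<cdot> u = h" if h: "h \<in> Hom C X Y" "f \<cdot> h = zero X Z" for X h
    using L h f zero_arrow_iff[OF Comp_Hom[OF h(1) f]] Hom_ObjD[OF h(1)]
    unfolding is_kernel_def Hom_def by auto
  ultimately show ?R using k by auto
next
  assume R: ?R
  then have k: "k \<in> Hom C (Dom C k) Y" by auto
  have fY: "Dom C f = Y" "f \<in> Arr C" using f by (auto simp: Hom_def)
  have "zero_arrow C (f \<cdot> k)" using zero_arrow_iff[OF Comp_Hom[OF k f]] R by auto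
  moreover have "\<exists>!u. u \<in> Hom C X (Dom C k) \<and> k \<cdot> u = h"
    if h: "h \<in> Hom C X Y" "zero_arrow C (f \<cdot> h)" for X h
    using R h zero_arrow_iff[OF Comp_Hom[OF h(1) f]] by auto
  moreover have "k \<in> Arr C" "Cod C k = Y" using k by (auto simp: Hom_def)
  ultimately show ?L unfolding is_kernel_def fY(1) using fY(2) by blast
qed

lemma is_cokernel_iff:
  assumes f: "f \<in> Hom C Y Z"
  shows "is_cokernel C f q \<longleftrightarrow> q \<in> Hom C Z (Cod C q) \<and> q \<cdot> f = zero Y (Cod C q) \<and>
    (\<forall>X h. h \<in> Hom C Z X \<longrightarrow> h \<cdot> f = zero Y X \<longrightarrow> (\<exists>!u. u \<in> Hom C (Cod C q) X \<and> u \<cdot> q = h))"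
    (is "?L \<longleftrightarrow> ?R")
proof
  assume L: ?L
  then have k: "q \<in> Hom C Z (Cod C q)" using f unfolding is_cokernel_def Hom_def by auto
  have "q \<cdot> f = zero Y (Cod C q)"
    using zero_arrow_iff[OF Comp_Hom[OF f k]] L unfolding is_cokernel_def by auto
  moreover have "\<exists>!u. u \<in> Hom C (Cod C q) X \<and> u \<cdot> q = h" if h: "h \<in> Hom C Z X" "h \<cdot> f = zero Y X" for X h
    using L h f zero_arrow_iff[OF Comp_Hom[OF f h(1)]] Hom_ObjD[OF h(1)]
    unfolding is_cokernel_def Hom_def by auto
  ultimately show ?R using k by auto
next
  assume R: ?R
  then have k: "q \<in> Hom C Z (Cod C q)" by auto
  have fY: "Cod C f = Z" "f \<in> Arr C" using f by (auto simp: Hom_def)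
  have "zero_arrow C (q \<cdot> f)" using zero_arrow_iff[OF Comp_Hom[OF f k]] R by auto
  moreover have "\<exists>!u. u \<in> Hom C (Cod C q) X \<and> u \<cdot> q = h"
    if h: "h \<in> Hom C Z X" "zero_arrow C (h \<cdot> f)" for X h
    using R h zero_arrow_iff[OF Comp_Hom[OF f h(1)]] by auto
  moreover have "q \<in> Arr C" "Dom C q = Z" using k by (auto simp: Hom_def)
  ultimately show ?L unfolding is_cokernel_def fY(1) using fY(2) by blast
qed

lemma kernel_factor:
  assumes "is_kernel C f k" "f \<in> Hom C Y Z" "h \<in> Hom C X Y" "f \<cdot> h = zero X Z"
  obtains u where "u \<in> Hom C X (Dom C k)" "k \<cdot> u = h"
  using assms is_kernel_iff[OF assms(2)] by blast

lemma cokernel_factor: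
  assumes "is_cokernel C f q" "f \<in> Hom C Y Z" "h \<in> Hom C Z X" "h \<cdot> f = zero Y X"
  obtains u where "u \<in> Hom C (Cod C q) X" "u \<cdot> q = h"
  using assms is_cokernel_iff[OF assms(2)] by blast

lemma kernel_cancel:
  assumes "is_kernel C f k" "u \<in> Hom C X (Dom C k)" "u' \<in> Hom C X (Dom C k)" "k \<cdot> u = k \<cdot> u'"
  shows "u = u'"
proof -
  obtain Y Z where f: "f \<in> Hom C Y Z" using assms(1) Hom_self unfolding is_kernel_def by blast
  note K = is_kernel_iff[OF f, THEN iffD1, OF assms(1)]
  have k: "k \<in> Hom C (Dom C k) Y" using K by blast
  have "f \<cdot> (k \<cdot> u) = zero X Z"
    using Comp_assoc[OF assms(2) k f] K zero_Comp[OF assms(2)] Hom_ObjD[OF f] by metis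
  then show ?thesis using K Comp_Hom[OF assms(2) k] assms by metis
qed

lemma cokernel_cancel:
  assumes "is_cokernel C f q" "u \<in> Hom C (Cod C q) X" "u' \<in> Hom C (Cod C q) X" "u \<cdot> q = u' \<cdot> q"
  shows "u = u'"
proof -
  obtain Y Z where f: "f \<in> Hom C Y Z" using assms(1) Hom_self unfolding is_cokernel_def by blast
  note K = is_cokernel_iff[OF f, THEN iffD1, OF assms(1)]
  have k: "q \<in> Hom C Z (Cod C q)" using K by blast
  have "(u \<cdot> q) \<cdot> f = zero Y X"
    using Comp_assoc[OF f k assms(2)] K Comp_zero[OF assms(2)] Hom_ObjD[OF f] by metis
  then show ?thesis using K Comp_Hom[OF k assms(2)] assms by metis
qed

lemma cokernel_epi: assumes "is_cokernel C f q" shows "is_epi C q"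
  unfolding is_epi_def using cokernel_cancel[OF assms] assms unfolding is_cokernel_def by blast

lemma kernel_mono: assumes "is_kernel C f k" shows "is_mono C k"
  unfolding is_mono_def using kernel_cancel[OF assms] assms unfolding is_kernel_def by blast

lemma mono_cancel:
  "is_mono C f \<Longrightarrow> f \<in> Hom C Y Z \<Longrightarrow> u \<in> Hom C X Y \<Longrightarrow> u' \<in> Hom C X Y \<Longrightarrow> f \<cdot> u = f \<cdot> u' \<Longrightarrow> u = u'"
  unfolding is_mono_def using Hom_ObjD by (metis (mono_tags, lifting) Hom_def mem_Collect_eq)

lemma epi_cancel:
  "is_epi C f \<Longrightarrow> f \<in> Hom C Y Z \<Longrightarrow> u \<in> Hom C Z X \<Longrightarrow> u' \<in> Hom C Z X \<Longrightarrow> u \<cdot> f = u' \<cdot> f \<Longrightarrow> u = u'"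
  unfolding is_epi_def using Hom_ObjD by (metis (mono_tags, lifting) Hom_def mem_Collect_eq)

lemma cokernel_of_kernel:
  assumes "is_cokernel C f q" "is_kernel C q k" shows "is_cokernel C k q"
proof -
  obtain X Y where f: "f \<in> Hom C X Y" using assms(1) Hom_self unfolding is_cokernel_def by blast
  note c = assms(1)[unfolded is_cokernel_iff[OF f]]
  then have q: "q \<in> Hom C Y (Cod C q)" by blast
  note k = assms(2)[unfolded is_kernel_iff[OF q]]
  obtain x where x: "x \<in> Hom C X (Dom C k)" "k \<cdot> x = f" using kernel_factor[OF assms(2) q f] c by blast
  have kH: "k \<in> Hom C (Dom C k) Y" using k by blast
  have "\<exists>!u. u \<in> Hom C (Cod C q) Z \<and> u \<cdot> q = h" if h: "h \<in> Hom C Y Z" "h \<cdot> k = zero (Dom C k) Z" for Z h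
  proof -
    have "h \<cdot> f = zero X Z"
      using Comp_assoc[OF x(1) kH h(1)] h(2) x zero_Comp[OF x(1)] Hom_ObjD[OF h(1)] by metis
    then show ?thesis using c h by blast
  qed
  then show ?thesis unfolding is_cokernel_iff[OF kH] using k q by blast
qed

lemma kernel_of_cokernel:
  assumes "is_kernel C f k" "is_cokernel C k q" shows "is_kernel C q k"
proof -
  obtain X Y where f: "f \<in> Hom C X Y" using assms(1) Hom_self unfolding is_kernel_def by blast
  note c = assms(1)[unfolded is_kernel_iff[OF f]]
  then have k: "k \<in> Hom C (Dom C k) X" by blast
  note q = assms(2)[unfolded is_cokernel_iff[OF k]]
  obtain x where x: "x \<in> Hom C (Cod C q) Y" "x \<cdot> q = f" using cokernel_factor[OF assms(2) k f] c by blast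
  have qH: "q \<in> Hom C X (Cod C q)" using q by blast
  have "\<exists>!u. u \<in> Hom C Z (Dom C k) \<and> k \<cdot> u = h" if h: "h \<in> Hom C Z X" "q \<cdot> h = zero Z (Cod C q)" for Z h
  proof -
    have "f \<cdot> h = zero Z Y"
      using Comp_assoc[OF h(1) qH x(1)] h(2) x Comp_zero[OF x(1)] Hom_ObjD[OF h(1)] by metis
    then show ?thesis using c h by blast
  qed
  then show ?thesis unfolding is_kernel_iff[OF qH] using k q by blast
qed

lemma is_iso_Id: "X \<in> Obj C \<Longrightarrow> is_iso C (Id C X)"
  unfolding is_iso_def using Id_Hom by (auto intro!: bexI[of _ "Id C X"])

lemma kernel_of_zero: assumes "X \<in> Obj C" "Y \<in> Obj C" shows "is_kernel C (zero X Y) (Id C X)"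
proof -
  note z = zero_Hom[OF assms]
  show ?thesis unfolding is_kernel_iff[OF z]
    using Id_Hom[OF assms(1)] Comp_Id[OF z] Id_Comp Comp_Hom assms by auto
qed

lemma cokernel_of_zero: assumes "X \<in> Obj C" "Y \<in> Obj C" shows "is_cokernel C (zero X Y) (Id C Y)"
proof -
  note z = zero_Hom[OF assms]
  show ?thesis unfolding is_cokernel_iff[OF z]
    using Id_Hom[OF assms(2)] Id_Comp[OF z] Comp_Id Comp_Hom assms by auto
qed

text \<open>A cokernel is its own coimage and its image is its whole codomain, so it is strict. Dually for
  kernels.\<close>

lemma cokernel_strict: assumes "is_cokernel C f q" shows "is_strict C q"
proof -
  obtain X Y where f: "f \<in> Hom C X Y" using assms(1) Hom_self unfolding is_cokernel_def by blast
  let ?Q = "Cod C q"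
  have q: "q \<in> Hom C Y ?Q" using assms is_cokernel_iff[OF f] by blast
  note QO = Hom_ObjD[OF q]
  obtain k where k: "is_kernel C q k" using kernel_exists q by blast
  obtain r where r: "is_cokernel C q r" using cokernel_exists q by blast
  have rH: "r \<in> Hom C ?Q (Cod C r)" "r \<cdot> q = zero Y (Cod C r)" using r is_cokernel_iff[OF q] by auto
  note RO = Hom_ObjD[OF rH(1)]
  have "r = zero ?Q (Cod C r)"
    using cokernel_cancel[OF assms rH(1) zero_Hom[OF RO]] rH zero_Comp[OF q RO(2)] by simp
  then have "is_kernel C r (Id C ?Q)" using kernel_of_zero[OF RO] by simp
  moreover have "q = Id C ?Q \<cdot> Id C ?Q \<cdot> q" using Id_Comp[OF q] by simp
  moreover have "Id C ?Q \<in> Hom C (Cod C q) (Dom C (Id C ?Q))" using Id_Hom QO(2) by simp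
  ultimately show ?thesis unfolding is_strict_def
    using k cokernel_of_kernel[OF assms k] r is_iso_Id[OF QO(2)] by blast
qed

lemma kernel_strict: assumes "is_kernel C f k" shows "is_strict C k"
proof -
  obtain X Y where f: "f \<in> Hom C X Y" using assms(1) Hom_self unfolding is_kernel_def by blast
  let ?K = "Dom C k"
  have k: "k \<in> Hom C ?K X" using assms is_kernel_iff[OF f] by blast
  note KO = Hom_ObjD[OF k]
  obtain q where q: "is_cokernel C k q" using cokernel_exists k by blast
  obtain r where r: "is_kernel C k r" using kernel_exists k by blast
  have rH: "r \<in> Hom C (Dom C r) ?K" "k \<cdot> r = zero (Dom C r) X" using r is_kernel_iff[OF k] by auto
  note RO = Hom_ObjD[OF rH(1)]
  have "r = zero (Dom C r) ?K"
    using kernel_cancel[OF assms rH(1) zero_Hom[OF RO]] rH Comp_zero[OF k RO(1)] by simp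
  then have "is_cokernel C r (Id C ?K)" using cokernel_of_zero[OF RO] by simp
  moreover have "k = k \<cdot> Id C ?K \<cdot> Id C ?K" using Comp_Id[OF k] Comp_Id[OF Id_Hom[OF KO(1)]] by simp
  moreover have "Id C ?K \<in> Hom C (Cod C (Id C ?K)) (Dom C k)" using Id_Hom KO(1) by simp
  ultimately show ?thesis unfolding is_strict_def
    using r q kernel_of_cokernel[OF assms q] is_iso_Id[OF KO(1)] by blast
qed

text \<open>Conversely, a strict epimorphism agrees with its coimage up to an isomorphism of codomains, because
  its image is its whole codomain.\<close>

lemma strict_epi_cokernel:
  assumes s: "is_strict C f" "is_epi C f" and f: "f \<in> Hom C X Y"
  obtains k where "k \<in> Hom C (Dom C k) X" "is_cokernel C k f"
proof -
  obtain k c q m u where k: "is_kernel C f k" and c: "is_cokernel C k c" and q: "is_cokernel C f q"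
    and m: "is_kernel C q m" and u: "u \<in> Hom C (Cod C c) (Dom C m)" and fe: "f = m \<cdot> u \<cdot> c"
    and ui: "is_iso C u"
    using s(1) unfolding is_strict_def by blast
  have kH: "k \<in> Hom C (Dom C k) X" using k is_kernel_iff[OF f] by blast
  have cH: "c \<in> Hom C X (Cod C c)" using c is_cokernel_iff[OF kH] by blast
  have qH: "q \<in> Hom C Y (Cod C q)" "q \<cdot> f = zero X (Cod C q)" using q is_cokernel_iff[OF f] by auto
  have mH: "m \<in> Hom C (Dom C m) Y" using m is_kernel_iff[OF qH(1)] by blast
  have "q = zero Y (Cod C q)"
    using epi_cancel[OF s(2) f qH(1)] qH zero_Hom zero_Comp[OF f] Hom_ObjD[OF qH(1)] by auto
  then obtain m' where m': "m' \<in> Hom C Y (Dom C m)" "m \<cdot> m' = Id C Y"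
    using kernel_factor[OF m qH(1) Id_Hom] Hom_ObjD[OF f] Comp_Id[OF qH(1)] by metis
  obtain u' where u': "u' \<in> Hom C (Dom C m) (Cod C c)" "u' \<cdot> u = Id C (Cod C c)" "u \<cdot> u' = Id C (Dom C m)"
    using ui u unfolding is_iso_def Hom_def by auto
  \<comment> \<open>\<open>w = m \<circ> u\<close> is an isomorphism from the coimage onto \<open>Y\<close>, with inverse \<open>w'\<close>.\<close>
  let ?w = "m \<cdot> u" and ?w' = "u' \<cdot> m'"
  have wH: "?w \<in> Hom C (Cod C c) Y" "?w' \<in> Hom C Y (Cod C c)" using u u' m' mH Comp_Hom by blast+
  have "m \<cdot> (m' \<cdot> m) = m \<cdot> Id C (Dom C m)"
    using Comp_rewrite1[OF m'(2,1) mH mH] mH m' Id_Comp Comp_Id by (metis)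
  then have m'm: "m' \<cdot> m = Id C (Dom C m)"
    using kernel_cancel[OF m, of "m' \<cdot> m" "Dom C m"] m' mH Comp_Hom Id_Hom Hom_ObjD by blast
  have ww': "?w \<cdot> ?w' = Id C Y"
    using m' u' u mH Comp_rewrite1[OF u'(3) u'(1) u m'(1)] by (simp add: Hom_def)
  have w'w: "?w' \<cdot> ?w = Id C (Cod C c)"
    using m' u' u mH Comp_rewrite1[OF m'm mH m'(1) u] by (simp add: Hom_def)
  have fw: "f = ?w \<cdot> c" using fe mH u cH by (simp add: Hom_def)
  have cf: "c = ?w' \<cdot> f" using fw Comp_rewrite1[OF w'w wH cH] Id_Comp[OF cH] by simp
  have cY: "Cod C f = Y" using f by (auto simp: Hom_def)
  have "is_cokernel C k f" unfolding is_cokernel_iff[OF kH] cY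
  proof (intro conjI allI impI)
    show "f \<in> Hom C X Y" by fact
    show "f \<cdot> k = zero (Dom C k) Y" using k is_kernel_iff[OF f] by blast
    fix Z h assume h: "h \<in> Hom C X Z" "h \<cdot> k = zero (Dom C k) Z"
    obtain v where v: "v \<in> Hom C (Cod C c) Z" "v \<cdot> c = h" using cokernel_factor[OF c kH h] .
    have "(v \<cdot> ?w') \<cdot> f = h" using Comp_assoc[OF f wH(2) v(1)] cf v by simp
    then show "\<exists>!u. u \<in> Hom C Y Z \<and> u \<cdot> f = h"
      using Comp_Hom[OF wH(2) v(1)] epi_cancel[OF s(2) f] by metis
  qed
  then show ?thesis using that kH by blast
qed

text \<open>A product \<open>P\<close> of \<open>X\<close> and \<open>Y\<close> with projections \<open>p\<close>, \<open>q\<close>, together with the injections \<open>i\<close>, \<open>j\<close> that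
  make it a biproduct.\<close>

definition is_biproduct :: "'o \<Rightarrow> 'o \<Rightarrow> 'o \<Rightarrow> 'a \<Rightarrow> 'a \<Rightarrow> 'a \<Rightarrow> 'a \<Rightarrow> bool" where
  "is_biproduct X Y P p q i j \<longleftrightarrow>
     p \<in> Hom C P X \<and> q \<in> Hom C P Y \<and> i \<in> Hom C X P \<and> j \<in> Hom C Y P \<and>
     p \<cdot> i = Id C X \<and> q \<cdot> j = Id C Y \<and> p \<cdot> j = zero Y X \<and> q \<cdot> i = zero X Y \<and>
     add (i \<cdot> p) (j \<cdot> q) = Id C P \<and>
     (\<forall>T a b. a \<in> Hom C T X \<longrightarrow> b \<in> Hom C T Y \<longrightarrow> (\<exists>!u. u \<in> Hom C T P \<and> p \<cdot> u = a \<and> q \<cdot> u = b))"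

lemma biproduct_exists:
  assumes X: "X \<in> Obj C" and Y: "Y \<in> Obj C"
  obtains P p q i j where "is_biproduct X Y P p q i j"
proof -
  obtain p q where pq: "is_product C X Y p q"
    using qa X Y unfolding quasi_abelian_def additive_category_def by blast
  define P where "P = Dom C p"
  have p: "p \<in> Hom C P X" and q: "q \<in> Hom C P Y"
    using pq unfolding is_product_def P_def Hom_def by auto
  have U: "\<exists>!u. u \<in> Hom C T P \<and> p \<cdot> u = a \<and> q \<cdot> u = b" if "a \<in> Hom C T X" "b \<in> Hom C T Y" for T a b
    using that pq Hom_ObjD[OF that(1)] unfolding is_product_def P_def by blast
  obtain i where i: "i \<in> Hom C X P" "p \<cdot> i = Id C X" "q \<cdot> i = zero X Y"
    using U[OF Id_Hom[OF X] zero_Hom[OF X Y]] by blast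
  obtain j where j: "j \<in> Hom C Y P" "p \<cdot> j = zero Y X" "q \<cdot> j = Id C Y"
    using U[OF zero_Hom[OF Y X] Id_Hom[OF Y]] by blast
  let ?e = "add (i \<cdot> p) (j \<cdot> q)"
  note ip = Comp_Hom[OF p i(1)] and jq = Comp_Hom[OF q j(1)]
  have PO: "P \<in> Obj C" using Hom_ObjD p by blast
  have "p \<cdot> ?e = p"
    using add_Comp[OF ip jq p] Comp_rewrite1[OF i(2,1) p p] Comp_rewrite1[OF j(2,1) p q]
      zero_Comp[OF q X] Id_Comp[OF p] add_zero[OF p] by simp
  moreover have "q \<cdot> ?e = q"
    using add_Comp[OF ip jq q] Comp_rewrite1[OF i(3,1) q p] Comp_rewrite1[OF j(3,1) q q]
      zero_Comp[OF p Y] Id_Comp[OF q] add_zero[OF q] by simp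
  ultimately have "?e = Id C P"
    using U[OF p q] add_Hom[OF ip jq] Id_Hom[OF PO] Comp_Id[OF p] Comp_Id[OF q] by metis
  then have "is_biproduct X Y P p q i j"
    unfolding is_biproduct_def using p q i j U by simp
  then show ?thesis by (rule that)
qed

text \<open>The pull-back is the kernel of \<open>f p - g q\<close> on the biproduct.\<close>

lemma pullback_strict_epi:
  assumes f: "f \<in> Hom C X Z" "is_strict C f" "is_epi C f" and g: "g \<in> Hom C Y Z"
  obtains P f' g' where "f' \<in> Hom C P Y" "g' \<in> Hom C P X" "f \<cdot> g' = g \<cdot> f'"
    "is_strict C f'" "is_epi C f'"
proof -
  have O: "X \<in> Obj C" "Y \<in> Obj C" "Z \<in> Obj C" using Hom_ObjD f g by blast+
  obtain B p q i j where B: "is_biproduct X Y B p q i j" using biproduct_exists[OF O(1,2)] .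
  have p: "p \<in> Hom C B X" and q: "q \<in> Hom C B Y" and
    U: "\<And>T a b. a \<in> Hom C T X \<Longrightarrow> b \<in> Hom C T Y \<Longrightarrow> \<exists>!u. u \<in> Hom C T B \<and> p \<cdot> u = a \<and> q \<cdot> u = b"
    using B unfolding is_biproduct_def by simp_all
  let ?d = "sub (f \<cdot> p) (g \<cdot> q)"
  have d: "?d \<in> Hom C B Z" using sub_Hom Comp_Hom p q f(1) g by blast
  obtain k where k: "is_kernel C ?d k" using kernel_exists d by blast
  have kH: "k \<in> Hom C (Dom C k) B" "?d \<cdot> k = zero (Dom C k) Z" using k is_kernel_iff[OF d] by auto
  have deq: "?d \<cdot> u = zero T Z \<longleftrightarrow> f \<cdot> p \<cdot> u = g \<cdot> q \<cdot> u" if u: "u \<in> Hom C T B" for T u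
    using sub_Comp[OF u Comp_Hom[OF p f(1)] Comp_Hom[OF q g]] Comp_assoc[OF u p f(1)] Comp_assoc[OF u q g]
      sub_eq_zero_iff[OF Comp_Hom[OF Comp_Hom[OF u p] f(1)] Comp_Hom[OF Comp_Hom[OF u q] g]] by simp
  have "is_pullback C f g (q \<cdot> k) (p \<cdot> k)"
    unfolding is_pullback_def
  proof (intro conjI ballI impI)
    show "f \<cdot> p \<cdot> k = g \<cdot> q \<cdot> k" using deq kH by blast
    fix T a b assume a: "a \<in> Hom C T (Dom C f)" "b \<in> Hom C T (Dom C g)" and e: "f \<cdot> a = g \<cdot> b"
    then have a: "a \<in> Hom C T X" "b \<in> Hom C T Y" using f g by (auto simp: Hom_def)
    obtain u where u: "u \<in> Hom C T B" "p \<cdot> u = a" "q \<cdot> u = b" using U[OF a] by blast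
    then obtain v where v: "v \<in> Hom C T (Dom C k)" "k \<cdot> v = u"
      using kernel_factor[OF k d u(1)] deq[OF u(1)] e u by auto
    show "\<exists>!u. u \<in> Hom C T (Dom C (q \<cdot> k)) \<and> (p \<cdot> k) \<cdot> u = a \<and> (q \<cdot> k) \<cdot> u = b"
    proof (intro ex1I[of _ v] conjI)
      have D: "Dom C (q \<cdot> k) = Dom C k" using kH q by (simp add: Hom_def)
      show "v \<in> Hom C T (Dom C (q \<cdot> k))" using v D by simp
      show "(p \<cdot> k) \<cdot> v = a" "(q \<cdot> k) \<cdot> v = b" 
        using Comp_assoc[OF v(1) kH(1) p] Comp_assoc[OF v(1) kH(1) q] v u by simp_all
      fix w assume w: "w \<in> Hom C T (Dom C (q \<cdot> k)) \<and> (p \<cdot> k) \<cdot> w = a \<and> (q \<cdot> k) \<cdot> w = b"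
      then have w: "w \<in> Hom C T (Dom C k)" and we: "(p \<cdot> k) \<cdot> w = a" "(q \<cdot> k) \<cdot> w = b"
        using D by simp_all
      then have "p \<cdot> (k \<cdot> w) = a" "q \<cdot> (k \<cdot> w) = b"
        using Comp_assoc[OF w kH(1) p] Comp_assoc[OF w kH(1) q] by simp_all
      then have "k \<cdot> w = k \<cdot> v" using U[OF a] u v Comp_Hom[OF w kH(1)] by blast
      then show "w = v" using kernel_cancel k w v by blast
    qed
  qed (use f g kH p q in \<open>auto simp: Hom_def\<close>)
  then have "is_strict C (q \<cdot> k) \<and> is_epi C (q \<cdot> k)"
    using qa f unfolding quasi_abelian_def by blast
  then show ?thesis
    using that[OF Comp_Hom[OF kH(1) q] Comp_Hom[OF kH(1) p]] deq[OF kH(1)] kH(2) by simp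
qed

text \<open>The push-out is the cokernel of \<open>i f - j g\<close>. Of the stability of strict monomorphisms only the
  monomorphism is recorded.\<close>

lemma pushout_kernel:
  assumes f: "is_kernel C r f" "f \<in> Hom C Z X" and g: "g \<in> Hom C Z Y"
  obtains P f' g' where "f' \<in> Hom C Y P" "g' \<in> Hom C X P" "g' \<cdot> f = f' \<cdot> g" "is_mono C f'"
proof -
  have O: "X \<in> Obj C" "Y \<in> Obj C" "Z \<in> Obj C" using Hom_ObjD f g by blast+
  obtain B p q i j where B: "is_biproduct X Y B p q i j" using biproduct_exists[OF O(1,2)] .
  have p: "p \<in> Hom C B X" and q: "q \<in> Hom C B Y"
    and i: "i \<in> Hom C X B" and j: "j \<in> Hom C Y B"
    and pi: "p \<cdot> i = Id C X" and qj: "q \<cdot> j = Id C Y" and pj: "p \<cdot> j = zero Y X" and qi: "q \<cdot> i = zero X Y"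
    and e: "add (i \<cdot> p) (j \<cdot> q) = Id C B"
    using B unfolding is_biproduct_def by simp_all
  let ?d = "sub (i \<cdot> f) (j \<cdot> g)"
  have d: "?d \<in> Hom C Z B" using sub_Hom Comp_Hom i j f(2) g by blast
  obtain c where c: "is_cokernel C ?d c" using cokernel_exists d by blast
  let ?P = "Cod C c"
  have cH: "c \<in> Hom C B ?P" "c \<cdot> ?d = zero Z ?P" using c is_cokernel_iff[OF d] by auto
  have deq: "u \<cdot> ?d = zero Z T \<longleftrightarrow> (u \<cdot> i) \<cdot> f = (u \<cdot> j) \<cdot> g" if u: "u \<in> Hom C B T" for T u
    using Comp_sub[OF Comp_Hom[OF f(2) i] Comp_Hom[OF g j] u] Comp_assoc[OF f(2) i u] Comp_assoc[OF g j u]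
      sub_eq_zero_iff[OF Comp_Hom[OF Comp_Hom[OF f(2) i] u] Comp_Hom[OF Comp_Hom[OF g j] u]] by simp
  have ext: "u = u'" if u: "u \<in> Hom C B T" "u' \<in> Hom C B T" "u \<cdot> i = u' \<cdot> i" "u \<cdot> j = u' \<cdot> j" for T u u'
  proof -
    have "w = add ((w \<cdot> i) \<cdot> p) ((w \<cdot> j) \<cdot> q)" if w: "w \<in> Hom C B T" for w
      using add_Comp[OF Comp_Hom[OF p i] Comp_Hom[OF q j] w] e Comp_Id[OF w]
        Comp_assoc[OF p i w] Comp_assoc[OF q j w] by simp
    from this[OF u(1)] this[OF u(2)] show ?thesis using u(3,4) by simp
  qed
  have "is_pushout C f g (c \<cdot> j) (c \<cdot> i)"
    unfolding is_pushout_def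
  proof (intro conjI ballI impI)
    show "(c \<cdot> i) \<cdot> f = (c \<cdot> j) \<cdot> g" using deq cH by blast
    fix T a b assume a: "a \<in> Hom C (Cod C f) T" "b \<in> Hom C (Cod C g) T" and ab: "a \<cdot> f = b \<cdot> g"
    then have a: "a \<in> Hom C X T" "b \<in> Hom C Y T" using f(2) g by (auto simp: Hom_def)
    let ?u = "add (a \<cdot> p) (b \<cdot> q)"
    note ap = Comp_Hom[OF p a(1)] and bq = Comp_Hom[OF q a(2)]
    have u: "?u \<in> Hom C B T" using add_Hom[OF ap bq] .
    have ui: "?u \<cdot> i = a" "?u \<cdot> j = b"
      using Comp_add[OF i ap bq] Comp_add[OF j ap bq] Comp_assoc[OF i p a(1)] Comp_assoc[OF i q a(2)]
        Comp_assoc[OF j p a(1)] Comp_assoc[OF j q a(2)] pi pj qi qj Comp_zero[OF a(2) O(1)]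
        Comp_zero[OF a(1) O(2)] Comp_Id a add_zero by simp_all
    obtain v where v: "v \<in> Hom C ?P T" "v \<cdot> c = ?u"
      using cokernel_factor[OF c d u] deq[OF u] ui ab by auto
    show "\<exists>!u. u \<in> Hom C (Cod C (c \<cdot> j)) T \<and> u \<cdot> (c \<cdot> i) = a \<and> u \<cdot> (c \<cdot> j) = b"
    proof (intro ex1I[of _ v] conjI)
      have D: "Cod C (c \<cdot> j) = ?P" using cH j by (simp add: Hom_def)
      show "v \<in> Hom C (Cod C (c \<cdot> j)) T" using v D by simp
      show "v \<cdot> (c \<cdot> i) = a" "v \<cdot> (c \<cdot> j) = b" 
        using Comp_assoc[OF i cH(1) v(1)] Comp_assoc[OF j cH(1) v(1)] v ui by simp_all
      fix w assume w: "w \<in> Hom C (Cod C (c \<cdot> j)) T \<and> w \<cdot> (c \<cdot> i) = a \<and> w \<cdot> (c \<cdot> j) = b"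
      then have w1: "w \<in> Hom C ?P T" and we: "w \<cdot> (c \<cdot> i) = a" "w \<cdot> (c \<cdot> j) = b"
        using D by simp_all
      then have w: "w \<in> Hom C ?P T" "(w \<cdot> c) \<cdot> i = a" "(w \<cdot> c) \<cdot> j = b"
        using Comp_assoc[OF i cH(1) w1] Comp_assoc[OF j cH(1) w1] by simp_all
      then have "w \<cdot> c = v \<cdot> c" using ext[OF Comp_Hom[OF cH(1) w(1)] u] ui v by simp
      then show "w = v" using cokernel_cancel c w v by blast
    qed
  qed (use f(2) g cH i j in \<open>auto simp: Hom_def\<close>)
  then have "is_mono C (c \<cdot> j)"
    using qa kernel_strict[OF f(1)] kernel_mono[OF f(1)] unfolding quasi_abelian_def by blast
  then show ?thesis
    using that[OF Comp_Hom[OF j cH(1)] Comp_Hom[OF i cH(1)]] deq[OF cH(1)] cH(2) by simp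
qed

end

section \<open>Representatives of morphisms of ind-objects\<close>

lemma filtered_category: "filtered J \<Longrightarrow> category J"
  by (simp add: filtered_def)

lemma filtered_upper:
  assumes "filtered J" "i \<in> Obj J" "j \<in> Obj J"
  obtains k u v where "u \<in> Hom J i k" "v \<in> Hom J j k"
  using assms unfolding filtered_def by blast

lemma filtered_coequalize:
  assumes "filtered J" "m \<in> Hom J i j" "n \<in> Hom J i j"
  obtains k h where "h \<in> Hom J j k" "h \<cdot>\<^bsub>J\<^esub> m = h \<cdot>\<^bsub>J\<^esub> n"
proof -
  interpret category J using assms(1) by (rule filtered_category)
  have "i \<in> Obj J" "j \<in> Obj J" using Hom_ObjD assms(2) by blast+
  then show ?thesis using assms that unfolding filtered_def by blast
qed

lemma filtered_span:
  assumes J: "filtered J" and u: "u \<in> Hom J i j" and v: "v \<in> Hom J i k"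
  obtains l a b where "a \<in> Hom J j l" "b \<in> Hom J k l" "a \<cdot>\<^bsub>J\<^esub> u = b \<cdot>\<^bsub>J\<^esub> v"
proof -
  interpret category J using J by (rule filtered_category)
  obtain l a b where ab: "a \<in> Hom J j l" "b \<in> Hom J k l"
    using filtered_upper[OF J Hom_ObjD(2)[OF u] Hom_ObjD(2)[OF v]] .
  obtain l' h where h: "h \<in> Hom J l l'" "h \<cdot>\<^bsub>J\<^esub> (a \<cdot>\<^bsub>J\<^esub> u) = h \<cdot>\<^bsub>J\<^esub> (b \<cdot>\<^bsub>J\<^esub> v)"
    using filtered_coequalize[OF J Comp_Hom[OF u ab(1)] Comp_Hom[OF v ab(2)]] .
  show ?thesis
    using that[OF Comp_Hom[OF ab(1) h(1)] Comp_Hom[OF ab(2) h(1)]] h(2)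
      Comp_assoc[OF u ab(1) h(1)] Comp_assoc[OF v ab(2) h(1)] by simp
qed

lemma is_functorD:
  assumes "is_functor J C F0 F1"
  shows "i \<in> Obj J \<Longrightarrow> F0 i \<in> Obj C" "i \<in> Obj J \<Longrightarrow> F1 (Id J i) = Id C (F0 i)"
    "m \<in> Hom J i j \<Longrightarrow> F1 m \<in> Hom C (F0 i) (F0 j)"
    "m \<in> Hom J i j \<Longrightarrow> n \<in> Hom J j k \<Longrightarrow> F1 (n \<cdot>\<^bsub>J\<^esub> m) = F1 n \<cdot>\<^bsub>C\<^esub> F1 m"
  using assms by (auto simp: is_functor_def Hom_def)

lemma ind_objectD:
  assumes "ind_object C F"
  shows ind_filtered: "filtered (idx F)" and ind_category: "category (idx F)"
    and ob_Obj: "i \<in> Obj (idx F) \<Longrightarrow> ob F i \<in> Obj C"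
    and ar_Id: "i \<in> Obj (idx F) \<Longrightarrow> ar F (Id (idx F) i) = Id C (ob F i)"
    and ar_Hom: "m \<in> Hom (idx F) i j \<Longrightarrow> ar F m \<in> Hom C (ob F i) (ob F j)"
    and ar_Comp: "m \<in> Hom (idx F) i j \<Longrightarrow> n \<in> Hom (idx F) j k \<Longrightarrow>
      ar F (n \<cdot>\<^bsub>idx F\<^esub> m) = ar F n \<cdot>\<^bsub>C\<^esub> ar F m"
  using assms is_functorD[of "idx F" C "ob F" "ar F"] filtered_category
  by (auto simp: ind_object_def)

context category
begin

text \<open>Two arrows \<open>\<phi> : X \<rightarrow> F\<^sub>j\<close> and \<open>\<phi>' : X \<rightarrow> F\<^sub>j\<^sub>'\<close> have the same germ if they agree at a later index.\<close>

definition same_germ :: "('j, 'o, 'a) ind_obj \<Rightarrow> 'j \<Rightarrow> 'a \<Rightarrow> 'j \<Rightarrow> 'a \<Rightarrow> bool" where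
  "same_germ F j \<phi> j' \<phi>' \<longleftrightarrow>
     (\<exists>k u v. u \<in> Hom (idx F) j k \<and> v \<in> Hom (idx F) j' k \<and> ar F u \<cdot> \<phi> = ar F v \<cdot> \<phi>')"

text \<open>The class of \<open>\<phi> : X \<rightarrow> F\<^sub>j\<close> in the filtered colimit of the sets \<open>Hom(X, F\<^sub>j)\<close>.\<close>

definition germ :: "'o \<Rightarrow> ('j, 'o, 'a) ind_obj \<Rightarrow> 'j \<Rightarrow> 'a \<Rightarrow> ('j \<times> 'a) set" where
  "germ X F j \<phi> = colim_rel C X F `` {(j, \<phi>)}"

lemma same_germE:
  assumes "same_germ F j \<phi> j' \<phi>'"
  obtains k u v where "u \<in> Hom (idx F) j k" "v \<in> Hom (idx F) j' k" "ar F u \<cdot> \<phi> = ar F v \<cdot> \<phi>'"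
  using assms unfolding same_germ_def by blast

lemma same_germI:
  "u \<in> Hom (idx F) j k \<Longrightarrow> v \<in> Hom (idx F) j' k \<Longrightarrow> ar F u \<cdot> \<phi> = ar F v \<cdot> \<phi>' \<Longrightarrow> same_germ F j \<phi> j' \<phi>'"
  unfolding same_germ_def by blast

lemma same_germ_sym: "same_germ F j \<phi> j' \<phi>' \<Longrightarrow> same_germ F j' \<phi>' j \<phi>"
  unfolding same_germ_def by metis

lemma same_germ_refl: "ind_object C F \<Longrightarrow> j \<in> Obj (idx F) \<Longrightarrow> same_germ F j \<phi> j \<phi>"
  by (rule same_germI[OF category.Id_Hom category.Id_Hom refl]) (simp_all add: ind_category)

lemma same_germ_trans:
  assumes F: "ind_object C F"
    and H: "\<phi> \<in> Hom C X (ob F j)" "\<phi>' \<in> Hom C X (ob F j')" "\<phi>'' \<in> Hom C X (ob F j'')"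
    and g: "same_germ F j \<phi> j' \<phi>'" "same_germ F j' \<phi>' j'' \<phi>''"
  shows "same_germ F j \<phi> j'' \<phi>''"
proof -
  interpret I: category "idx F" using F by (rule ind_category)
  obtain k u v where u: "u \<in> Hom (idx F) j k" "v \<in> Hom (idx F) j' k" "ar F u \<cdot> \<phi> = ar F v \<cdot> \<phi>'"
    using g(1) by (rule same_germE)
  obtain l w z where w: "w \<in> Hom (idx F) j' l" "z \<in> Hom (idx F) j'' l" "ar F w \<cdot> \<phi>' = ar F z \<cdot> \<phi>''"
    using g(2) by (rule same_germE)
  obtain q a b where a: "a \<in> Hom (idx F) k q" "b \<in> Hom (idx F) l q" "a \<cdot>\<^bsub>idx F\<^esub> v = b \<cdot>\<^bsub>idx F\<^esub> w"
    using filtered_span[OF ind_filtered[OF F] u(2) w(1)] .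
  note A = ar_Hom[OF F] and AC = ar_Comp[OF F]
  have "ar F (a \<cdot>\<^bsub>idx F\<^esub> u) \<cdot> \<phi> = ar F a \<cdot> (ar F v \<cdot> \<phi>')"
    using AC[OF u(1) a(1)] Comp_assoc[OF H(1) A[OF u(1)] A[OF a(1)]] u(3) by simp
  also have "\<dots> = ar F (b \<cdot>\<^bsub>idx F\<^esub> w) \<cdot> \<phi>'"
    using AC[OF u(2) a(1)] Comp_assoc[OF H(2) A[OF u(2)] A[OF a(1)]] a(3) by simp
  also have "\<dots> = ar F (b \<cdot>\<^bsub>idx F\<^esub> z) \<cdot> \<phi>''"
    using AC[OF w(1) a(2)] AC[OF w(2) a(2)] Comp_assoc[OF H(2) A[OF w(1)] A[OF a(2)]]
      Comp_assoc[OF H(3) A[OF w(2)] A[OF a(2)]] w(3) by simp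
  finally show ?thesis by (rule same_germI[OF I.Comp_Hom[OF u(1) a(1)] I.Comp_Hom[OF w(2) a(2)]])
qed

lemma colim_rel_iff:
  assumes F: "ind_object C F"
  shows "((j, \<phi>), (j', \<phi>')) \<in> colim_rel C X F \<longleftrightarrow>
    j \<in> Obj (idx F) \<and> j' \<in> Obj (idx F) \<and> \<phi> \<in> Hom C X (ob F j) \<and> \<phi>' \<in> Hom C X (ob F j') \<and>
    same_germ F j \<phi> j' \<phi>'"
proof -
  interpret I: category "idx F" using F by (rule ind_category)
  show ?thesis unfolding colim_rel_def same_germ_def using I.Hom_ObjD by blast
qed

lemma equiv_colim_rel:
  assumes F: "ind_object C F"
  shows "equiv (SIGMA j:Obj (idx F). Hom C X (ob F j)) (colim_rel C X F)"
proof (rule equivI)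
  show "colim_rel C X F \<subseteq> (SIGMA j:Obj (idx F). Hom C X (ob F j)) \<times> (SIGMA j:Obj (idx F). Hom C X (ob F j))"
    by (auto simp: colim_rel_def)
  show "refl_on (SIGMA j:Obj (idx F). Hom C X (ob F j)) (colim_rel C X F)"
    using colim_rel_iff[OF F] same_germ_refl[OF F] by (auto intro!: refl_onI)
  show "sym (colim_rel C X F)"
  proof (rule symI)
    fix p q assume "(p, q) \<in> colim_rel C X F"
    then show "(q, p) \<in> colim_rel C X F"
      by (cases p; cases q) (simp add: colim_rel_iff[OF F] same_germ_sym)
  qed
  show "trans (colim_rel C X F)"
  proof (rule transI)
    fix p q r assume "(p, q) \<in> colim_rel C X F" "(q, r) \<in> colim_rel C X F"
    then show "(p, r) \<in> colim_rel C X F"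
      by (cases p; cases q; cases r) (use same_germ_trans[OF F] in \<open>simp add: colim_rel_iff[OF F], blast\<close>)
  qed
qed

lemma germ_mem_iff:
  assumes "ind_object C F"
  shows "(j', \<phi>') \<in> germ X F j \<phi> \<longleftrightarrow>
    j \<in> Obj (idx F) \<and> j' \<in> Obj (idx F) \<and> \<phi> \<in> Hom C X (ob F j) \<and> \<phi>' \<in> Hom C X (ob F j') \<and>
    same_germ F j \<phi> j' \<phi>'"
  unfolding germ_def using colim_rel_iff[OF assms] by simp

lemma germ_in_colim:
  "j \<in> Obj (idx F) \<Longrightarrow> \<phi> \<in> Hom C X (ob F j) \<Longrightarrow> germ X F j \<phi> \<in> colim_hom C X F"
  unfolding germ_def colim_hom_def by (rule quotientI) simp

lemma colim_hom_memD:
  assumes F: "ind_object C F" and c: "c \<in> colim_hom C X F" and m: "(j, \<phi>) \<in> c"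
  shows "j \<in> Obj (idx F)" "\<phi> \<in> Hom C X (ob F j)" "c = germ X F j \<phi>"
proof -
  obtain j0 \<phi>0 where c0: "c = germ X F j0 \<phi>0" "j0 \<in> Obj (idx F)" "\<phi>0 \<in> Hom C X (ob F j0)"
    using c unfolding colim_hom_def germ_def by (auto elim!: quotientE)
  show "j \<in> Obj (idx F)" "\<phi> \<in> Hom C X (ob F j)" using m germ_mem_iff[OF F] c0 by auto
  have "((j0, \<phi>0), (j, \<phi>)) \<in> colim_rel C X F" using m c0 unfolding germ_def by simp
  then show "c = germ X F j \<phi>" using equiv_class_eq[OF equiv_colim_rel[OF F]] c0(1) unfolding germ_def by blast
qed

lemma colim_hom_nonempty:
  assumes F: "ind_object C F" and c: "c \<in> colim_hom C X F"
  obtains j \<phi> where "(j, \<phi>) \<in> c"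
proof -
  obtain j0 \<phi>0 where c0: "c = germ X F j0 \<phi>0" "j0 \<in> Obj (idx F)" "\<phi>0 \<in> Hom C X (ob F j0)"
    using c unfolding colim_hom_def germ_def by (auto elim!: quotientE)
  then have "(j0, \<phi>0) \<in> c" using germ_mem_iff[OF F] same_germ_refl[OF F] by auto
  then show ?thesis by (rule that)
qed

text \<open>The members \<open>(j, \<phi>)\<close> of the class \<open>x i\<close> are the arrows \<open>\<phi> : E\<^sub>i \<rightarrow> F\<^sub>j\<close> of \<open>C\<close> that represent the
  morphism \<open>x\<close> of ind-objects at the index \<open>i\<close>.\<close>

lemma ind_hom_memD:
  assumes F: "ind_object C F" and x: "x \<in> ind_hom C E F" and m: "(j, \<phi>) \<in> x i"
  shows "i \<in> Obj (idx E)" "j \<in> Obj (idx F)" "\<phi> \<in> Hom C (ob E i) (ob F j)" "x i = germ (ob E i) F j \<phi>"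
proof -
  show i: "i \<in> Obj (idx E)" using x m unfolding ind_hom_def by auto
  then have "x i \<in> colim_hom C (ob E i) F" using x unfolding ind_hom_def by auto
  then show "j \<in> Obj (idx F)" "\<phi> \<in> Hom C (ob E i) (ob F j)" "x i = germ (ob E i) F j \<phi>"
    using colim_hom_memD[OF F _ m] by blast+
qed

lemma ind_hom_rep:
  assumes F: "ind_object C F" and x: "x \<in> ind_hom C E F" and i: "i \<in> Obj (idx E)"
  obtains j \<phi> where "(j, \<phi>) \<in> x i"
  using colim_hom_nonempty[OF F, of "x i" "ob E i"] x i unfolding ind_hom_def by blast

lemma ind_hom_same_germ:
  assumes F: "ind_object C F" and x: "x \<in> ind_hom C E F" and m: "(j, \<phi>) \<in> x i" "(j', \<phi>') \<in> x i"
  shows "same_germ F j \<phi> j' \<phi>'"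
  using ind_hom_memD(4)[OF F x m(1)] m(2) germ_mem_iff[OF F] by simp

lemma ind_hom_mem_same_germ:
  assumes F: "ind_object C F" and x: "x \<in> ind_hom C E F" and m: "(j, \<phi>) \<in> x i"
    and "j' \<in> Obj (idx F)" "\<phi>' \<in> Hom C (ob E i) (ob F j')" "same_germ F j \<phi> j' \<phi>'"
  shows "(j', \<phi>') \<in> x i"
  using ind_hom_memD[OF F x m] assms(4-6) germ_mem_iff[OF F] by simp

lemma same_germ_ar:
  assumes F: "ind_object C F" and "\<phi> \<in> Hom C X (ob F j)" "u \<in> Hom (idx F) j k"
  shows "same_germ F j \<phi> k (ar F u \<cdot> \<phi>)"
proof -
  interpret I: category "idx F" using F by (rule ind_category)
  have k: "k \<in> Obj (idx F)" using assms(3) I.Hom_ObjD by blast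
  have "ar F u \<cdot> \<phi> = ar F (Id (idx F) k) \<cdot> (ar F u \<cdot> \<phi>)"
    using ar_Id[OF F k] Id_Comp[OF Comp_Hom[OF assms(2) ar_Hom[OF F assms(3)]]] by simp
  then show ?thesis using same_germI[OF assms(3) I.Id_Hom[OF k]] by blast
qed

lemma ind_hom_post:
  assumes F: "ind_object C F" and x: "x \<in> ind_hom C E F" and m: "(j, \<phi>) \<in> x i" and u: "u \<in> Hom (idx F) j k"
  shows "(k, ar F u \<cdot> \<phi>) \<in> x i"
proof -
  interpret I: category "idx F" using F by (rule ind_category)
  note D = ind_hom_memD[OF F x m]
  show ?thesis
    using ind_hom_mem_same_germ[OF F x m I.Hom_ObjD(2)[OF u] Comp_Hom[OF D(3) ar_Hom[OF F u]]
        same_germ_ar[OF F D(3) u]] .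
qed

lemma ind_hom_pre:
  assumes x: "x \<in> ind_hom C E F" and m: "(j, \<phi>) \<in> x i'" and u: "u \<in> Hom (idx E) i i'"
  shows "(j, \<phi> \<cdot> ar E u) \<in> x i"
  using assms unfolding ind_hom_def Hom_def by blast

lemma ind_hom_ext:
  assumes F: "ind_object C F" and x: "x \<in> ind_hom C E F" and y: "y \<in> ind_hom C E F"
    and m: "\<And>i. i \<in> Obj (idx E) \<Longrightarrow> \<exists>j \<phi>. (j, \<phi>) \<in> x i \<and> (j, \<phi>) \<in> y i"
  shows "x = y"
proof
  fix i
  show "x i = y i"
  proof (cases "i \<in> Obj (idx E)")
    case True
    then show ?thesis using m[OF True] ind_hom_memD(4)[OF F x] ind_hom_memD(4)[OF F y] by metis
  next
    case False
    then show ?thesis using x y unfolding ind_hom_def by auto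
  qed
qed

text \<open>The morphism of ind-objects that is represented at the index \<open>i\<close> by an arrow \<open>r i\<close> from \<open>E\<^sub>i\<close> to the
  object of \<open>F\<close> at the index \<open>n i\<close>. Outside of the index set its value is \<open>{}\<close>, as in \<open>ind_hom\<close>.\<close>

definition make_hom ::
  "('i, 'o, 'a) ind_obj \<Rightarrow> ('j, 'o, 'a) ind_obj \<Rightarrow> ('i \<Rightarrow> 'j) \<Rightarrow> ('i \<Rightarrow> 'a) \<Rightarrow> 'i \<Rightarrow> ('j \<times> 'a) set" where
  "make_hom E F n r i = (if i \<in> Obj (idx E) then germ (ob E i) F (n i) (r i) else {})"

lemma make_hom:
  assumes E: "ind_object C E" and F: "ind_object C F"
    and H: "\<And>i. i \<in> Obj (idx E) \<Longrightarrow> n i \<in> Obj (idx F)"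
      "\<And>i. i \<in> Obj (idx E) \<Longrightarrow> r i \<in> Hom C (ob E i) (ob F (n i))"
    and c: "\<And>i i' m. m \<in> Hom (idx E) i i' \<Longrightarrow> same_germ F (n i') (r i' \<cdot> ar E m) (n i) (r i)"
  shows "make_hom E F n r \<in> ind_hom C E F"
    and "\<And>i. i \<in> Obj (idx E) \<Longrightarrow> (n i, r i) \<in> make_hom E F n r i"
proof -
  interpret I: category "idx E" using E by (rule ind_category)
  show m: "(n i, r i) \<in> make_hom E F n r i" if "i \<in> Obj (idx E)" for i
    using that H same_germ_refl[OF F] by (simp add: make_hom_def germ_mem_iff[OF F])
  have "(j, \<phi> \<cdot> ar E m) \<in> make_hom E F n r i"
    if u: "m \<in> Hom (idx E) i i'" and p: "(j, \<phi>) \<in> make_hom E F n r i'" for m i i' j \<phi>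
  proof -
    note O = I.Hom_ObjD[OF u] and A = ar_Hom[OF E u]
    have p': "j \<in> Obj (idx F)" "\<phi> \<in> Hom C (ob E i') (ob F j)" "same_germ F (n i') (r i') j \<phi>"
      using p O by (auto simp: make_hom_def germ_mem_iff[OF F])
    obtain k a b where k: "a \<in> Hom (idx F) (n i') k" "b \<in> Hom (idx F) j k" "ar F a \<cdot> r i' = ar F b \<cdot> \<phi>"
      using p'(3) by (rule same_germE)
    have "ar F a \<cdot> (r i' \<cdot> ar E m) = ar F b \<cdot> (\<phi> \<cdot> ar E m)"
      using Comp_rewrite[OF k(3) H(2)[OF O(2)] ar_Hom[OF F k(1)] p'(2) ar_Hom[OF F k(2)] A] .
    then have "same_germ F (n i') (r i' \<cdot> ar E m) j (\<phi> \<cdot> ar E m)" by (rule same_germI[OF k(1,2)])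
    then have "same_germ F (n i) (r i) j (\<phi> \<cdot> ar E m)"
      using same_germ_trans[OF F H(2)[OF O(1)] Comp_Hom[OF A H(2)[OF O(2)]] Comp_Hom[OF A p'(2)]]
        same_germ_sym[OF c[OF u]] by blast
    then show ?thesis using O H p'(1) Comp_Hom[OF A p'(2)] by (simp add: make_hom_def germ_mem_iff[OF F])
  qed
  then have "\<forall>m\<in>Arr (idx E). \<forall>(j, \<phi>)\<in>make_hom E F n r (Cod (idx E) m).
      (j, \<phi> \<cdot> ar E m) \<in> make_hom E F n r (Dom (idx E) m)"
    using I.Hom_self by blast
  moreover have "make_hom E F n r i \<in> colim_hom C (ob E i) F" if "i \<in> Obj (idx E)" for i
    using that germ_in_colim[OF H(1)[OF that] H(2)[OF that]] by (simp add: make_hom_def)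
  ultimately show "make_hom E F n r \<in> ind_hom C E F"
    unfolding ind_hom_def by (simp add: make_hom_def)
qed

text \<open>Composites of representatives represent the composite, and their germ does not depend on the choices.\<close>

lemma ind_comp:
  assumes E: "ind_object C E" and F: "ind_object C F" and G: "ind_object C G"
    and x: "x \<in> ind_hom C E F" and y: "y \<in> ind_hom C F G"
  shows "ind_comp C E G y x \<in> ind_hom C E G"
    and "\<And>i j k \<phi> \<psi>. (j, \<phi>) \<in> x i \<Longrightarrow> (k, \<psi>) \<in> y j \<Longrightarrow> (k, \<psi> \<cdot> \<phi>) \<in> ind_comp C E G y x i"
proof -
  have H: "k \<in> Obj (idx G)" "\<psi> \<cdot> \<phi> \<in> Hom C (ob E i) (ob G k)" if "(j, \<phi>) \<in> x i" "(k, \<psi>) \<in> y j" for i j k \<phi> \<psi>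
    using ind_hom_memD[OF F x that(1)] ind_hom_memD[OF G y that(2)] Comp_Hom by blast+
  show mem: "(k, \<psi> \<cdot> \<phi>) \<in> ind_comp C E G y x i" if "(j, \<phi>) \<in> x i" "(k, \<psi>) \<in> y j" for i j k \<phi> \<psi>
  proof -
    have "((k, \<psi> \<cdot> \<phi>), (k, \<psi> \<cdot> \<phi>)) \<in> colim_rel C (ob E i) G"
      using colim_rel_iff[OF G] H[OF that] same_germ_refl[OF G] by blast
    then show ?thesis using that unfolding ind_comp_def by blast
  qed
  have sg: "same_germ G k (\<psi> \<cdot> \<phi>) k' (\<psi>' \<cdot> \<phi>')"
    if m: "(j, \<phi>) \<in> x i" "(k, \<psi>) \<in> y j" "(j', \<phi>') \<in> x i" "(k', \<psi>') \<in> y j'" for i j k \<phi> \<psi> j' k' \<phi>' \<psi>'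
  proof -
    obtain l u v where u: "u \<in> Hom (idx F) j l" "v \<in> Hom (idx F) j' l" "ar F u \<cdot> \<phi> = ar F v \<cdot> \<phi>'"
      using ind_hom_same_germ[OF F x m(1,3)] by (rule same_germE)
    note A = ar_Hom[OF F u(1)] ar_Hom[OF F u(2)]
    have "l \<in> Obj (idx F)" using category.Hom_ObjD(2)[OF ind_category[OF F] u(1)] .
    then obtain q \<chi> where q: "(q, \<chi>) \<in> y l" using ind_hom_rep[OF G y] by blast
    have \<chi>: "\<chi> \<in> Hom C (ob F l) (ob G q)" using ind_hom_memD[OF G y q] by blast
    \<comment> \<open>Both composites are compared with \<open>\<chi>\<close>, a representative of \<open>y\<close> at the common index \<open>l\<close>.\<close>
    have pre: "same_germ G k0 (\<psi>0 \<cdot> \<phi>0) q (\<chi> \<cdot> ar F w \<cdot> \<phi>0)"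
      if w: "w \<in> Hom (idx F) j0 l" and m0: "(k0, \<psi>0) \<in> y j0" and p0: "(j0, \<phi>0) \<in> x i" for k0 \<psi>0 \<phi>0 w j0
    proof -
      note p = ind_hom_memD(3)[OF F x p0] and s = ind_hom_memD(3)[OF G y m0]
      obtain r a b where r: "a \<in> Hom (idx G) k0 r" "b \<in> Hom (idx G) q r" "ar G a \<cdot> \<psi>0 = ar G b \<cdot> (\<chi> \<cdot> ar F w)"
        using ind_hom_same_germ[OF G y m0 ind_hom_pre[OF y q w]] by (rule same_germE)
      note W = ar_Hom[OF F w]
      have "ar G a \<cdot> \<psi>0 \<cdot> \<phi>0 = ar G b \<cdot> (\<chi> \<cdot> ar F w) \<cdot> \<phi>0"
        using Comp_rewrite[OF r(3) s ar_Hom[OF G r(1)] Comp_Hom[OF W \<chi>] ar_Hom[OF G r(2)] p] .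
      then show ?thesis using same_germI[OF r(1,2)] Comp_assoc[OF p W \<chi>] by simp
    qed
    note P1 = pre[OF u(1) m(2) m(1)] and P2 = pre[OF u(2) m(4) m(3)]
    have "\<chi> \<cdot> ar F v \<cdot> \<phi>' \<in> Hom C (ob E i) (ob G q)"
      using Comp_Hom[OF Comp_Hom[OF ind_hom_memD(3)[OF F x m(3)] A(2)] \<chi>] .
    then show ?thesis
      using same_germ_trans[OF G H(2)[OF m(1,2)] _ H(2)[OF m(3,4)]] P1 same_germ_sym[OF P2] u(3) by simp
  qed
  have eq: "ind_comp C E G y x i = germ (ob E i) G k (\<psi> \<cdot> \<phi>)" if m: "(j, \<phi>) \<in> x i" "(k, \<psi>) \<in> y j" for i j k \<phi> \<psi>
  proof -
    have "colim_rel C (ob E i) G `` {(k', \<psi>' \<cdot> \<phi>')} = germ (ob E i) G k (\<psi> \<cdot> \<phi>)"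
      if "(j', \<phi>') \<in> x i" "(k', \<psi>') \<in> y j'" for j' \<phi>' k' \<psi>'
      unfolding germ_def using equiv_class_eq[OF equiv_colim_rel[OF G]] colim_rel_iff[OF G] H[OF that] H[OF m]
        sg[OF that m] by simp
    moreover have "ind_comp C E G y x i =
      (\<Union>p\<in>{(k, \<psi> \<cdot> \<phi>) | j \<phi> k \<psi>. (j, \<phi>) \<in> x i \<and> (k, \<psi>) \<in> y j}. colim_rel C (ob E i) G `` {p})"
      unfolding ind_comp_def by blast
    ultimately show ?thesis using m by fast
  qed
  show "ind_comp C E G y x \<in> ind_hom C E G"
    unfolding ind_hom_def
  proof (intro CollectI conjI ballI allI impI)
    fix i assume i: "i \<in> Obj (idx E)"
    obtain j \<phi> where m: "(j, \<phi>) \<in> x i" using ind_hom_rep[OF F x i] .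
    obtain k \<psi> where m': "(k, \<psi>) \<in> y j" using ind_hom_rep[OF G y ind_hom_memD(2)[OF F x m]] .
    show "ind_comp C E G y x i \<in> colim_hom C (ob E i) G"
      using eq[OF m m'] germ_in_colim H[OF m m'] by simp
  next
    fix i assume "i \<notin> Obj (idx E)"
    then have "x i = {}" using x unfolding ind_hom_def by blast
    then show "ind_comp C E G y x i = {}" unfolding ind_comp_def by simp
  next
    fix m p assume "m \<in> Arr (idx E)" and p: "p \<in> ind_comp C E G y x (Cod (idx E) m)"
    then obtain i i' where u: "m \<in> Hom (idx E) i i'" "Dom (idx E) m = i" "Cod (idx E) m = i'" by (simp add: Hom_def)
    have i': "i' \<in> Obj (idx E)" using category.Hom_ObjD(2)[OF ind_category[OF E] u(1)] .
    obtain j \<phi> where a: "(j, \<phi>) \<in> x i'" using ind_hom_rep[OF F x i'] .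
    obtain k \<psi> where b: "(k, \<psi>) \<in> y j" using ind_hom_rep[OF G y ind_hom_memD(2)[OF F x a]] .
    note a' = ind_hom_pre[OF x a u(1)]
    note aH = ind_hom_memD(3)[OF F x a] and bH = ind_hom_memD(3)[OF G y b] and M = ar_Hom[OF E u(1)]
    have "(q, \<chi> \<cdot> ar E m) \<in> ind_comp C E G y x i" if q: "(q, \<chi>) \<in> ind_comp C E G y x i'" for q \<chi>
    proof -
      have q': "q \<in> Obj (idx G)" "\<chi> \<in> Hom C (ob E i') (ob G q)" "same_germ G k (\<psi> \<cdot> \<phi>) q \<chi>"
        using q eq[OF a b] germ_mem_iff[OF G] by simp_all
      obtain r c d where r: "c \<in> Hom (idx G) k r" "d \<in> Hom (idx G) q r" "ar G c \<cdot> (\<psi> \<cdot> \<phi>) = ar G d \<cdot> \<chi>"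
        using q'(3) by (rule same_germE)
      have "ar G c \<cdot> (\<psi> \<cdot> \<phi>) \<cdot> ar E m = ar G d \<cdot> \<chi> \<cdot> ar E m"
        using Comp_rewrite[OF r(3) Comp_Hom[OF aH bH] ar_Hom[OF G r(1)] q'(2) ar_Hom[OF G r(2)] M] .
      then have "same_germ G k (\<psi> \<cdot> \<phi> \<cdot> ar E m) q (\<chi> \<cdot> ar E m)"
        using same_germI[OF r(1,2)] Comp_assoc[OF M aH bH] by simp
      then show ?thesis using eq[OF a' b] germ_mem_iff[OF G] H[OF a' b] q' Comp_Hom[OF M q'(2)] by simp
    qed
    then show "case p of (j, \<phi>) \<Rightarrow> (j, \<phi> \<cdot> ar E m) \<in> ind_comp C E G y x (Dom (idx E) m)"
      using u p by (cases p) simp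
  qed
qed

lemma ind_id:
  assumes E: "ind_object C E"
  shows "ind_id C E \<in> ind_hom C E E"
    and "\<And>i. i \<in> Obj (idx E) \<Longrightarrow> (i, Id C (ob E i)) \<in> ind_id C E i"
proof -
  interpret I: category "idx E" using E by (rule ind_category)
  have e: "ind_id C E = make_hom E E (\<lambda>i. i) (\<lambda>i. Id C (ob E i))"
    by (rule ext) (simp add: ind_id_def make_hom_def germ_def)
  have c: "same_germ E i' (Id C (ob E i') \<cdot> ar E m) i (Id C (ob E i))" if u: "m \<in> Hom (idx E) i i'" for m i i'
    using same_germ_sym[OF same_germ_ar[OF E Id_Hom[OF ob_Obj[OF E I.Hom_ObjD(1)[OF u]]] u]]
      Comp_Id[OF ar_Hom[OF E u]] Id_Comp[OF ar_Hom[OF E u]] by simp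
  show "ind_id C E \<in> ind_hom C E E" unfolding e
    by (rule make_hom(1)[OF E E _ _ c]) (use Id_Hom ob_Obj[OF E] in auto)
  show "\<And>i. i \<in> Obj (idx E) \<Longrightarrow> (i, Id C (ob E i)) \<in> ind_id C E i" unfolding e
    by (rule make_hom(2)[OF E E _ _ c]) (use Id_Hom ob_Obj[OF E] in auto)
qed

lemma Ind_simps [simp]:
  "E \<in> Obj (Ind C) \<longleftrightarrow> ind_object C E"
  "(E, F, x) \<in> Arr (Ind C) \<longleftrightarrow> ind_object C E \<and> ind_object C F \<and> x \<in> ind_hom C E F"
  "Dom (Ind C) (E, F, x) = E" "Cod (Ind C) (E, F, x) = F"
  "(F, G, y) \<cdot>\<^bsub>Ind C\<^esub> (E, F', x) = (E, G, ind_comp C E G y x)"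
  by (simp_all add: Ind_def)

lemma Ind_Hom_iff:
  "a \<in> Hom (Ind C) E F \<longleftrightarrow> (\<exists>x. a = (E, F, x) \<and> ind_object C E \<and> ind_object C F \<and> x \<in> ind_hom C E F)"
  by (cases a) (auto simp: Hom_def)

end

section \<open>Transport of index categories, and kernels of ind-objects\<close>

text \<open>The transport of a category along injections of its objects and of its arrows into another type.\<close>

definition transport_cat :: "('n \<Rightarrow> 'i) \<Rightarrow> ('m \<Rightarrow> 'i) \<Rightarrow> ('n, 'm) cat \<Rightarrow> ('i, 'i) cat" where
  "transport_cat e0 e1 K = \<lparr>
     Obj = e0 ` Obj K,
     Arr = e1 ` Arr K,
     Dom = e0 \<circ> Dom K \<circ> inv_into UNIV e1,
     Cod = e0 \<circ> Cod K \<circ> inv_into UNIV e1,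
     Id = e1 \<circ> Id K \<circ> inv_into UNIV e0,
     Comp = (\<lambda>m n. e1 (inv_into UNIV e1 m \<cdot>\<^bsub>K\<^esub> inv_into UNIV e1 n))\<rparr>"

text \<open>A diagram \<open>(F0, F1)\<close> of shape \<open>K\<close> as a formal colimit over the transported category.\<close>

definition transport_ind ::
  "('n \<Rightarrow> 'i) \<Rightarrow> ('m \<Rightarrow> 'i) \<Rightarrow> ('n, 'm) cat \<Rightarrow> ('n \<Rightarrow> 'o) \<Rightarrow> ('m \<Rightarrow> 'a) \<Rightarrow> ('i, 'o, 'a) ind_obj" where
  "transport_ind e0 e1 K F0 F1 = \<lparr>idx = transport_cat e0 e1 K, ob = F0 \<circ> inv_into UNIV e0, ar = F1 \<circ> inv_into UNIV e1\<rparr>"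

locale transport =
  fixes e0 :: "'n \<Rightarrow> 'i" and e1 :: "'m \<Rightarrow> 'i" and K :: "('n, 'm) cat"
  assumes inj0: "inj e0" and inj1: "inj e1"
begin

abbreviation "R \<equiv> transport_cat e0 e1 K"

lemma transport_simps:
  "Obj R = e0 ` Obj K" "Arr R = e1 ` Arr K" "Dom R (e1 m) = e0 (Dom K m)" "Cod R (e1 m) = e0 (Cod K m)"
  "Id R (e0 i) = e1 (Id K i)" "e1 m \<cdot>\<^bsub>R\<^esub> e1 n = e1 (m \<cdot>\<^bsub>K\<^esub> n)"
  using inj0 inj1 by (simp_all add: transport_cat_def)

lemma transport_Hom_iff: "e1 m \<in> Hom R (e0 i) (e0 j) \<longleftrightarrow> m \<in> Hom K i j"
  using inj0 inj1 by (simp add: Hom_def transport_simps inj_image_mem_iff inj_eq)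

lemma transport_HomE:
  assumes "x \<in> Hom R a b"
  obtains m i j where "x = e1 m" "a = e0 i" "b = e0 j" "m \<in> Hom K i j"
  using assms that by (auto simp: Hom_def transport_simps)

lemma transport_category:
  assumes "category K" shows "category R"
proof -
  interpret K: category K by fact
  show ?thesis
  proof
    fix f assume "f \<in> Arr R"
    then show "Dom R f \<in> Obj R" "Cod R f \<in> Obj R"
      using K.Dom_Obj K.Cod_Obj by (auto simp: transport_simps)
  next
    fix X assume "X \<in> Obj R"
    then obtain i where "X = e0 i" "i \<in> Obj K" by (auto simp: transport_simps)
    then show "Id R X \<in> Hom R X X" using K.Id_Hom by (simp add: transport_simps transport_Hom_iff)
  next
    fix f X Y g Z assume f: "f \<in> Hom R X Y" and g: "g \<in> Hom R Y Z"
    obtain m i j where m: "f = e1 m" "X = e0 i" "Y = e0 j" "m \<in> Hom K i j" using f by (rule transport_HomE)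
    obtain n j' k where n: "g = e1 n" "Y = e0 j'" "Z = e0 k" "n \<in> Hom K j' k" using g by (rule transport_HomE)
    have "j' = j" using m n inj0 by (simp add: inj_eq)
    then show "g \<cdot>\<^bsub>R\<^esub> f \<in> Hom R X Z"
      using m n K.Comp_Hom by (simp add: transport_simps transport_Hom_iff)
  next
    fix f X Y assume f: "f \<in> Hom R X Y"
    obtain m i j where m: "f = e1 m" "X = e0 i" "Y = e0 j" "m \<in> Hom K i j" using f by (rule transport_HomE)
    then show "f \<cdot>\<^bsub>R\<^esub> Id R X = f" "Id R Y \<cdot>\<^bsub>R\<^esub> f = f"
      using K.Comp_Id K.Id_Comp by (simp_all add: transport_simps)
  next
    fix f W X g Y h Z assume f: "f \<in> Hom R W X" and g: "g \<in> Hom R X Y" and h: "h \<in> Hom R Y Z"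
    obtain m i j where m: "f = e1 m" "W = e0 i" "X = e0 j" "m \<in> Hom K i j" using f by (rule transport_HomE)
    obtain n j' k where n: "g = e1 n" "X = e0 j'" "Y = e0 k" "n \<in> Hom K j' k" using g by (rule transport_HomE)
    obtain r k' l where r: "h = e1 r" "Y = e0 k'" "Z = e0 l" "r \<in> Hom K k' l" using h by (rule transport_HomE)
    have "j' = j" "k' = k" using m n r inj0 by (simp_all add: inj_eq)
    then show "(h \<cdot>\<^bsub>R\<^esub> g) \<cdot>\<^bsub>R\<^esub> f = h \<cdot>\<^bsub>R\<^esub> (g \<cdot>\<^bsub>R\<^esub> f)"
      using m n r K.Comp_assoc by (simp add: transport_simps)
  qed
qed

lemma transport_filtered:
  assumes "filtered K" shows "filtered R"
  unfolding filtered_def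
proof (intro conjI ballI)
  show "category R" using transport_category filtered_category assms by blast
  show "Obj R \<noteq> {}" using assms by (simp add: transport_simps filtered_def)
next
  fix a b assume "a \<in> Obj R" "b \<in> Obj R"
  then obtain i j where i: "a = e0 i" "i \<in> Obj K" and j: "b = e0 j" "j \<in> Obj K" by (auto simp: transport_simps)
  obtain k u v where "u \<in> Hom K i k" "v \<in> Hom K j k" using filtered_upper[OF assms i(2) j(2)] .
  then have "e1 u \<in> Hom R a (e0 k)" "e1 v \<in> Hom R b (e0 k)" "e0 k \<in> Obj R"
    using i j category.Hom_ObjD(2)[OF filtered_category[OF assms]]
    by (auto simp: transport_Hom_iff transport_simps)
  then show "\<exists>k\<in>Obj R. Hom R a k \<noteq> {} \<and> Hom R b k \<noteq> {}" by blast
next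
  fix a b x y assume x: "x \<in> Hom R a b" and y: "y \<in> Hom R a b"
  obtain m i j where m: "x = e1 m" "a = e0 i" "b = e0 j" "m \<in> Hom K i j" using x by (rule transport_HomE)
  obtain n i' j' where n: "y = e1 n" "a = e0 i'" "b = e0 j'" "n \<in> Hom K i' j'" using y by (rule transport_HomE)
  have "i' = i" "j' = j" using m n inj0 by (simp_all add: inj_eq)
  then obtain k h where h: "h \<in> Hom K j k" "h \<cdot>\<^bsub>K\<^esub> m = h \<cdot>\<^bsub>K\<^esub> n"
    using filtered_coequalize[OF assms m(4)] n(4) by blast
  then have "e1 h \<in> Hom R b (e0 k)" "e1 h \<cdot>\<^bsub>R\<^esub> x = e1 h \<cdot>\<^bsub>R\<^esub> y" "e0 k \<in> Obj R"
    using m n category.Hom_ObjD(2)[OF filtered_category[OF assms]]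
    by (auto simp: transport_Hom_iff transport_simps)
  then show "\<exists>k\<in>Obj R. \<exists>h\<in>Hom R b k. h \<cdot>\<^bsub>R\<^esub> x = h \<cdot>\<^bsub>R\<^esub> y" by blast
qed

lemma transport_ind_simps [simp]:
  "idx (transport_ind e0 e1 K F0 F1) = R"
  "ob (transport_ind e0 e1 K F0 F1) (e0 i) = F0 i"
  "ar (transport_ind e0 e1 K F0 F1) (e1 m) = F1 m"
  using inj0 inj1 by (simp_all add: transport_ind_def)

lemma transport_ind_object:
  assumes "filtered K" "is_functor K C F0 F1"
  shows "ind_object C (transport_ind e0 e1 K F0 F1)"
proof -
  note F = is_functorD[OF assms(2)]
  have "F1 (n \<cdot>\<^bsub>K\<^esub> m) = F1 n \<cdot>\<^bsub>C\<^esub> F1 m" if "m \<in> Arr K" "n \<in> Arr K" "e0 (Dom K n) = e0 (Cod K m)" for m n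
    using that F(4) inj0 by (simp add: Hom_def inj_eq)
  then show ?thesis
    using transport_filtered[OF assms(1)] F(1,2) F(3) unfolding ind_object_def is_functor_def
    by (auto simp: transport_simps Hom_def)
qed

end

lemma point_cat_simps [simp]:
  "Obj point_cat = UNIV" "Arr point_cat = UNIV" "Dom point_cat m = m" "Cod point_cat m = m"
  "Id point_cat i = i" "m \<cdot>\<^bsub>point_cat\<^esub> n = ()" "Hom point_cat i j = UNIV"
  by (auto simp: point_cat_def Hom_def)

lemma filtered_point_cat: "filtered point_cat"
  by (auto simp: filtered_def category_def)

context category
begin

text \<open>An object of \<open>C\<close> as an ind-object whose single index lies in an arbitrary type.\<close>

lemma const_ind_object:
  assumes X: "X \<in> Obj C"
  obtains E :: "('i, 'o, 'a) ind_obj" and c where "ind_object C E" "Obj (idx E) = {c}" "ob E c = X"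
    "\<forall>u\<in>Arr (idx E). ar E u = Id C X"
proof -
  define e :: "unit \<Rightarrow> 'i" where "e = (\<lambda>_. undefined)"
  interpret transport e e point_cat by standard (simp_all add: inj_on_def)
  let ?E = "transport_ind e e point_cat (\<lambda>_. X) (\<lambda>_. Id C X)"
  have "is_functor point_cat C (\<lambda>_. X) (\<lambda>_. Id C X)"
    using X Id_Hom Comp_Id[OF Id_Hom[OF X]] by (simp add: is_functor_def)
  then have "ind_object C ?E" using transport_ind_object filtered_point_cat by blast
  moreover have "Obj (idx ?E) = {e ()}" by (auto simp: transport_simps)
  moreover have "ob ?E (e ()) = X" by simp
  moreover have "\<forall>u\<in>Arr (idx ?E). ar ?E u = Id C X" by (auto simp: transport_simps)
  ultimately show ?thesis by (rule that)
qed

end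

context quasi_abelian_category
begin

lemma same_germ_zero:
  assumes F: "ind_object C F" and X: "X \<in> Obj C" and j: "j \<in> Obj (idx F)" "j' \<in> Obj (idx F)"
  shows "same_germ F j (zero X (ob F j)) j' (zero X (ob F j'))"
proof -
  obtain k u v where k: "u \<in> Hom (idx F) j k" "v \<in> Hom (idx F) j' k"
    using filtered_upper[OF ind_filtered[OF F] j] .
  then show ?thesis using Comp_zero[OF ar_Hom[OF F k(1)] X] Comp_zero[OF ar_Hom[OF F k(2)] X] by (intro same_germI[OF k]) simp
qed

lemma same_germ_zeroE:
  assumes F: "ind_object C F" and \<phi>: "\<phi> \<in> Hom C X (ob F j)" and g: "same_germ F j \<phi> j' (zero X (ob F j'))"
  obtains k u where "u \<in> Hom (idx F) j k" "ar F u \<cdot> \<phi> = zero X (ob F k)"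
proof -
  obtain k u v where k: "u \<in> Hom (idx F) j k" "v \<in> Hom (idx F) j' k" "ar F u \<cdot> \<phi> = ar F v \<cdot> zero X (ob F j')"
    using g by (rule same_germE)
  show ?thesis using that[OF k(1)] k(3) Comp_zero[OF ar_Hom[OF F k(2)] Hom_ObjD(1)[OF \<phi>]] by simp
qed

text \<open>The zero morphisms of ind-objects: some representative at each index is a zero arrow.\<close>

definition ind_zero :: "('i, 'o, 'a) ind_obj \<Rightarrow> ('j, 'o, 'a) ind_obj \<Rightarrow> ('i \<Rightarrow> ('j \<times> 'a) set) \<Rightarrow> bool" where
  "ind_zero E F x \<longleftrightarrow> (\<forall>i\<in>Obj (idx E). \<exists>j. (j, zero (ob E i) (ob F j)) \<in> x i)"

lemma ind_zero_unique:
  assumes E: "ind_object C E" and F: "ind_object C F"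
    and x: "x \<in> ind_hom C E F" "ind_zero E F x" and y: "y \<in> ind_hom C E F" "ind_zero E F y"
  shows "x = y"
proof (rule ind_hom_ext[OF F x(1) y(1)])
  fix i assume i: "i \<in> Obj (idx E)"
  then obtain j j' where j: "(j, zero (ob E i) (ob F j)) \<in> x i" "(j', zero (ob E i) (ob F j')) \<in> y i"
    using x y unfolding ind_zero_def by blast
  note D = ind_hom_memD[OF F x(1) j(1)] and D' = ind_hom_memD[OF F y(1) j(2)]
  show "\<exists>j \<phi>. (j, \<phi>) \<in> x i \<and> (j, \<phi>) \<in> y i"
    using ind_hom_mem_same_germ[OF F y(1) j(2) D(2,3) same_germ_zero[OF F ob_Obj[OF E i] D'(2) D(2)]] j(1) by blast
qed

lemma ind_zero_exists:
  assumes E: "ind_object C E" and F: "ind_object C F"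
  obtains x where "x \<in> ind_hom C E F" "ind_zero E F x"
proof -
  obtain j where j: "j \<in> Obj (idx F)" using ind_filtered[OF F] unfolding filtered_def by blast
  let ?z = "\<lambda>i. zero (ob E i) (ob F j)"
  interpret I: category "idx E" using E by (rule ind_category)
  have H: "\<And>i. i \<in> Obj (idx E) \<Longrightarrow> ?z i \<in> Hom C (ob E i) (ob F j)"
    using zero_Hom ob_Obj[OF E] ob_Obj[OF F j] by blast
  have c: "same_germ F j (?z i' \<cdot> ar E m) j (?z i)" if m: "m \<in> Hom (idx E) i i'" for m i i'
    using zero_Comp[OF ar_Hom[OF E m] ob_Obj[OF F j]] same_germ_refl[OF F j] by simp
  note M = make_hom[OF E F j H c]
  show ?thesis using that[OF M(1)] M(2) unfolding ind_zero_def by blast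
qed

text \<open>Any zero object \<open>Z\<close> of \<open>Ind C\<close> makes the comparison possible: the only morphism from \<open>Z\<close> to \<open>F\<close> is then
  the morphism with zero representatives, and every morphism with zero representatives factors through
  \<open>Z\<close>.\<close>

lemma Ind_zero_arrow_iff:
  assumes Z: "zero_object (Ind C) (Z :: ('i, 'o, 'a) ind_obj)"
    and E: "ind_object C (E :: ('i, 'o, 'a) ind_obj)" and F: "ind_object C F" and x: "x \<in> ind_hom C E F"
  shows "zero_arrow (Ind C) (E, F, x) \<longleftrightarrow> ind_zero E F x"
proof
  assume "zero_arrow (Ind C) (E, F, x)"
  then obtain Z' a b where Z': "zero_object (Ind C) Z'" and a: "a \<in> Hom (Ind C) E Z'" and b: "b \<in> Hom (Ind C) Z' F"
    and e: "(E, F, x) = b \<cdot>\<^bsub>Ind C\<^esub> a"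
    unfolding zero_arrow_def by auto
  obtain a' where a': "a = (E, Z', a')" "ind_object C Z'" "a' \<in> ind_hom C E Z'" using a unfolding Ind_Hom_iff by blast
  obtain b' where b': "b = (Z', F, b')" "b' \<in> ind_hom C Z' F" using b unfolding Ind_Hom_iff by blast
  have xe: "x = ind_comp C E F b' a'" using e a' b' by simp
  obtain z where z: "z \<in> ind_hom C Z' F" "ind_zero Z' F z" using ind_zero_exists[OF a'(2) F] .
  have "F \<in> Obj (Ind C)" using F by simp
  then have "\<exists>!f. f \<in> Hom (Ind C) Z' F" using Z' unfolding zero_object_def by blast
  then have "(Z', F, b') = (Z', F, z)" using a'(2) F b'(2) z(1) unfolding Ind_Hom_iff by blast
  then have bz: "ind_zero Z' F b'" using z by simp
  show "ind_zero E F x" unfolding ind_zero_def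
  proof
    fix i assume "i \<in> Obj (idx E)"
    then obtain j \<phi> where j: "(j, \<phi>) \<in> a' i" using ind_hom_rep[OF a'(2,3)] by blast
    note D = ind_hom_memD[OF a'(2,3) j]
    obtain k where k: "(k, zero (ob Z' j) (ob F k)) \<in> b' j" using bz D(2) unfolding ind_zero_def by blast
    note D' = ind_hom_memD[OF F b'(2) k]
    show "\<exists>k. (k, zero (ob E i) (ob F k)) \<in> x i"
      using ind_comp(2)[OF E a'(2) F a'(3) b'(2) j k] zero_Comp[OF D(3) ob_Obj[OF F D'(2)]] xe by auto
  qed
next
  assume zx: "ind_zero E F x"
  have Zi: "ind_object C Z" using Z unfolding zero_object_def by simp
  obtain a where a: "a \<in> ind_hom C E Z" "ind_zero E Z a" using ind_zero_exists[OF E Zi] .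
  obtain b where b: "b \<in> ind_hom C Z F" "ind_zero Z F b" using ind_zero_exists[OF Zi F] .
  have "ind_zero E F (ind_comp C E F b a)" unfolding ind_zero_def
  proof
    fix i assume i: "i \<in> Obj (idx E)"
    then obtain j where j: "(j, zero (ob E i) (ob Z j)) \<in> a i" using a(2) unfolding ind_zero_def by blast
    note D = ind_hom_memD[OF Zi a(1) j]
    obtain k where k: "(k, zero (ob Z j) (ob F k)) \<in> b j" using b D(2) unfolding ind_zero_def by blast
    note D' = ind_hom_memD[OF F b(1) k]
    show "\<exists>k. (k, zero (ob E i) (ob F k)) \<in> ind_comp C E F b a i"
      using ind_comp(2)[OF E Zi F a(1) b(1) j k] zero_Comp[OF D(3) ob_Obj[OF F D'(2)]] by auto
  qed
  then have "x = ind_comp C E F b a"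
    using ind_zero_unique[OF E F x zx ind_comp(1)[OF E Zi F a(1) b(1)]] by simp
  then have "(E, F, x) = (Z, F, b) \<cdot>\<^bsub>Ind C\<^esub> (E, Z, a)" by simp
  moreover have "(E, Z, a) \<in> Hom (Ind C) E Z" "(Z, F, b) \<in> Hom (Ind C) Z F"
    using a b E F Zi unfolding Ind_Hom_iff by auto
  ultimately show "zero_arrow (Ind C) (E, F, x)"
    unfolding zero_arrow_def using Z E F x Ind_simps(2-4) by metis
qed

lemma kernel_lift:
  "is_kernel D f k \<Longrightarrow> X \<in> Obj D \<Longrightarrow> h \<in> Hom D X (Dom D f) \<Longrightarrow> zero_arrow D (f \<cdot>\<^bsub>D\<^esub> h) \<Longrightarrow>
    \<exists>u. u \<in> Hom D X (Dom D k) \<and> k \<cdot>\<^bsub>D\<^esub> u = h"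
  unfolding is_kernel_def by blast

lemma cokernel_lift:
  "is_cokernel D f q \<Longrightarrow> X \<in> Obj D \<Longrightarrow> h \<in> Hom D (Cod D f) X \<Longrightarrow> zero_arrow D (h \<cdot>\<^bsub>D\<^esub> f) \<Longrightarrow>
    \<exists>!u. u \<in> Hom D (Cod D q) X \<and> u \<cdot>\<^bsub>D\<^esub> q = h"
  unfolding is_cokernel_def by blast

lemma kernel_zero_object: "is_kernel D f k \<Longrightarrow> \<exists>Z. zero_object D Z"
  unfolding is_kernel_def zero_arrow_def by blast

text \<open>The universal property of a kernel in \<open>Ind C\<close>, tested on the constant ind-object \<open>X\<close> and expressed by
  representatives.\<close>

lemma ind_kernel_factor:
  fixes U V W :: "('i, 'o, 'a) ind_obj"
  assumes U: "ind_object C U" and V: "ind_object C V" and W: "ind_object C W"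
    and f: "f \<in> ind_hom C U V" and g: "g \<in> ind_hom C V W"
    and ker: "is_kernel (Ind C) (V, W, g) (U, V, f)"
    and p: "(k, p) \<in> g j" and a: "a \<in> Hom C X (ob V j)" "p \<cdot> a = zero X (ob W k)"
  obtains i \<delta> j' \<phi> t where "\<delta> \<in> Hom C X (ob U i)" "(j', \<phi>) \<in> f i" "t \<in> Hom (idx V) j j'"
    "\<phi> \<cdot> \<delta> = ar V t \<cdot> a"
proof -
  have X: "X \<in> Obj C" using a Hom_ObjD by blast
  note pD = ind_hom_memD[OF W g p]
  obtain E :: "('i, 'o, 'a) ind_obj" and c where E: "ind_object C E" "Obj (idx E) = {c}" "ob E c = X"
    and EA: "\<forall>u\<in>Arr (idx E). ar E u = Id C X"
    using const_ind_object[OF X] .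
  let ?a = "make_hom E V (\<lambda>_. j) (\<lambda>_. a)"
  have comp: "same_germ V j (a \<cdot> ar E m) j a" if m: "m \<in> Hom (idx E) i i'" for m i i'
  proof -
    have "ar E m = Id C X" using EA m by (simp add: Hom_def)
    then show ?thesis using Comp_Id[OF a(1)] same_germ_refl[OF V pD(1)] by simp
  qed
  have H: "j \<in> Obj (idx V)" "a \<in> Hom C (ob E i) (ob V j)" if "i \<in> Obj (idx E)" for i
    using pD(1) a(1) E that by auto
  note M = make_hom[where n = "\<lambda>_. j" and r = "\<lambda>_. a", OF E(1) V H comp]
  have aH: "?a \<in> ind_hom C E V" and am: "(j, a) \<in> ?a c" using M E(2) by simp_all
  obtain Z :: "('i, 'o, 'a) ind_obj" where Z: "zero_object (Ind C) Z"
    using kernel_zero_object[OF ker] by blast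
  note gaH = ind_comp(1)[OF E(1) V W aH g] and gam = ind_comp(2)[OF E(1) V W aH g am p]
  have "ind_zero E W (ind_comp C E W g ?a)"
    unfolding ind_zero_def using E gam a(2) by auto
  then have "zero_arrow (Ind C) ((V, W, g) \<cdot>\<^bsub>Ind C\<^esub> (E, V, ?a))"
    using Ind_zero_arrow_iff[OF Z E(1) W gaH] by simp
  moreover have "(E, V, ?a) \<in> Hom (Ind C) E V" using E V aH unfolding Ind_Hom_iff by blast
  ultimately obtain u where u: "u \<in> Hom (Ind C) E U" "(U, V, f) \<cdot>\<^bsub>Ind C\<^esub> u = (E, V, ?a)"
    using kernel_lift[OF ker, of E "(E, V, ?a)"] E(1) by auto
  obtain d where d: "u = (E, U, d)" "d \<in> ind_hom C E U" using u(1) unfolding Ind_Hom_iff by blast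
  have e: "ind_comp C E V f d = ?a" using u(2) d by simp
  obtain i \<delta> where i: "(i, \<delta>) \<in> d c" using ind_hom_rep[OF U d(2), of c] E(2) by auto
  note iD = ind_hom_memD[OF U d(2) i]
  obtain j1 \<phi>1 where j1: "(j1, \<phi>1) \<in> f i" using ind_hom_rep[OF V f iD(2)] .
  note jD = ind_hom_memD[OF V f j1]
  have "(j1, \<phi>1 \<cdot> \<delta>) \<in> ?a c" using ind_comp(2)[OF E(1) U V d(2) f i j1] e by simp
  then obtain j' s t where st: "s \<in> Hom (idx V) j1 j'" "t \<in> Hom (idx V) j j'" "ar V s \<cdot> \<phi>1 \<cdot> \<delta> = ar V t \<cdot> a"
    using ind_hom_same_germ[OF V aH _ am, of j1 "\<phi>1 \<cdot> \<delta>"] unfolding same_germ_def by blast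
  have \<delta>: "\<delta> \<in> Hom C X (ob U i)" using iD(3) E(3) by simp
  show ?thesis
    using that[OF \<delta> ind_hom_post[OF V f j1 st(1)] st(2)] Comp_assoc[OF \<delta> jD(3) ar_Hom[OF V st(1)]] st(3) by simp
qed

end

lemma infinite_pair_inj:
  assumes "infinite (UNIV :: 'i set)"
  shows "\<exists>e :: 'i \<times> 'i \<Rightarrow> 'i. inj e"
proof -
  have "(card_of ((UNIV :: 'i set) \<times> (UNIV :: 'i set)), card_of (UNIV :: 'i set)) \<in> ordIso"
    using card_of_Times_same_infinite assms by blast
  then obtain e where "bij_betw e ((UNIV :: 'i set) \<times> (UNIV :: 'i set)) (UNIV :: 'i set)"
    using card_of_ordIso by blast
  then show ?thesis by (auto simp: bij_betw_def)
qed

section \<open>Images and cokernels of ind-objects\<close>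

text \<open>A morphism \<open>g : V \<rightarrow> W\<close> of ind-objects. Its image is constructed as an ind-object with indices of the
  same type \<open>'i\<close>, which is taken to be infinite so that tuples of indices can be
  coded by indices.\<close>

locale ind_morphism = quasi_abelian_category C add zero
  for C :: "('o, 'a, 'z) cat_scheme" (structure) and add zero +
  fixes V W :: "('i, 'o, 'a) ind_obj" and g :: "'i \<Rightarrow> ('i \<times> 'a) set"
  assumes V: "ind_object C V" and W: "ind_object C W" and g: "g \<in> ind_hom C V W"
    and inf: "infinite (UNIV :: 'i set)"
begin

text \<open>A representative of \<open>g\<close> at each index \<open>j\<close> of \<open>V\<close>.\<close>

definition rep_idx :: "'i \<Rightarrow> 'i" where "rep_idx j = (SOME k. \<exists>p. (k, p) \<in> g j)"
definition rep :: "'i \<Rightarrow> 'a" where "rep j = (SOME p. (rep_idx j, p) \<in> g j)"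

lemma rep_mem: assumes "j \<in> Obj (idx V)" shows "(rep_idx j, rep j) \<in> g j"
proof -
  have "\<exists>k p. (k, p) \<in> g j" using ind_hom_rep[OF W g assms] by metis
  then have "\<exists>p. (rep_idx j, p) \<in> g j" unfolding rep_idx_def by (rule someI_ex)
  then show ?thesis unfolding rep_def by (rule someI_ex)
qed

text \<open>The indices of the image: pairs of an index \<open>j\<close> of \<open>V\<close> and an arrow \<open>w\<close> out of \<open>rep_idx j\<close>, that is, a
  representative \<open>img_arr (j, w)\<close> of \<open>g\<close> at \<open>j\<close>. For such an index \<open>s\<close>, \<open>tgt s\<close> is the index of \<open>W\<close> in which \<open>img_arr s\<close> ends, \<open>nu s\<close> is a kernel of
  \<open>img_arr s\<close>, and \<open>pr s\<close> is the projection onto its coimage \<open>Q s\<close>.\<close>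

definition img_idx :: "('i \<times> 'i) set" where
  "img_idx = {(j, w). j \<in> Obj (idx V) \<and> w \<in> Arr (idx W) \<and> Dom (idx W) w = rep_idx j}"
definition tgt :: "'i \<times> 'i \<Rightarrow> 'i" where "tgt s = Cod (idx W) (snd s)"
definition img_arr :: "'i \<times> 'i \<Rightarrow> 'a" where "img_arr s = ar W (snd s) \<cdot> rep (fst s)"
definition nu :: "'i \<times> 'i \<Rightarrow> 'a" where "nu s = (SOME k. is_kernel C (img_arr s) k)"
definition pr :: "'i \<times> 'i \<Rightarrow> 'a" where "pr s = (SOME q. is_cokernel C (nu s) q)"
definition Q :: "'i \<times> 'i \<Rightarrow> 'o" where "Q s = Cod C (pr s)"

lemma img_idxI:
  assumes "j \<in> Obj (idx V)" "w \<in> Hom (idx W) (rep_idx j) k" shows "(j, w) \<in> img_idx" "tgt (j, w) = k"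
  using assms by (auto simp: img_idx_def tgt_def Hom_def)

lemma img_idxD:
  assumes "s \<in> img_idx"
  shows "fst s \<in> Obj (idx V)" "snd s \<in> Hom (idx W) (rep_idx (fst s)) (tgt s)"
    "(tgt s, img_arr s) \<in> g (fst s)" "img_arr s \<in> Hom C (ob V (fst s)) (ob W (tgt s))"
    "tgt s \<in> Obj (idx W)"
proof -
  show j: "fst s \<in> Obj (idx V)" and w: "snd s \<in> Hom (idx W) (rep_idx (fst s)) (tgt s)"
    using assms by (auto simp: img_idx_def tgt_def Hom_def)
  show m: "(tgt s, img_arr s) \<in> g (fst s)"
    unfolding img_arr_def using ind_hom_post[OF W g rep_mem[OF j] w] .
  show "img_arr s \<in> Hom C (ob V (fst s)) (ob W (tgt s))" "tgt s \<in> Obj (idx W)"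
    using ind_hom_memD[OF W g m] by auto
qed

lemma img_exact:
  assumes "s \<in> img_idx"
  shows "is_kernel C (img_arr s) (nu s)" "is_cokernel C (nu s) (pr s)" "is_kernel C (pr s) (nu s)"
    "nu s \<in> Hom C (Dom C (nu s)) (ob V (fst s))" "pr s \<in> Hom C (ob V (fst s)) (Q s)"
    "img_arr s \<cdot> nu s = zero (Dom C (nu s)) (ob W (tgt s))"
    "pr s \<cdot> nu s = zero (Dom C (nu s)) (Q s)"
proof -
  note P = img_idxD(4)[OF assms]
  have "\<exists>k. is_kernel C (img_arr s) k" using kernel_exists[OF P] by metis
  then show k: "is_kernel C (img_arr s) (nu s)" unfolding nu_def by (rule someI_ex)
  show kH: "nu s \<in> Hom C (Dom C (nu s)) (ob V (fst s))"
    "img_arr s \<cdot> nu s = zero (Dom C (nu s)) (ob W (tgt s))"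
    using k is_kernel_iff[OF P] by auto
  have "\<exists>q. is_cokernel C (nu s) q" using cokernel_exists[OF kH(1)] by metis
  then show c: "is_cokernel C (nu s) (pr s)" unfolding pr_def by (rule someI_ex)
  show "pr s \<in> Hom C (ob V (fst s)) (Q s)" "pr s \<cdot> nu s = zero (Dom C (nu s)) (Q s)"
    using c is_cokernel_iff[OF kH(1)] unfolding Q_def by auto
  show "is_kernel C (pr s) (nu s)" using kernel_of_cokernel[OF k c] .
qed

lemma pr_factor:
  assumes "s \<in> img_idx" "h \<in> Hom C (ob V (fst s)) X" "h \<cdot> nu s = zero (Dom C (nu s)) X"
  obtains u where "u \<in> Hom C (Q s) X" "u \<cdot> pr s = h"
  using cokernel_factor[OF img_exact(2,4)[OF assms(1)] assms(2,3)] unfolding Q_def .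

lemma pr_cancel:
  "s \<in> img_idx \<Longrightarrow> u \<in> Hom C (Q s) X \<Longrightarrow> u' \<in> Hom C (Q s) X \<Longrightarrow> u \<cdot> pr s = u' \<cdot> pr s \<Longrightarrow> u = u'"
  using cokernel_cancel[OF img_exact(2)] unfolding Q_def by blast

text \<open>An arrow \<open>m : j \<rightarrow> j'\<close> is an arrow of the index category of the image if it induces an arrow of the quotients.\<close>

definition img_arrows :: "(('i \<times> 'i) \<times> 'i \<times> ('i \<times> 'i)) set" where
  "img_arrows = {(s, m, s'). s \<in> img_idx \<and> s' \<in> img_idx \<and> m \<in> Hom (idx V) (fst s) (fst s') \<and>
     (\<exists>t. t \<in> Hom C (Q s) (Q s') \<and> t \<cdot> pr s = pr s' \<cdot> ar V m)}"

text \<open>The arrow of coimages over \<open>m\<close>.\<close>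

definition induced :: "('i \<times> 'i) \<times> 'i \<times> ('i \<times> 'i) \<Rightarrow> 'a" where
  "induced = (\<lambda>(s, m, s'). SOME t. t \<in> Hom C (Q s) (Q s') \<and> t \<cdot> pr s = pr s' \<cdot> ar V m)"

text \<open>The index category of the image. An arrow carries its domain and its codomain, because the same \<open>m\<close>
  occurs between several indices.\<close>

definition img_cat :: "('i \<times> 'i, ('i \<times> 'i) \<times> 'i \<times> ('i \<times> 'i)) cat" where
  "img_cat = \<lparr>Obj = img_idx, Arr = img_arrows, Dom = fst, Cod = (\<lambda>\<alpha>. snd (snd \<alpha>)),
     Id = (\<lambda>s. (s, Id (idx V) (fst s), s)),
     Comp = (\<lambda>(s2, n, s3) (s1, m, s2'). (s1, n \<cdot>\<^bsub>idx V\<^esub> m, s3))\<rparr>"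

lemma img_cat_simps [simp]:
  "Obj img_cat = img_idx" "Arr img_cat = img_arrows"
  "Dom img_cat (s, m, s') = s" "Cod img_cat (s, m, s') = s'"
  "Id img_cat s = (s, Id (idx V) (fst s), s)"
  "(s2, n, s3) \<cdot>\<^bsub>img_cat\<^esub> (s1, m, s2') = (s1, n \<cdot>\<^bsub>idx V\<^esub> m, s3)"
  by (simp_all add: img_cat_def)

lemma img_Hom_iff:
  "\<alpha> \<in> Hom img_cat s s' \<longleftrightarrow> (\<exists>m. \<alpha> = (s, m, s') \<and> (s, m, s') \<in> img_arrows)"
  by (cases \<alpha>) (auto simp: Hom_def)

lemma img_arrowsD:
  assumes "(s, m, s') \<in> img_arrows"
  shows "s \<in> img_idx" "s' \<in> img_idx" "m \<in> Hom (idx V) (fst s) (fst s')"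
  using assms by (auto simp: img_arrows_def)

lemma induced:
  assumes "(s, m, s') \<in> img_arrows"
  shows "induced (s, m, s') \<in> Hom C (Q s) (Q s')" "induced (s, m, s') \<cdot> pr s = pr s' \<cdot> ar V m"
proof -
  have "\<exists>t. t \<in> Hom C (Q s) (Q s') \<and> t \<cdot> pr s = pr s' \<cdot> ar V m"
    using assms by (auto simp: img_arrows_def)
  then show "induced (s, m, s') \<in> Hom C (Q s) (Q s')" "induced (s, m, s') \<cdot> pr s = pr s' \<cdot> ar V m"
    using someI_ex[of "\<lambda>t. t \<in> Hom C (Q s) (Q s') \<and> t \<cdot> pr s = pr s' \<cdot> ar V m"] by (auto simp: induced_def)
qed

lemma induced_unique:
  assumes "(s, m, s') \<in> img_arrows" "t \<in> Hom C (Q s) (Q s')" "t \<cdot> pr s = pr s' \<cdot> ar V m"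
  shows "induced (s, m, s') = t"
  using pr_cancel[OF img_arrowsD(1)[OF assms(1)] induced(1)[OF assms(1)] assms(2)] induced(2)[OF assms(1)] assms(3)
  by simp

lemma img_arrows_Id:
  assumes "s \<in> img_idx"
  shows "(s, Id (idx V) (fst s), s) \<in> img_arrows" "induced (s, Id (idx V) (fst s), s) = Id C (Q s)"
proof -
  interpret I: category "idx V" using V by (rule ind_category)
  note j = img_idxD(1)[OF assms] and p = img_exact(5)[OF assms]
  note QO = Hom_ObjD(2)[OF p]
  have e: "Id C (Q s) \<cdot> pr s = pr s \<cdot> ar V (Id (idx V) (fst s))"
    using Id_Comp[OF p] Comp_Id[OF p] ar_Id[OF V j] by simp
  show m: "(s, Id (idx V) (fst s), s) \<in> img_arrows"
    using assms I.Id_Hom[OF j] e Id_Hom[OF QO] by (auto simp: img_arrows_def)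
  show "induced (s, Id (idx V) (fst s), s) = Id C (Q s)" using induced_unique[OF m Id_Hom[OF QO] e] .
qed

lemma img_arrows_Comp:
  assumes a: "(s1, m, s2) \<in> img_arrows" and b: "(s2, n, s3) \<in> img_arrows"
  shows "(s1, n \<cdot>\<^bsub>idx V\<^esub> m, s3) \<in> img_arrows"
    "induced (s1, n \<cdot>\<^bsub>idx V\<^esub> m, s3) = induced (s2, n, s3) \<cdot> induced (s1, m, s2)"
proof -
  interpret I: category "idx V" using V by (rule ind_category)
  note A = img_arrowsD[OF a] and B = img_arrowsD[OF b]
  note p1 = img_exact(5)[OF A(1)] and p2 = img_exact(5)[OF A(2)] and p3 = img_exact(5)[OF B(2)]
  let ?t = "induced (s2, n, s3) \<cdot> induced (s1, m, s2)"
  note tH = Comp_Hom[OF induced(1)[OF a] induced(1)[OF b]]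
  have "?t \<cdot> pr s1 = induced (s2, n, s3) \<cdot> (pr s2 \<cdot> ar V m)"
    using Comp_assoc[OF p1 induced(1)[OF a] induced(1)[OF b]] induced(2)[OF a] by simp
  also have "\<dots> = pr s3 \<cdot> (ar V n \<cdot> ar V m)"
    by (rule Comp_rewrite[OF induced(2)[OF b] p2 induced(1)[OF b] ar_Hom[OF V B(3)] p3 ar_Hom[OF V A(3)]])
  finally have e: "?t \<cdot> pr s1 = pr s3 \<cdot> ar V (n \<cdot>\<^bsub>idx V\<^esub> m)" using ar_Comp[OF V A(3) B(3)] by simp
  show m: "(s1, n \<cdot>\<^bsub>idx V\<^esub> m, s3) \<in> img_arrows"
    using A B I.Comp_Hom[OF A(3) B(3)] e tH by (auto simp: img_arrows_def)
  show "induced (s1, n \<cdot>\<^bsub>idx V\<^esub> m, s3) = ?t" using induced_unique[OF m tH e] .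
qed

text \<open>Enlarging \<open>w\<close> enlarges the kernel of the representative, so for large \<open>w\<close> given arrows of the index
  category of \<open>V\<close> with codomain \<open>j\<close> become arrows of the image with codomain \<open>(j, w)\<close>.\<close>

lemma img_extend:
  assumes s: "s1 \<in> img_idx" "s2 \<in> img_idx"
    and m: "m1 \<in> Hom (idx V) (fst s1) j" "m2 \<in> Hom (idx V) (fst s2) j"
  obtains w where "(s1, m1, (j, w)) \<in> img_arrows" "(s2, m2, (j, w)) \<in> img_arrows"
proof -
  interpret I: category "idx V" using V by (rule ind_category)
  interpret J: category "idx W" using W by (rule ind_category)
  have j: "j \<in> Obj (idx V)" using m I.Hom_ObjD by blast
  note r = rep_mem[OF j]
  note rH = ind_hom_memD[OF W g r]
  obtain l1 a1 b1 where 1: "a1 \<in> Hom (idx W) (rep_idx j) l1" "b1 \<in> Hom (idx W) (tgt s1) l1"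
    "ar W a1 \<cdot> (rep j \<cdot> ar V m1) = ar W b1 \<cdot> img_arr s1"
    using ind_hom_same_germ[OF W g ind_hom_pre[OF g r m(1)] img_idxD(3)[OF s(1)]] by (rule same_germE)
  obtain l2 a2 b2 where 2: "a2 \<in> Hom (idx W) (rep_idx j) l2" "b2 \<in> Hom (idx W) (tgt s2) l2"
    "ar W a2 \<cdot> (rep j \<cdot> ar V m2) = ar W b2 \<cdot> img_arr s2"
    using ind_hom_same_germ[OF W g ind_hom_pre[OF g r m(2)] img_idxD(3)[OF s(2)]] by (rule same_germE)
  obtain k c1 c2 where c: "c1 \<in> Hom (idx W) l1 k" "c2 \<in> Hom (idx W) l2 k" "c1 \<cdot>\<^bsub>idx W\<^esub> a1 = c2 \<cdot>\<^bsub>idx W\<^esub> a2"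
    using filtered_span[OF ind_filtered[OF W] 1(1) 2(1)] .
  let ?w = "c1 \<cdot>\<^bsub>idx W\<^esub> a1"
  have w: "(j, ?w) \<in> img_idx" "tgt (j, ?w) = k" using img_idxI[OF j J.Comp_Hom[OF 1(1) c(1)]] .
  \<comment> \<open>Beyond \<open>w\<close> the two representatives of \<open>g\<close> agree on the source, so the kernel at the source goes into
    the kernel at \<open>(j, w)\<close>.\<close>
  have main: "(s', n, (j, ?w)) \<in> img_arrows"
    if k': "s' \<in> img_idx" and n: "n \<in> Hom (idx V) (fst s') j" and a: "a \<in> Hom (idx W) (rep_idx j) l"
      and b: "b \<in> Hom (idx W) (tgt s') l" and e: "ar W a \<cdot> (rep j \<cdot> ar V n) = ar W b \<cdot> img_arr s'"
      and c: "c \<in> Hom (idx W) l k" and cw: "c \<cdot>\<^bsub>idx W\<^esub> a = ?w" for s' n a b c l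
  proof -
    note N = img_exact(4)[OF k'] and P = img_idxD(4)[OF k'] and A = ar_Hom[OF V n]
    note aH = ar_Hom[OF W a] and bH = ar_Hom[OF W b] and cH = ar_Hom[OF W c]
    note p = img_exact(5)[OF w(1), simplified]
    have ia: "img_arr (j, ?w) = ar W c \<cdot> (ar W a \<cdot> rep j)"
      using ar_Comp[OF W a c] Comp_assoc[OF rH(3) aH cH] cw unfolding img_arr_def by simp
    have AN: "ar V n \<cdot> nu s' \<in> Hom C (Dom C (nu s')) (ob V j)" using Comp_Hom[OF N A] .
    have "img_arr (j, ?w) \<cdot> (ar V n \<cdot> nu s') = ar W c \<cdot> ((ar W a \<cdot> (rep j \<cdot> ar V n)) \<cdot> nu s')"
      unfolding ia using N A aH cH rH(3) by (simp add: Hom_def)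
    also have "\<dots> = ar W c \<cdot> (ar W b \<cdot> (img_arr s' \<cdot> nu s'))"
      unfolding e using Comp_assoc[OF N P bH] by simp
    also have "\<dots> = zero (Dom C (nu s')) (ob W k)"
      using img_exact(6)[OF k'] Comp_zero[OF bH] Comp_zero[OF cH] Hom_ObjD(1)[OF N] by simp
    finally have z: "img_arr (j, ?w) \<cdot> (ar V n \<cdot> nu s') = zero (Dom C (nu s')) (ob W k)" .
    have ia': "img_arr (j, ?w) \<in> Hom C (ob V j) (ob W k)" using img_idxD(4)[OF w(1)] w(2) by simp
    obtain x where x: "x \<in> Hom C (Dom C (nu s')) (Dom C (nu (j, ?w)))" "nu (j, ?w) \<cdot> x = ar V n \<cdot> nu s'"
      using kernel_factor[OF img_exact(1)[OF w(1)] ia' AN z] .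
    have "(pr (j, ?w) \<cdot> ar V n) \<cdot> nu s' = (pr (j, ?w) \<cdot> nu (j, ?w)) \<cdot> x"
      using Comp_assoc[OF N A p] Comp_assoc[OF x(1) img_exact(4)[OF w(1), simplified] p] x(2) by simp
    also have "\<dots> = zero (Dom C (nu s')) (Q (j, ?w))"
      using img_exact(7)[OF w(1)] zero_Comp[OF x(1)] Hom_ObjD(2)[OF p] by simp
    finally obtain t where "t \<in> Hom C (Q s') (Q (j, ?w))" "t \<cdot> pr s' = pr (j, ?w) \<cdot> ar V n"
      using pr_factor[OF k' Comp_Hom[OF A p]] by blast
    then show ?thesis using k' w(1) n by (auto simp: img_arrows_def)
  qed
  show ?thesis
    using that[OF main[OF s(1) m(1) 1 c(1) refl] main[OF s(2) m(2) 2 c(2) c(3)[symmetric]]] .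
qed

lemma img_idx_exists: assumes "j \<in> Obj (idx V)" shows "(j, Id (idx W) (rep_idx j)) \<in> img_idx"
proof -
  interpret J: category "idx W" using W by (rule ind_category)
  show ?thesis using img_idxI(1)[OF assms J.Id_Hom[OF ind_hom_memD(2)[OF W g rep_mem[OF assms]]]] .
qed

lemma img_category: "category img_cat"
proof -
  interpret I: category "idx V" using V by (rule ind_category)
  show ?thesis
  proof
    fix f assume "f \<in> Arr img_cat"
    then show "Dom img_cat f \<in> Obj img_cat" "Cod img_cat f \<in> Obj img_cat"
      using img_arrowsD by (cases f; simp)+
  next
    fix X assume "X \<in> Obj img_cat"
    then show "Id img_cat X \<in> Hom img_cat X X" using img_arrows_Id by (simp add: img_Hom_iff)
  next
    fix f X Y g Z assume "f \<in> Hom img_cat X Y" "g \<in> Hom img_cat Y Z"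
    then obtain m n where "f = (X, m, Y)" "(X, m, Y) \<in> img_arrows" "g = (Y, n, Z)" "(Y, n, Z) \<in> img_arrows"
      unfolding img_Hom_iff by blast
    then show "g \<cdot>\<^bsub>img_cat\<^esub> f \<in> Hom img_cat X Z" using img_arrows_Comp(1)[of X m Y n Z] by (simp add: img_Hom_iff)
  next
    fix f X Y assume "f \<in> Hom img_cat X Y"
    then obtain m where m: "f = (X, m, Y)" "(X, m, Y) \<in> img_arrows" unfolding img_Hom_iff by blast
    note H = img_arrowsD(3)[OF m(2)]
    show "f \<cdot>\<^bsub>img_cat\<^esub> Id img_cat X = f" "Id img_cat Y \<cdot>\<^bsub>img_cat\<^esub> f = f"
      using I.Comp_Id[OF H] I.Id_Comp[OF H] m(1) by simp_all
  next
    fix f X1 X2 g X3 h X4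
    assume "f \<in> Hom img_cat X1 X2" "g \<in> Hom img_cat X2 X3" "h \<in> Hom img_cat X3 X4"
    then obtain m n r where m: "f = (X1, m, X2)" "(X1, m, X2) \<in> img_arrows"
      and n: "g = (X2, n, X3)" "(X2, n, X3) \<in> img_arrows" and r: "h = (X3, r, X4)" "(X3, r, X4) \<in> img_arrows"
      unfolding img_Hom_iff by blast
    show "(h \<cdot>\<^bsub>img_cat\<^esub> g) \<cdot>\<^bsub>img_cat\<^esub> f = h \<cdot>\<^bsub>img_cat\<^esub> (g \<cdot>\<^bsub>img_cat\<^esub> f)"
      using I.Comp_assoc[OF img_arrowsD(3)[OF m(2)] img_arrowsD(3)[OF n(2)] img_arrowsD(3)[OF r(2)]] m n r by simp
  qed
qed

lemma img_filtered: "filtered img_cat"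
  unfolding filtered_def
proof (intro conjI ballI)
  show "category img_cat" by (rule img_category)
  obtain j where "j \<in> Obj (idx V)" using ind_filtered[OF V] unfolding filtered_def by blast
  then show "Obj img_cat \<noteq> {}" using img_idx_exists by auto
next
  fix s1 s2 assume "s1 \<in> Obj img_cat" "s2 \<in> Obj img_cat"
  then have k: "s1 \<in> img_idx" "s2 \<in> img_idx" by simp_all
  obtain j m1 m2 where m: "m1 \<in> Hom (idx V) (fst s1) j" "m2 \<in> Hom (idx V) (fst s2) j"
    using filtered_upper[OF ind_filtered[OF V] img_idxD(1)[OF k(1)] img_idxD(1)[OF k(2)]] .
  obtain w where w: "(s1, m1, (j, w)) \<in> img_arrows" "(s2, m2, (j, w)) \<in> img_arrows" using img_extend[OF k m] .
  then have "(s1, m1, (j, w)) \<in> Hom img_cat s1 (j, w)" "(s2, m2, (j, w)) \<in> Hom img_cat s2 (j, w)"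
    by (auto simp: img_Hom_iff)
  moreover have "(j, w) \<in> Obj img_cat" using img_arrowsD(2)[OF w(1)] by simp
  ultimately show "\<exists>s\<in>Obj img_cat. Hom img_cat s1 s \<noteq> {} \<and> Hom img_cat s2 s \<noteq> {}" by blast
next
  fix s s' \<alpha> \<beta> assume "\<alpha> \<in> Hom img_cat s s'" "\<beta> \<in> Hom img_cat s s'"
  then obtain m n where m: "\<alpha> = (s, m, s')" "(s, m, s') \<in> img_arrows" and n: "\<beta> = (s, n, s')" "(s, n, s') \<in> img_arrows"
    unfolding img_Hom_iff by blast
  obtain j h where h: "h \<in> Hom (idx V) (fst s') j" "h \<cdot>\<^bsub>idx V\<^esub> m = h \<cdot>\<^bsub>idx V\<^esub> n"
    using filtered_coequalize[OF ind_filtered[OF V] img_arrowsD(3)[OF m(2)] img_arrowsD(3)[OF n(2)]] .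
  note k' = img_arrowsD(2)[OF m(2)]
  obtain w where w: "(s', h, (j, w)) \<in> img_arrows" using img_extend[OF k' k' h(1) h(1)] .
  have "(s', h, (j, w)) \<in> Hom img_cat s' (j, w)" using w by (auto simp: img_Hom_iff)
  moreover have "(s', h, (j, w)) \<cdot>\<^bsub>img_cat\<^esub> \<alpha> = (s', h, (j, w)) \<cdot>\<^bsub>img_cat\<^esub> \<beta>" using m n h by simp
  moreover have "(j, w) \<in> Obj img_cat" using img_arrowsD(2)[OF w] by simp
  ultimately show "\<exists>s\<in>Obj img_cat. \<exists>h\<in>Hom img_cat s' s. h \<cdot>\<^bsub>img_cat\<^esub> \<alpha> = h \<cdot>\<^bsub>img_cat\<^esub> \<beta>" by blast
qed

lemma img_functor: "is_functor img_cat C Q induced"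
  unfolding is_functor_def
proof (intro conjI ballI impI)
  fix s assume "s \<in> Obj img_cat"
  then have k: "s \<in> img_idx" by simp
  show "Q s \<in> Obj C" using Hom_ObjD(2)[OF img_exact(5)[OF k]] .
  show "induced (Id img_cat s) = Id C (Q s)" using img_arrows_Id(2)[OF k] by simp
next
  fix \<alpha> assume "\<alpha> \<in> Arr img_cat"
  then show "induced \<alpha> \<in> Hom C (Q (Dom img_cat \<alpha>)) (Q (Cod img_cat \<alpha>))"
    using induced(1) by (cases \<alpha>) simp
next
  fix \<alpha> \<beta> assume "\<alpha> \<in> Arr img_cat" "\<beta> \<in> Arr img_cat" "Dom img_cat \<beta> = Cod img_cat \<alpha>"
  then show "induced (\<beta> \<cdot>\<^bsub>img_cat\<^esub> \<alpha>) = induced \<beta> \<cdot> induced \<alpha>"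
    using img_arrows_Comp(2) by (cases \<alpha>; cases \<beta>) simp
qed

text \<open>Codes of pairs and of arrows as single indices.\<close>

definition enc :: "'i \<times> 'i \<Rightarrow> 'i" where "enc = (SOME e. inj e)"
definition enc3 :: "('i \<times> 'i) \<times> 'i \<times> ('i \<times> 'i) \<Rightarrow> 'i" where
  "enc3 = (\<lambda>(s, m, s'). enc (enc s, enc (m, enc s')))"

lemma inj_enc: "inj enc" unfolding enc_def using infinite_pair_inj[OF inf] by (rule someI_ex)

lemma inj_enc3: "inj enc3"
  by (auto intro!: injI simp: enc3_def inj_eq[OF inj_enc])

sublocale transport enc enc3 img_cat
  by standard (rule inj_enc, rule inj_enc3)

text \<open>The image of \<open>g\<close>, the formal colimit of the coimages of the representatives of \<open>g\<close>.\<close>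

definition img :: "('i, 'o, 'a) ind_obj" where "img = transport_ind enc enc3 img_cat Q induced"

lemma img: "ind_object C img"
  unfolding img_def using transport_ind_object img_filtered img_functor by blast

lemma img_simps [simp]:
  "ob img (enc s) = Q s" "ar img (enc3 \<alpha>) = induced \<alpha>" "enc s \<in> Obj (idx img) \<longleftrightarrow> s \<in> img_idx"
  using inj_enc by (simp_all add: img_def transport_simps inj_image_mem_iff)

lemma img_ObjE: assumes "a \<in> Obj (idx img)" obtains s where "a = enc s" "s \<in> img_idx"
  using assms that by (auto simp: img_def transport_simps)

lemma img_HomI: "(s, m, s') \<in> img_arrows \<Longrightarrow> enc3 (s, m, s') \<in> Hom (idx img) (enc s) (enc s')"
  by (simp add: img_def transport_Hom_iff img_Hom_iff)

lemma img_HomE: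
  assumes "x \<in> Hom (idx img) a b"
  obtains s m s' where "x = enc3 (s, m, s')" "a = enc s" "b = enc s'" "(s, m, s') \<in> img_arrows"
proof -
  obtain \<alpha> s s' where "x = enc3 \<alpha>" "a = enc s" "b = enc s'" "\<alpha> \<in> Hom img_cat s s'"
    using transport_HomE assms[unfolded img_def transport_ind_simps] by metis
  then show ?thesis using that unfolding img_Hom_iff by blast
qed

lemma pr_same_germ:
  assumes k: "s1 \<in> img_idx" "s2 \<in> img_idx" and m: "m \<in> Hom (idx V) (fst s1) (fst s2)"
  shows "same_germ img (enc s2) (pr s2 \<cdot> ar V m) (enc s1) (pr s1)"
proof -
  interpret I: category "idx V" using V by (rule ind_category)
  note i = I.Id_Hom[OF I.Hom_ObjD(2)[OF m]]
  obtain w where w: "(s1, m, (fst s2, w)) \<in> img_arrows" "(s2, Id (idx V) (fst s2), (fst s2, w)) \<in> img_arrows"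
    using img_extend[OF k m i] .
  let ?s = "(fst s2, w)"
  note p = img_exact(5)[OF img_arrowsD(2)[OF w(1)], simplified]
  have "induced (s2, Id (idx V) (fst s2), ?s) \<cdot> (pr s2 \<cdot> ar V m) =
      (pr ?s \<cdot> ar V (Id (idx V) (fst s2))) \<cdot> ar V m"
    using Comp_assoc[OF ar_Hom[OF V m] img_exact(5)[OF k(2)] induced(1)[OF w(2)]] induced(2)[OF w(2)] by simp
  also have "\<dots> = induced (s1, m, ?s) \<cdot> pr s1"
    using ar_Id[OF V img_idxD(1)[OF k(2)]] Comp_Id[OF p] induced(2)[OF w(1)] by simp
  finally show ?thesis
    using same_germI[OF img_HomI[OF w(2)] img_HomI[OF w(1)], of "pr s2 \<cdot> ar V m" "pr s1"] by simp
qed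

text \<open>The projection \<open>V \<rightarrow> img\<close>. At \<open>j\<close> it is represented by the projection at the index \<open>(j, id)\<close>.\<close>

definition to_img :: "'i \<Rightarrow> ('i \<times> 'a) set" where
  "to_img = make_hom V img (\<lambda>j. enc (j, Id (idx W) (rep_idx j))) (\<lambda>j. pr (j, Id (idx W) (rep_idx j)))"

lemma to_img:
  shows "to_img \<in> ind_hom C V img" and "\<And>s. s \<in> img_idx \<Longrightarrow> (enc s, pr s) \<in> to_img (fst s)"
proof -
  let ?k = "\<lambda>j. (j, Id (idx W) (rep_idx j))"
  interpret I: category "idx V" using V by (rule ind_category)
  have H: "enc (?k j) \<in> Obj (idx img)" "pr (?k j) \<in> Hom C (ob V j) (ob img (enc (?k j)))"
    if "j \<in> Obj (idx V)" for j
    using img_idx_exists[OF that] img_exact(5)[OF img_idx_exists[OF that]] by simp_all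
  have c: "same_germ img (enc (?k j')) (pr (?k j') \<cdot> ar V m) (enc (?k j)) (pr (?k j))"
    if m: "m \<in> Hom (idx V) j j'" for m j j'
    using pr_same_germ[OF img_idx_exists[OF I.Hom_ObjD(1)[OF m]] img_idx_exists[OF I.Hom_ObjD(2)[OF m]]] m by simp
  note M = make_hom[where n = "\<lambda>j. enc (?k j)" and r = "\<lambda>j. pr (?k j)", OF V img H c]
  show h: "to_img \<in> ind_hom C V img" unfolding to_img_def by (rule M(1))
  fix s assume k: "s \<in> img_idx"
  note j = img_idxD(1)[OF k]
  have "(enc (?k (fst s)), pr (?k (fst s))) \<in> to_img (fst s)" unfolding to_img_def using M(2) j by simp
  moreover have "same_germ img (enc (?k (fst s))) (pr (?k (fst s))) (enc s) (pr s)"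
    using pr_same_germ[OF k img_idx_exists[OF j], of "Id (idx V) (fst s)"] I.Id_Hom[OF j] ar_Id[OF V j]
      Comp_Id[OF img_exact(5)[OF img_idx_exists[OF j]]] by simp
  ultimately show "(enc s, pr s) \<in> to_img (fst s)"
    using ind_hom_mem_same_germ[OF img h] k img_exact(5)[OF k] by simp
qed

text \<open>The arrow from the coimage that is induced by the representative \<open>img_arr s\<close>.\<close>

definition img_incl :: "'i \<times> 'i \<Rightarrow> 'a" where
  "img_incl s = (SOME v. v \<in> Hom C (Q s) (ob W (tgt s)) \<and> v \<cdot> pr s = img_arr s)"

lemma img_incl:
  assumes "s \<in> img_idx"
  shows "img_incl s \<in> Hom C (Q s) (ob W (tgt s))" "img_incl s \<cdot> pr s = img_arr s"
proof -
  have "\<exists>v. v \<in> Hom C (Q s) (ob W (tgt s)) \<and> v \<cdot> pr s = img_arr s"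
    using pr_factor[OF assms img_idxD(4)[OF assms] img_exact(6)[OF assms]] by metis
  then have "img_incl s \<in> Hom C (Q s) (ob W (tgt s)) \<and> img_incl s \<cdot> pr s = img_arr s"
    unfolding img_incl_def by (rule someI_ex)
  then show "img_incl s \<in> Hom C (Q s) (ob W (tgt s))" "img_incl s \<cdot> pr s = img_arr s" by auto
qed

text \<open>The morphism \<open>img \<rightarrow> W\<close> through which \<open>g\<close> factors.\<close>

definition from_img :: "'i \<Rightarrow> ('i \<times> 'a) set" where
  "from_img = make_hom img W (\<lambda>a. tgt (inv_into UNIV enc a)) (\<lambda>a. img_incl (inv_into UNIV enc a))"

lemma from_img:
  shows "from_img \<in> ind_hom C img W" and "\<And>s. s \<in> img_idx \<Longrightarrow> (tgt s, img_incl s) \<in> from_img (enc s)"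
proof -
  let ?n = "\<lambda>a. tgt (inv_into UNIV enc a)" and ?r = "\<lambda>a. img_incl (inv_into UNIV enc a)"
  have i: "inv_into UNIV enc (enc s) = s" for s using inj_enc by simp
  have H: "?n a \<in> Obj (idx W)" "?r a \<in> Hom C (ob img a) (ob W (?n a))" if "a \<in> Obj (idx img)" for a
    using that img_idxD(5) img_incl(1) i by (auto elim!: img_ObjE)
  have c: "same_germ W (?n b) (?r b \<cdot> ar img x) (?n a) (?r a)" if x: "x \<in> Hom (idx img) a b" for x a b
  proof -
    obtain s m s' where m: "x = enc3 (s, m, s')" "a = enc s" "b = enc s'" "(s, m, s') \<in> img_arrows"
      using x by (rule img_HomE)
    note k = img_arrowsD[OF m(4)]
    obtain l u v where l: "u \<in> Hom (idx W) (tgt s') l" "v \<in> Hom (idx W) (tgt s) l"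
      "ar W u \<cdot> (img_arr s' \<cdot> ar V m) = ar W v \<cdot> img_arr s"
      using ind_hom_same_germ[OF W g ind_hom_pre[OF g img_idxD(3)[OF k(2)] k(3)] img_idxD(3)[OF k(1)]]
      by (rule same_germE)
    note T = induced[OF m(4)] and I' = img_incl[OF k(2)] and I = img_incl[OF k(1)]
    note p = img_exact(5)[OF k(1)] and p' = img_exact(5)[OF k(2)]
    note uH = ar_Hom[OF W l(1)] and vH = ar_Hom[OF W l(2)]
    have "img_incl s' \<cdot> (induced (s, m, s') \<cdot> pr s) = img_arr s' \<cdot> ar V m"
      unfolding T(2) using Comp_rewrite1[OF I'(2) p' I'(1) ar_Hom[OF V k(3)]] .
    then have "(ar W u \<cdot> (img_incl s' \<cdot> induced (s, m, s'))) \<cdot> pr s = ar W u \<cdot> (img_arr s' \<cdot> ar V m)"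
      using Comp_assoc[OF p Comp_Hom[OF T(1) I'(1)] uH] Comp_assoc[OF p T(1) I'(1)] by simp
    also have "\<dots> = (ar W v \<cdot> img_incl s) \<cdot> pr s"
      using l(3) Comp_assoc[OF p I(1) vH] I(2) by simp
    finally have "ar W u \<cdot> (img_incl s' \<cdot> induced (s, m, s')) = ar W v \<cdot> img_incl s"
      using pr_cancel[OF k(1) Comp_Hom[OF Comp_Hom[OF T(1) I'(1)] uH] Comp_Hom[OF I(1) vH]] by simp
    then show ?thesis unfolding m i img_simps by (rule same_germI[OF l(1,2)])
  qed
  note M = make_hom[where n = "?n" and r = "?r", OF img W H c]
  show "from_img \<in> ind_hom C img W" unfolding from_img_def by (rule M(1))
  fix s assume k: "s \<in> img_idx"
  then show "(tgt s, img_incl s) \<in> from_img (enc s)"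
    unfolding from_img_def using M(2)[of "enc s"] i by simp
qed

lemma from_to_img: "ind_comp C V W from_img to_img = g"
proof (rule ind_hom_ext[OF W ind_comp(1)[OF V img W to_img(1) from_img(1)] g])
  fix j assume j: "j \<in> Obj (idx V)"
  let ?s = "(j, Id (idx W) (rep_idx j))"
  note k = img_idx_exists[OF j]
  have "(enc ?s, pr ?s) \<in> to_img j" using to_img(2)[OF k] by simp
  then have "(tgt ?s, img_arr ?s) \<in> ind_comp C V W from_img to_img j"
    using ind_comp(2)[OF V img W to_img(1) from_img(1) _ from_img(2)[OF k]] img_incl(2)[OF k] by metis
  moreover have "(tgt ?s, img_arr ?s) \<in> g j" using img_idxD(3)[OF k] by simp
  ultimately show "\<exists>k p. (k, p) \<in> ind_comp C V W from_img to_img j \<and> (k, p) \<in> g j" by blast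
qed

lemma to_img_zero:
  assumes U: "ind_object C U" and f: "f \<in> ind_hom C U V" and z: "ind_zero U W (ind_comp C U W g f)"
  shows "ind_zero U img (ind_comp C U img to_img f)"
  unfolding ind_zero_def
proof
  fix i assume i: "i \<in> Obj (idx U)"
  obtain j \<phi> where j: "(j, \<phi>) \<in> f i" using ind_hom_rep[OF V f i] .
  note jD = ind_hom_memD[OF V f j]
  note r = rep_mem[OF jD(2)]
  note rD = ind_hom_memD[OF W g r]
  obtain k0 where "(k0, zero (ob U i) (ob W k0)) \<in> ind_comp C U W g f i" using z i unfolding ind_zero_def by blast
  from ind_hom_same_germ[OF W ind_comp(1)[OF U V W f g] ind_comp(2)[OF U V W f g j r] this]
  obtain k w where w: "w \<in> Hom (idx W) (rep_idx j) k" "ar W w \<cdot> (rep j \<cdot> \<phi>) = zero (ob U i) (ob W k)"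
    by (rule same_germ_zeroE[OF W Comp_Hom[OF jD(3) rD(3)]])
  have k: "(j, w) \<in> img_idx" "tgt (j, w) = k" using img_idxI[OF jD(2) w(1)] .
  have "img_arr (j, w) \<cdot> \<phi> = zero (ob U i) (ob W k)"
    unfolding img_arr_def using Comp_assoc[OF jD(3) rD(3) ar_Hom[OF W w(1)]] w(2) by simp
  then obtain x where x: "x \<in> Hom C (ob U i) (Dom C (nu (j, w)))" "nu (j, w) \<cdot> x = \<phi>"
    using kernel_factor[OF img_exact(1)[OF k(1)] img_idxD(4)[OF k(1)], simplified, OF jD(3)] k(2) by metis
  note n = img_exact(4)[OF k(1)] and p = img_exact(5)[OF k(1)]
  have "pr (j, w) \<cdot> \<phi> = zero (ob U i) (Q (j, w))"
    using Comp_assoc[OF x(1) n p] x(2) img_exact(7)[OF k(1)] zero_Comp[OF x(1) Hom_ObjD(2)[OF p]] by simp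
  moreover have "(enc (j, w), pr (j, w)) \<in> to_img j" using to_img(2)[OF k(1)] by simp
  ultimately have "(enc (j, w), zero (ob U i) (Q (j, w))) \<in> ind_comp C U img to_img f i"
    using ind_comp(2)[OF U V img f to_img(1) j] by metis
  then show "\<exists>k. (k, zero (ob U i) (ob img k)) \<in> ind_comp C U img to_img f i"
    by (intro exI[of _ "enc (j, w)"]) simp
qed

text \<open>If \<open>g\<close> is a cokernel of \<open>f\<close>, then the projection to the image, which kills \<open>f\<close>, factors through \<open>g\<close>. This
  gives a section of \<open>img \<rightarrow> W\<close>.\<close>

lemma ind_cokernel_split:
  assumes U: "ind_object C U" and f: "f \<in> ind_hom C U V"
    and ck: "is_cokernel (Ind C) (U, V, f) (V, W, g)"
  obtains u where "u \<in> ind_hom C W img" "ind_comp C V img u g = to_img"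
    "ind_comp C W W from_img u = ind_id C W"
proof -
  have za: "zero_arrow (Ind C) (U, W, ind_comp C U W g f)" using ck unfolding is_cokernel_def by simp
  then obtain Z :: "('i, 'o, 'a) ind_obj" where Z: "zero_object (Ind C) Z" unfolding zero_arrow_def by blast
  note gfH = ind_comp(1)[OF U V W f g]
  have z: "ind_zero U W (ind_comp C U W g f)" using za Ind_zero_arrow_iff[OF Z U W gfH] by simp
  have "zero_arrow (Ind C) ((V, img, to_img) \<cdot>\<^bsub>Ind C\<^esub> (U, V, f))"
    using Ind_zero_arrow_iff[OF Z U img ind_comp(1)[OF U V img f to_img(1)]] to_img_zero[OF U f z] by simp
  moreover have "(V, img, to_img) \<in> Hom (Ind C) V img" using V img to_img(1) unfolding Ind_Hom_iff by blast
  ultimately obtain a where a: "a \<in> Hom (Ind C) W img" "a \<cdot>\<^bsub>Ind C\<^esub> (V, W, g) = (V, img, to_img)"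
    using cokernel_lift[OF ck, of img "(V, img, to_img)"] img by auto
  obtain u where u: "a = (W, img, u)" "u \<in> ind_hom C W img" using a(1) unfolding Ind_Hom_iff by blast
  have e: "ind_comp C V img u g = to_img" using a(2) u by simp
  let ?x = "ind_comp C W W from_img u"
  note xH = ind_comp(1)[OF W img W u(2) from_img(1)] and iH = ind_id(1)[OF W]
  have ge: "ind_comp C V W ?x g = g"
  proof (rule ind_hom_ext[OF W ind_comp(1)[OF V W W g xH] g])
    fix j assume j: "j \<in> Obj (idx V)"
    obtain k p where k: "(k, p) \<in> g j" using ind_hom_rep[OF W g j] .
    note kD = ind_hom_memD[OF W g k]
    obtain a \<xi> where a: "(a, \<xi>) \<in> u k" using ind_hom_rep[OF img u(2) kD(2)] .
    note aD = ind_hom_memD[OF img u(2) a]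
    obtain l v where l: "(l, v) \<in> from_img a" using ind_hom_rep[OF W from_img(1) aD(2)] .
    note lD = ind_hom_memD[OF W from_img(1) l]
    have "(a, \<xi> \<cdot> p) \<in> to_img j" using ind_comp(2)[OF V W img g u(2) k a] e by simp
    then have 1: "(l, v \<cdot> \<xi> \<cdot> p) \<in> g j"
      using ind_comp(2)[OF V img W to_img(1) from_img(1) _ l] from_to_img by metis
    have "(l, (v \<cdot> \<xi>) \<cdot> p) \<in> ind_comp C V W ?x g j"
      using ind_comp(2)[OF V W W g xH k ind_comp(2)[OF W img W u(2) from_img(1) a l]] .
    then show "\<exists>k p. (k, p) \<in> ind_comp C V W ?x g j \<and> (k, p) \<in> g j"
      using 1 Comp_assoc[OF kD(3) aD(3) lD(3)] by auto
  qed
  have ie: "ind_comp C V W (ind_id C W) g = g"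
  proof (rule ind_hom_ext[OF W ind_comp(1)[OF V W W g iH] g])
    fix j assume j: "j \<in> Obj (idx V)"
    obtain k p where k: "(k, p) \<in> g j" using ind_hom_rep[OF W g j] .
    note kD = ind_hom_memD[OF W g k]
    show "\<exists>k p. (k, p) \<in> ind_comp C V W (ind_id C W) g j \<and> (k, p) \<in> g j"
      using ind_comp(2)[OF V W W g iH k ind_id(2)[OF W kD(2)]] Id_Comp[OF kD(3)] k by auto
  qed
  have "\<exists>!b. b \<in> Hom (Ind C) W W \<and> b \<cdot>\<^bsub>Ind C\<^esub> (V, W, g) = (V, W, g)"
    using cokernel_lift[OF ck, of W "(V, W, g)"] za V W g by (simp add: Ind_Hom_iff)
  moreover have "(W, W, ?x) \<in> Hom (Ind C) W W" "(W, W, ind_id C W) \<in> Hom (Ind C) W W"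
    using W xH iH by (simp_all add: Ind_Hom_iff)
  ultimately have "(W, W, ?x) = (W, W, ind_id C W)" using ge ie Ind_simps(5) by metis
  then show ?thesis using that u(2) e by simp
qed

text \<open>What it means inside \<open>C\<close> that \<open>g\<close> is a cokernel: some transition arrow out of the object of \<open>W\<close> at \<open>k\<close>
  factors as \<open>v \<xi>\<close> through a strict quotient \<open>\<pi>\<close> of an object of \<open>V\<close> such that \<open>v \<pi>\<close> represents \<open>g\<close>. Moreover,
  \<open>\<xi>\<close> is compatible with the given representative \<open>p\<close>.\<close>

lemma ind_cokernel_presentation:
  assumes U: "ind_object C U" and f: "f \<in> ind_hom C U V"
    and ck: "is_cokernel (Ind C) (U, V, f) (V, W, g)"
    and p: "(k, p) \<in> g j"
  obtains j' t k' t' \<nu> \<pi> \<xi> v where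
    "t \<in> Hom (idx V) j j'" "t' \<in> Hom (idx W) k k'"
    "is_cokernel C \<nu> \<pi>" "is_kernel C \<pi> \<nu>"
    "\<nu> \<in> Hom C (Dom C \<nu>) (ob V j')" "\<pi> \<in> Hom C (ob V j') (Cod C \<pi>)"
    "\<xi> \<in> Hom C (ob W k) (Cod C \<pi>)" "v \<in> Hom C (Cod C \<pi>) (ob W k')"
    "(k', v \<cdot> \<pi>) \<in> g j'" "\<xi> \<cdot> p = \<pi> \<cdot> ar V t" "v \<cdot> \<xi> = ar W t'"
proof -
  obtain u where u: "u \<in> ind_hom C W img" "ind_comp C V img u g = to_img"
    "ind_comp C W W from_img u = ind_id C W"
    using ind_cokernel_split[OF U f ck] .
  note pD = ind_hom_memD[OF W g p]
  obtain a1 \<xi>1 where a1: "(a1, \<xi>1) \<in> u k" using ind_hom_rep[OF img u(1) pD(2)] .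
  note a1D = ind_hom_memD[OF img u(1) a1]
  let ?s0 = "(j, Id (idx W) (rep_idx j))"
  note k0 = img_idx_exists[OF pD(1)]
  have m: "(enc ?s0, pr ?s0) \<in> to_img j" using to_img(2)[OF k0] by simp
  have m1: "(a1, \<xi>1 \<cdot> p) \<in> to_img j" using ind_comp(2)[OF V W img g u(1) p a1] u(2) by simp
  obtain a x y where xy: "x \<in> Hom (idx img) a1 a" "y \<in> Hom (idx img) (enc ?s0) a"
    "ar img x \<cdot> (\<xi>1 \<cdot> p) = ar img y \<cdot> pr ?s0"
    using ind_hom_same_germ[OF img to_img(1) m1 m] by (rule same_germE)
  obtain s0' t s where y: "y = enc3 (s0', t, s)" "enc ?s0 = enc s0'" "a = enc s" "(s0', t, s) \<in> img_arrows"
    using xy(2) by (rule img_HomE)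
  have "s0' = ?s0" using y(2) inj_enc by (simp add: inj_eq)
  then have t: "(?s0, t, s) \<in> img_arrows" "y = enc3 (?s0, t, s)" using y by simp_all
  note T = img_arrowsD[OF t(1), simplified]
  define \<xi> where "\<xi> = ar img x \<cdot> \<xi>1"
  have \<xi>u: "(enc s, \<xi>) \<in> u k" unfolding \<xi>_def using ind_hom_post[OF img u(1) a1 xy(1)] y(3) by simp
  have \<xi>H: "\<xi> \<in> Hom C (ob W k) (Q s)" using ind_hom_memD(3)[OF img u(1) \<xi>u] by simp
  have \<xi>p: "\<xi> \<cdot> p = pr s \<cdot> ar V t"
    using xy(3) Comp_assoc[OF pD(3) a1D(3) ar_Hom[OF img xy(1)]] induced(2)[OF t(1)] t(2) unfolding \<xi>_def by simp
  note I = img_incl[OF T(2)] and q = img_exact(5)[OF T(2)]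
  have "(tgt s, img_incl s \<cdot> \<xi>) \<in> ind_id C W k"
    using ind_comp(2)[OF W img W u(1) from_img(1) \<xi>u from_img(2)[OF T(2)]] u(3) by simp
  then obtain k' r t' where r: "r \<in> Hom (idx W) (tgt s) k'" "t' \<in> Hom (idx W) k k'"
    "ar W r \<cdot> (img_incl s \<cdot> \<xi>) = ar W t' \<cdot> Id C (ob W k)"
    using ind_hom_same_germ[OF W ind_id(1)[OF W] _ ind_id(2)[OF W pD(2)]] unfolding same_germ_def by blast
  note rH = ar_Hom[OF W r(1)] and t'H = ar_Hom[OF W r(2)]
  define v where "v = ar W r \<cdot> img_incl s"
  have vH: "v \<in> Hom C (Q s) (ob W k')" unfolding v_def using Comp_Hom[OF I(1) rH] .
  have v\<xi>: "v \<cdot> \<xi> = ar W t'" unfolding v_def using Comp_assoc[OF \<xi>H I(1) rH] r(3) Comp_Id[OF t'H] by simp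
  have vp: "(k', v \<cdot> pr s) \<in> g (fst s)"
    unfolding v_def using ind_hom_post[OF W g img_idxD(3)[OF T(2)] r(1)] Comp_assoc[OF q I(1) rH] I(2) by simp
  show ?thesis
    by (rule that[OF T(3) r(2) img_exact(2,3,4)[OF T(2)] _ _ _ vp \<xi>p v\<xi>])
      (use q \<xi>H vH in \<open>simp_all add: Q_def\<close>)
qed

end

section \<open>Tensor product and internal Hom\<close>

text \<open>A closed symmetric monoidal quasi-abelian category with a chosen addition of arrows. That tensor products
  of zero arrows vanish is a consequence of closedness.\<close>

locale quasi_abelian_monoidal =
  quasi_abelian_category C add zero + closed_symmetric_monoidal_category C
  for C :: "('o, 'a, 'z) csm_cat_scheme" (structure) and add zero
begin

text \<open>The arrow \<open>Z \<otimes> X \<rightarrow> Y\<close> that corresponds to \<open>g : Z \<rightarrow> Hom(X, Y)\<close>.\<close>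

definition untranspose :: "'o \<Rightarrow> 'o \<Rightarrow> 'a \<Rightarrow> 'a" where
  "untranspose X Y g = ev C X Y \<cdot> (g \<otimes>\<^sub>a Id C X)"

lemma untranspose_Hom:
  assumes "X \<in> Obj C" "Y \<in> Obj C" "g \<in> Hom C Z (ihom C X Y)"
  shows "untranspose X Y g \<in> Hom C (Z \<otimes>\<^sub>o X) Y"
  unfolding untranspose_def using Comp_Hom[OF tens_Hom[OF assms(3) Id_Hom[OF assms(1)]] ev_Hom[OF assms(1,2)]] .

lemma untranspose_inj:
  assumes "X \<in> Obj C" "Y \<in> Obj C" "g \<in> Hom C Z (ihom C X Y)" "g' \<in> Hom C Z (ihom C X Y)"
    "untranspose X Y g = untranspose X Y g'"
  shows "g = g'"
proof -
  note u = the1_equality[OF ev_universal[OF assms(1,2) Hom_ObjD(1)[OF assms(3)] untranspose_Hom[OF assms(1-3)]]]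
  show ?thesis
    using u[of g] u[of g'] assms(3-5) unfolding untranspose_def by simp
qed

lemma transpose_ihom:
  assumes "X \<in> Obj C" "Y \<in> Obj C" "Z \<in> Obj C" "f \<in> Hom C (Z \<otimes>\<^sub>o X) Y"
  shows transpose_Hom: "transpose C X Y Z f \<in> Hom C Z (ihom C X Y)"
    and untranspose_transpose: "untranspose X Y (transpose C X Y Z f) = f"
  using theI'[OF ev_universal[OF assms]] unfolding transpose_def untranspose_def by auto

lemma tens_Comp_Id:
  assumes "D \<in> Obj C" "f \<in> Hom C X Y" "g \<in> Hom C Y Z"
  shows "Id C D \<otimes>\<^sub>a (g \<cdot> f) = (Id C D \<otimes>\<^sub>a g) \<cdot> (Id C D \<otimes>\<^sub>a f)"
    and "(g \<cdot> f) \<otimes>\<^sub>a Id C D = (g \<otimes>\<^sub>a Id C D) \<cdot> (f \<otimes>\<^sub>a Id C D)"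
  using tens_Comp[OF Id_Hom[OF assms(1)] Id_Hom[OF assms(1)] assms(2,3)]
    tens_Comp[OF assms(2,3) Id_Hom[OF assms(1)] Id_Hom[OF assms(1)]] Comp_Id[OF Id_Hom[OF assms(1)]] by simp_all

lemma untranspose_Comp:
  assumes "X \<in> Obj C" "Y \<in> Obj C" "g \<in> Hom C Z (ihom C X Y)" "h \<in> Hom C Z' Z"
  shows "untranspose X Y (g \<cdot> h) = untranspose X Y g \<cdot> (h \<otimes>\<^sub>a Id C X)"
  using tens_Comp_Id(2)[OF assms(1,4,3)] Id_Hom[OF assms(1)] tens_Hom[OF assms(3) Id_Hom[OF assms(1)]]
    tens_Hom[OF assms(4) Id_Hom[OF assms(1)]] ev_Hom[OF assms(1,2)]
  unfolding untranspose_def by (simp add: Comp_assoc)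

text \<open>The functor \<open>_ \<otimes> W\<close> is a left adjoint, so it maps a zero object to an initial object, hence zero arrows
  to zero arrows.\<close>

lemma zero_tens:
  assumes W: "W \<in> Obj C" and Z: "Z \<in> Obj C" "Z' \<in> Obj C"
  shows "zero Z Z' \<otimes>\<^sub>a Id C W = zero (Z \<otimes>\<^sub>o W) (Z' \<otimes>\<^sub>o W)"
proof -
  obtain O0 where O0: "zero_object C O0" using zero_object_exists by blast
  then have O: "O0 \<in> Obj C" unfolding zero_object_def by blast
  have uniq: "f = f'" if "f \<in> Hom C O0 Y" "f' \<in> Hom C O0 Y" for f f' Y
    using O0 that Hom_ObjD(2)[OF that(1)] unfolding zero_object_def by blast
  have key: "f = zero (O0 \<otimes>\<^sub>o W) Y" if f: "f \<in> Hom C (O0 \<otimes>\<^sub>o W) Y" for f Y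
  proof -
    note Y = Hom_ObjD(2)[OF f]
    note z = zero_Hom[OF tens_Obj[OF O W] Y]
    have "transpose C W Y O0 f = transpose C W Y O0 (zero (O0 \<otimes>\<^sub>o W) Y)"
      using uniq[OF transpose_Hom[OF W Y O f] transpose_Hom[OF W Y O z]] .
    then have "untranspose W Y (transpose C W Y O0 f) = untranspose W Y (transpose C W Y O0 (zero (O0 \<otimes>\<^sub>o W) Y))"
      by (rule arg_cong)
    then show ?thesis unfolding untranspose_transpose[OF W Y O f] untranspose_transpose[OF W Y O z] .
  qed
  note a = zero_Hom[OF Z(1) O] and b = zero_Hom[OF O Z(2)]
  note aW = tens_Hom[OF a Id_Hom[OF W]] and bW = tens_Hom[OF b Id_Hom[OF W]]
  have "zero Z Z' = zero O0 Z' \<cdot> zero Z O0" using zero_Comp[OF a Z(2)] by simp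
  then have "zero Z Z' \<otimes>\<^sub>a Id C W = (zero O0 Z' \<otimes>\<^sub>a Id C W) \<cdot> (zero Z O0 \<otimes>\<^sub>a Id C W)"
    using tens_Comp_Id(2)[OF W a b] by simp
  also have "\<dots> = zero (Z \<otimes>\<^sub>o W) (Z' \<otimes>\<^sub>o W)"
    using key[OF bW] zero_Comp[OF aW Hom_ObjD(2)[OF bW]] by simp
  finally show ?thesis .
qed

lemma tens_zero:
  assumes D: "D \<in> Obj C" and Z: "Z \<in> Obj C" "Z' \<in> Obj C"
  shows "Id C D \<otimes>\<^sub>a zero Z Z' = zero (D \<otimes>\<^sub>o Z) (D \<otimes>\<^sub>o Z')"
proof -
  note z = zero_Hom[OF Z] and i = Id_Hom[OF D]
  note iz = tens_Hom[OF i z]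
  note b = braid_Hom[OF D Z(1)] and b' = braid_Hom[OF D Z(2)] and c' = braid_Hom[OF Z(2) D]
  have "braid C D Z' \<cdot> (Id C D \<otimes>\<^sub>a zero Z Z') = zero (D \<otimes>\<^sub>o Z) (Z' \<otimes>\<^sub>o D)"
    using braid_natural[OF i z] zero_tens[OF D Z] zero_Comp[OF b] tens_Obj[OF Z(2) D] by simp
  then have "braid C Z' D \<cdot> (braid C D Z' \<cdot> (Id C D \<otimes>\<^sub>a zero Z Z')) = zero (D \<otimes>\<^sub>o Z) (D \<otimes>\<^sub>o Z')"
    using Comp_zero[OF c'] tens_Obj[OF D Z(1)] by simp
  then show ?thesis
    using Comp_rewrite1[OF symmetry[OF D Z(2)] b' c' iz] Id_Comp[OF iz] by simp
qed

lemma untranspose_zero: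
  assumes "X \<in> Obj C" "Y \<in> Obj C" "Z \<in> Obj C"
  shows "untranspose X Y (zero Z (ihom C X Y)) = zero (Z \<otimes>\<^sub>o X) Y"
  unfolding untranspose_def
  using zero_tens[OF assms(1,3) ihom_Obj[OF assms(1,2)]] Comp_zero[OF ev_Hom[OF assms(1,2)] tens_Obj[OF assms(3,1)]]
  by simp

lemma untranspose_zero_iff:
  assumes "X \<in> Obj C" "Y \<in> Obj C" "g \<in> Hom C Z (ihom C X Y)"
  shows "untranspose X Y g = zero (Z \<otimes>\<^sub>o X) Y \<longleftrightarrow> g = zero Z (ihom C X Y)"
  using untranspose_inj[OF assms zero_Hom[OF Hom_ObjD[OF assms(3)]]]
    untranspose_zero[OF assms(1,2) Hom_ObjD(1)[OF assms(3)]] by auto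

lemma ihom_arr_eval:
  assumes W: "W \<in> Obj C" and g: "g \<in> Hom C Y Y'"
  shows ihom_arr_Hom: "ihom_arr C W g \<in> Hom C (ihom C W Y) (ihom C W Y')"
    and untranspose_ihom_arr: "untranspose W Y' (ihom_arr C W g) = g \<cdot> ev C W Y"
proof -
  note Y = Hom_ObjD[OF g]
  have c: "Dom C g = Y" "Cod C g = Y'" using g by (auto simp: Hom_def)
  note t = transpose_ihom[OF W Y(2) ihom_Obj[OF W Y(1)] Comp_Hom[OF ev_Hom[OF W Y(1)] g]]
  show "ihom_arr C W g \<in> Hom C (ihom C W Y) (ihom C W Y')" unfolding ihom_arr_def c using t(1) .
  show "untranspose W Y' (ihom_arr C W g) = g \<cdot> ev C W Y" unfolding ihom_arr_def c using t(2) .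
qed

lemma untranspose_ihom_arr_Comp:
  assumes W: "W \<in> Obj C" and g: "g \<in> Hom C Y Y'" and h: "h \<in> Hom C Z (ihom C W Y)"
  shows "untranspose W Y' (ihom_arr C W g \<cdot> h) = g \<cdot> untranspose W Y h"
proof -
  note Y = Hom_ObjD[OF g] and hW = tens_Hom[OF h Id_Hom[OF W]]
  show ?thesis
    using untranspose_Comp[OF W Y(2) ihom_arr_Hom[OF W g] h] untranspose_ihom_arr[OF W g]
      Comp_assoc[OF hW ev_Hom[OF W Y(1)] g] unfolding untranspose_def by simp
qed

lemma ihom_arr_Comp:
  assumes W: "W \<in> Obj C" and f: "f \<in> Hom C X Y" and g: "g \<in> Hom C Y Z"
  shows "ihom_arr C W (g \<cdot> f) = ihom_arr C W g \<cdot> ihom_arr C W f"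
proof (rule untranspose_inj[OF W Hom_ObjD(2)[OF g]])
  show "ihom_arr C W (g \<cdot> f) \<in> Hom C (ihom C W X) (ihom C W Z)" using ihom_arr_Hom[OF W Comp_Hom[OF f g]] .
  show "ihom_arr C W g \<cdot> ihom_arr C W f \<in> Hom C (ihom C W X) (ihom C W Z)"
    using Comp_Hom[OF ihom_arr_Hom[OF W f] ihom_arr_Hom[OF W g]] .
  show "untranspose W Z (ihom_arr C W (g \<cdot> f)) = untranspose W Z (ihom_arr C W g \<cdot> ihom_arr C W f)"
    using untranspose_ihom_arr[OF W Comp_Hom[OF f g]] untranspose_ihom_arr_Comp[OF W g ihom_arr_Hom[OF W f]]
      untranspose_ihom_arr[OF W f] Comp_assoc[OF ev_Hom[OF W Hom_ObjD(1)[OF f]] f g] by simp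
qed

lemma ihom_arr_Id:
  assumes W: "W \<in> Obj C" and Y: "Y \<in> Obj C"
  shows "ihom_arr C W (Id C Y) = Id C (ihom C W Y)"
proof (rule untranspose_inj[OF W Y])
  note e = ev_Hom[OF W Y] and i = ihom_Obj[OF W Y]
  show "ihom_arr C W (Id C Y) \<in> Hom C (ihom C W Y) (ihom C W Y)" using ihom_arr_Hom[OF W Id_Hom[OF Y]] .
  show "Id C (ihom C W Y) \<in> Hom C (ihom C W Y) (ihom C W Y)" using Id_Hom[OF i] .
  show "untranspose W Y (ihom_arr C W (Id C Y)) = untranspose W Y (Id C (ihom C W Y))"
    using untranspose_ihom_arr[OF W Id_Hom[OF Y]] Id_Comp[OF e] tens_Id[OF i W] Comp_Id[OF e]
    unfolding untranspose_def by simp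
qed

text \<open>The functor \<open>Hom(W, _)\<close> is a right adjoint and preserves kernels; \<open>D \<otimes> _\<close> is a left adjoint up to
  the braiding and preserves cokernels.\<close>

lemma ihom_arr_kernel:
  assumes W: "W \<in> Obj C" and r: "r \<in> Hom C Y Z" and k: "is_kernel C r k"
  shows "is_kernel C (ihom_arr C W r) (ihom_arr C W k)"
proof -
  let ?K = "Dom C k"
  have kH: "k \<in> Hom C ?K Y" "r \<cdot> k = zero ?K Z" using k is_kernel_iff[OF r] by auto
  note O = Hom_ObjD[OF r] and KO = Hom_ObjD(1)[OF kH(1)]
  note Gr = ihom_arr_Hom[OF W r] and Gk = ihom_arr_Hom[OF W kH(1)]
  have D: "Dom C (ihom_arr C W k) = ihom C W ?K" using Gk by (simp add: Hom_def)
  have z: "zero ?K Z \<in> Hom C ?K Z" using zero_Hom[OF KO O(2)] .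
  show ?thesis unfolding is_kernel_iff[OF Gr] D
  proof (intro conjI allI impI)
    show "ihom_arr C W k \<in> Hom C (ihom C W ?K) (ihom C W Y)" by (rule Gk)
    have "untranspose W Z (ihom_arr C W r \<cdot> ihom_arr C W k) = zero (ihom C W ?K \<otimes>\<^sub>o W) Z"
      using untranspose_ihom_arr[OF W Comp_Hom[OF kH(1) r]] ihom_arr_Comp[OF W kH(1) r] kH(2)
        zero_Comp[OF ev_Hom[OF W KO] O(2)] by simp
    then show "ihom_arr C W r \<cdot> ihom_arr C W k = zero (ihom C W ?K) (ihom C W Z)"
      using untranspose_zero_iff[OF W O(2) Comp_Hom[OF Gk Gr]] by simp
    fix X h assume h: "h \<in> Hom C X (ihom C W Y)" and e: "ihom_arr C W r \<cdot> h = zero X (ihom C W Z)"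
    note XO = Hom_ObjD(1)[OF h]
    note uh = untranspose_Hom[OF W O(1) h]
    have "r \<cdot> untranspose W Y h = zero (X \<otimes>\<^sub>o W) Z"
      using untranspose_ihom_arr_Comp[OF W r h] e untranspose_zero[OF W O(2) XO] by simp
    then obtain u where u: "u \<in> Hom C (X \<otimes>\<^sub>o W) ?K" "k \<cdot> u = untranspose W Y h"
      using kernel_factor[OF k r uh] by blast
    let ?t = "transpose C W ?K X u"
    note t = transpose_ihom[OF W KO XO u(1)]
    have "untranspose W Y (ihom_arr C W k \<cdot> ?t) = untranspose W Y h"
      using untranspose_ihom_arr_Comp[OF W kH(1) t(1)] t(2) u(2) by simp
    then have "ihom_arr C W k \<cdot> ?t = h" using untranspose_inj[OF W O(1) Comp_Hom[OF t(1) Gk] h] by simp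
    moreover have "v = ?t" if v: "v \<in> Hom C X (ihom C W ?K)" "ihom_arr C W k \<cdot> v = h" for v
    proof -
      have "k \<cdot> untranspose W ?K v = k \<cdot> untranspose W ?K ?t"
        using untranspose_ihom_arr_Comp[OF W kH(1) v(1)] v(2) t(2) u(2) by simp
      then have "untranspose W ?K v = untranspose W ?K ?t"
        using kernel_cancel[OF k untranspose_Hom[OF W KO v(1)] untranspose_Hom[OF W KO t(1)]] by simp
      then show ?thesis using untranspose_inj[OF W KO v(1) t(1)] by simp
    qed
    ultimately show "\<exists>!u. u \<in> Hom C X (ihom C W ?K) \<and> ihom_arr C W k \<cdot> u = h" using t(1) by blast
  qed
qed

lemma tens_cokernel:
  assumes D: "D \<in> Obj C" and k: "k \<in> Hom C N Y" and s: "is_cokernel C k s"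
  shows "is_cokernel C (Id C D \<otimes>\<^sub>a k) (Id C D \<otimes>\<^sub>a s)"
proof -
  let ?X = "Cod C s"
  have sH: "s \<in> Hom C Y ?X" "s \<cdot> k = zero N ?X" using s is_cokernel_iff[OF k] by auto
  note O = Hom_ObjD[OF k] and XO = Hom_ObjD(2)[OF sH(1)] and i = Id_Hom[OF D]
  note Fk = tens_Hom[OF i k] and Fs = tens_Hom[OF i sH(1)]
  have c: "Cod C (Id C D \<otimes>\<^sub>a s) = D \<otimes>\<^sub>o ?X" using Fs by (simp add: Hom_def)
  note bY = braid_Hom[OF O(2) D] and bY' = braid_Hom[OF D O(2)] and bX = braid_Hom[OF XO D] and bX' = braid_Hom[OF D XO]
  note bN = braid_Hom[OF O(1) D]
  show ?thesis unfolding is_cokernel_iff[OF Fk] c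
  proof (intro conjI allI impI)
    show "Id C D \<otimes>\<^sub>a s \<in> Hom C (D \<otimes>\<^sub>o Y) (D \<otimes>\<^sub>o ?X)" by (rule Fs)
    show "(Id C D \<otimes>\<^sub>a s) \<cdot> (Id C D \<otimes>\<^sub>a k) = zero (D \<otimes>\<^sub>o N) (D \<otimes>\<^sub>o ?X)"
      using tens_Comp_Id(1)[OF D k sH(1)] sH(2) tens_zero[OF D O(1) XO] by simp
    fix T h assume h: "h \<in> Hom C (D \<otimes>\<^sub>o Y) T" and e: "h \<cdot> (Id C D \<otimes>\<^sub>a k) = zero (D \<otimes>\<^sub>o N) T"
    note TO = Hom_ObjD(2)[OF h]
    let ?h' = "transpose C D T Y (h \<cdot> braid C Y D)"
    note h' = transpose_ihom[OF D TO O(2) Comp_Hom[OF bY h]]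
    have "untranspose D T (?h' \<cdot> k) = (h \<cdot> braid C Y D) \<cdot> (k \<otimes>\<^sub>a Id C D)"
      using untranspose_Comp[OF D TO h'(1) k] h'(2) by simp
    also have "\<dots> = (h \<cdot> (Id C D \<otimes>\<^sub>a k)) \<cdot> braid C N D"
      using Comp_assoc[OF tens_Hom[OF k i] bY h] Comp_assoc[OF bN Fk h] braid_natural[OF k i] by simp
    also have "\<dots> = zero (N \<otimes>\<^sub>o D) T" using e zero_Comp[OF bN TO] by simp
    finally have "?h' \<cdot> k = zero N (ihom C D T)"
      using untranspose_zero_iff[OF D TO Comp_Hom[OF k h'(1)]] by simp
    then obtain u' where u': "u' \<in> Hom C ?X (ihom C D T)" "u' \<cdot> s = ?h'"
      using cokernel_factor[OF s k h'(1)] by blast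
    note uu = untranspose_Hom[OF D TO u'(1)]
    let ?u = "untranspose D T u' \<cdot> braid C D ?X"
    have "?u \<cdot> (Id C D \<otimes>\<^sub>a s) = untranspose D T u' \<cdot> ((s \<otimes>\<^sub>a Id C D) \<cdot> braid C D Y)"
      using Comp_assoc[OF Fs bX' uu] braid_natural[OF i sH(1)] by simp
    also have "\<dots> = untranspose D T (u' \<cdot> s) \<cdot> braid C D Y"
      using untranspose_Comp[OF D TO u'(1) sH(1)] Comp_assoc[OF bY' tens_Hom[OF sH(1) i] uu] by simp
    also have "\<dots> = h"
      using u'(2) h'(2) Comp_assoc[OF bY' bY h] symmetry[OF D O(2)] Comp_Id[OF h] by simp
    finally have u: "?u \<cdot> (Id C D \<otimes>\<^sub>a s) = h" .
    moreover have "v = v'" if v: "v \<in> Hom C (D \<otimes>\<^sub>o ?X) T" "v' \<in> Hom C (D \<otimes>\<^sub>o ?X) T"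
      and e: "v \<cdot> (Id C D \<otimes>\<^sub>a s) = v' \<cdot> (Id C D \<otimes>\<^sub>a s)" for v v'
    proof -
      have tr: "untranspose D T (transpose C D T ?X (w \<cdot> braid C ?X D) \<cdot> s) = (w \<cdot> (Id C D \<otimes>\<^sub>a s)) \<cdot> braid C Y D"
        if w: "w \<in> Hom C (D \<otimes>\<^sub>o ?X) T" for w
        using untranspose_Comp[OF D TO transpose_Hom[OF D TO XO Comp_Hom[OF bX w]] sH(1)]
          untranspose_transpose[OF D TO XO Comp_Hom[OF bX w]]
          Comp_assoc[OF tens_Hom[OF sH(1) i] bX w] Comp_assoc[OF bY Fs w] braid_natural[OF sH(1) i] by simp
      note t = transpose_Hom[OF D TO XO Comp_Hom[OF bX v(1)]] and t' = transpose_Hom[OF D TO XO Comp_Hom[OF bX v(2)]]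
      have "transpose C D T ?X (v \<cdot> braid C ?X D) \<cdot> s = transpose C D T ?X (v' \<cdot> braid C ?X D) \<cdot> s"
        using untranspose_inj[OF D TO Comp_Hom[OF sH(1) t] Comp_Hom[OF sH(1) t']] tr[OF v(1)] tr[OF v(2)] e by simp
      then have "transpose C D T ?X (v \<cdot> braid C ?X D) = transpose C D T ?X (v' \<cdot> braid C ?X D)"
        using cokernel_cancel[OF s t t'] by simp
      then have "v \<cdot> braid C ?X D = v' \<cdot> braid C ?X D"
        using untranspose_transpose[OF D TO XO Comp_Hom[OF bX v(1)]]
          untranspose_transpose[OF D TO XO Comp_Hom[OF bX v(2)]] by metis
      then have "(v \<cdot> braid C ?X D) \<cdot> braid C D ?X = (v' \<cdot> braid C ?X D) \<cdot> braid C D ?X" by simp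
      then show "v = v'"
        using Comp_assoc[OF bX' bX v(1)] Comp_assoc[OF bX' bX v(2)] symmetry[OF D XO] Comp_Id v by simp
    qed
    ultimately show "\<exists>!u. u \<in> Hom C (D \<otimes>\<^sub>o ?X) T \<and> u \<cdot> (Id C D \<otimes>\<^sub>a s) = h"
      using Comp_Hom[OF bX' uu] by metis
  qed
qed

lemma dual_Obj: "W \<in> Obj C \<Longrightarrow> dual C W \<in> Obj C"
  unfolding dual_def using ihom_Obj munit_Obj by blast

lemma nuc_arr_eval:
  assumes W: "W \<in> Obj C" and V: "V \<in> Obj C"
  defines "c \<equiv> runit C V \<cdot> (Id C V \<otimes>\<^sub>a ev C W (munit C)) \<cdot> massoc C V (dual C W) W \<cdot>
    (braid C (dual C W) V \<otimes>\<^sub>a Id C W)"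
  shows "c \<in> Hom C ((dual C W \<otimes>\<^sub>o V) \<otimes>\<^sub>o W) V"
    and nuc_arr_Hom: "nuc_arr C W V \<in> Hom C (dual C W \<otimes>\<^sub>o V) (ihom C W V)"
    and "untranspose W V (nuc_arr C W V) = c"
proof -
  note D = dual_Obj[OF W]
  have e: "ev C W (munit C) \<in> Hom C (dual C W \<otimes>\<^sub>o W) (munit C)" using ev_Hom[OF W munit_Obj] unfolding dual_def .
  show c: "c \<in> Hom C ((dual C W \<otimes>\<^sub>o V) \<otimes>\<^sub>o W) V" unfolding c_def
    using Comp_Hom[OF Comp_Hom[OF Comp_Hom[OF tens_Hom[OF braid_Hom[OF D V] Id_Hom[OF W]] massoc_Hom[OF V D W]]
          tens_Hom[OF Id_Hom[OF V] e]] runit_Hom[OF V]] .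
  show "nuc_arr C W V \<in> Hom C (dual C W \<otimes>\<^sub>o V) (ihom C W V)" "untranspose W V (nuc_arr C W V) = c"
    using transpose_ihom[OF W V tens_Obj[OF D V] c] unfolding nuc_arr_def c_def by auto
qed

text \<open>Naturality is checked on the untransposed arrows, one factor of the defining composite at a time.\<close>

lemma nuc_arr_natural:
  assumes W: "W \<in> Obj C" and \<phi>: "\<phi> \<in> Hom C V V'"
  shows "nuc_arr C W V' \<cdot> (Id C (dual C W) \<otimes>\<^sub>a \<phi>) = ihom_arr C W \<phi> \<cdot> nuc_arr C W V"
proof -
  let ?D = "dual C W" and ?e = "munit C"
  note V = Hom_ObjD[OF \<phi>] and D = dual_Obj[OF W] and E = munit_Obj
  note iD = Id_Hom[OF D] and iW = Id_Hom[OF W] and iE = Id_Hom[OF E]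
  note F\<phi> = tens_Hom[OF iD \<phi>]
  have e: "ev C W ?e \<in> Hom C (?D \<otimes>\<^sub>o W) ?e" using ev_Hom[OF W E] unfolding dual_def .
  note n = nuc_arr_eval[OF W V(1)] and n' = nuc_arr_eval[OF W V(2)]
  note b = tens_Hom[OF braid_Hom[OF D V(1)] iW] and b' = tens_Hom[OF braid_Hom[OF D V(2)] iW]
  note F\<phi>W = tens_Hom[OF F\<phi> iW] and \<phi>DW = tens_Hom[OF tens_Hom[OF \<phi> iD] iW]
  note m = massoc_Hom[OF V(1) D W] and m' = massoc_Hom[OF V(2) D W]
  note v = tens_Hom[OF Id_Hom[OF V(1)] e] and v' = tens_Hom[OF Id_Hom[OF V(2)] e]
  note r = runit_Hom[OF V(1)] and r' = runit_Hom[OF V(2)]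
  note \<phi>t = tens_Hom[OF \<phi> Id_Hom[OF tens_Obj[OF D W]]] and \<phi>e = tens_Hom[OF \<phi> iE]
  have s1: "(braid C ?D V' \<otimes>\<^sub>a Id C W) \<cdot> ((Id C ?D \<otimes>\<^sub>a \<phi>) \<otimes>\<^sub>a Id C W) =
      ((\<phi> \<otimes>\<^sub>a Id C ?D) \<otimes>\<^sub>a Id C W) \<cdot> (braid C ?D V \<otimes>\<^sub>a Id C W)"
    using tens_Comp_Id(2)[OF W F\<phi> braid_Hom[OF D V(2)]] braid_natural[OF iD \<phi>]
      tens_Comp_Id(2)[OF W braid_Hom[OF D V(1)] tens_Hom[OF \<phi> iD]] by simp
  have s2: "massoc C V' ?D W \<cdot> ((\<phi> \<otimes>\<^sub>a Id C ?D) \<otimes>\<^sub>a Id C W) = (\<phi> \<otimes>\<^sub>a Id C (?D \<otimes>\<^sub>o W)) \<cdot> massoc C V ?D W"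
    using massoc_natural[OF \<phi> iD iW] tens_Id[OF D W] by simp
  have s3: "(Id C V' \<otimes>\<^sub>a ev C W ?e) \<cdot> (\<phi> \<otimes>\<^sub>a Id C (?D \<otimes>\<^sub>o W)) = (\<phi> \<otimes>\<^sub>a Id C ?e) \<cdot> (Id C V \<otimes>\<^sub>a ev C W ?e)"
    using tens_Comp[OF \<phi> Id_Hom[OF V(2)] Id_Hom[OF tens_Obj[OF D W]] e]
      tens_Comp[OF Id_Hom[OF V(1)] \<phi> e iE] Id_Comp[OF \<phi>] Comp_Id[OF \<phi>] Id_Comp[OF e] Comp_Id[OF e] by simp
  have "untranspose W V' (nuc_arr C W V' \<cdot> (Id C ?D \<otimes>\<^sub>a \<phi>)) =
      (runit C V' \<cdot> (Id C V' \<otimes>\<^sub>a ev C W ?e) \<cdot> massoc C V' ?D W \<cdot> (braid C ?D V' \<otimes>\<^sub>a Id C W)) \<cdot>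
        ((Id C ?D \<otimes>\<^sub>a \<phi>) \<otimes>\<^sub>a Id C W)"
    using untranspose_Comp[OF W V(2) n'(2) F\<phi>] n'(3) by simp
  also have "\<dots> = runit C V' \<cdot> (Id C V' \<otimes>\<^sub>a ev C W ?e) \<cdot> massoc C V' ?D W \<cdot>
      ((braid C ?D V' \<otimes>\<^sub>a Id C W) \<cdot> ((Id C ?D \<otimes>\<^sub>a \<phi>) \<otimes>\<^sub>a Id C W))"
    using Comp_assoc[OF F\<phi>W b' m'] Comp_assoc[OF F\<phi>W Comp_Hom[OF b' m'] v']
      Comp_assoc[OF F\<phi>W Comp_Hom[OF Comp_Hom[OF b' m'] v'] r'] by simp
  also have "\<dots> = runit C V' \<cdot> (Id C V' \<otimes>\<^sub>a ev C W ?e) \<cdot> (\<phi> \<otimes>\<^sub>a Id C (?D \<otimes>\<^sub>o W)) \<cdot>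
      massoc C V ?D W \<cdot> (braid C ?D V \<otimes>\<^sub>a Id C W)"
    unfolding s1 using Comp_rewrite[OF s2 \<phi>DW m' m \<phi>t b] by simp
  also have "\<dots> = runit C V' \<cdot> (\<phi> \<otimes>\<^sub>a Id C ?e) \<cdot> (Id C V \<otimes>\<^sub>a ev C W ?e) \<cdot>
      massoc C V ?D W \<cdot> (braid C ?D V \<otimes>\<^sub>a Id C W)"
    using Comp_rewrite[OF s3 \<phi>t v' v \<phi>e Comp_Hom[OF b m]] by simp
  also have "\<dots> = \<phi> \<cdot> runit C V \<cdot> (Id C V \<otimes>\<^sub>a ev C W ?e) \<cdot> massoc C V ?D W \<cdot> (braid C ?D V \<otimes>\<^sub>a Id C W)"
    using Comp_rewrite[OF runit_natural[OF \<phi>] \<phi>e r' r \<phi> Comp_Hom[OF Comp_Hom[OF b m] v]] by simp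
  also have "\<dots> = untranspose W V' (ihom_arr C W \<phi> \<cdot> nuc_arr C W V)"
    using untranspose_ihom_arr_Comp[OF W \<phi> n(2)] n(3) by simp
  finally show ?thesis
    using untranspose_inj[OF W V(2) Comp_Hom[OF F\<phi> n'(2)] Comp_Hom[OF n(2) ihom_arr_Hom[OF W \<phi>]]] by simp
qed

end

section \<open>Nuclearity in terms of arrows from objects of the category\<close>

text \<open>The index category of \<open>W\<^sup>\<or> \<otimes> V\<close> is that of \<open>V\<close>, up to renaming \<open>j\<close> to \<open>((), j)\<close>.\<close>

lemma prod_point_cat: "prod_cat point_cat J = transport_cat (Pair ()) (Pair ()) J"
proof -
  have i: "inv_into UNIV (Pair ()) = (snd :: unit \<times> 'x \<Rightarrow> 'x)"
    by (rule ext) (auto intro!: inv_f_eq injI)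
  have s: "UNIV \<times> S = Pair () ` S" for S :: "'x set" by auto
  show ?thesis
    unfolding prod_cat_def transport_cat_def point_cat_def i s by (auto simp: fun_eq_iff)
qed

context quasi_abelian_monoidal
begin

lemma tens_Id_functor:
  assumes V: "ind_object C V" and D: "D \<in> Obj C"
  shows "is_functor (idx V) C (\<lambda>j. D \<otimes>\<^sub>o ob V j) (\<lambda>m. Id C D \<otimes>\<^sub>a ar V m)"
proof -
  interpret I: category "idx V" using V by (rule ind_category)
  have "Id C D \<otimes>\<^sub>a ar V (n \<cdot>\<^bsub>idx V\<^esub> m) = (Id C D \<otimes>\<^sub>a ar V n) \<cdot> (Id C D \<otimes>\<^sub>a ar V m)"
    if m: "m \<in> Hom (idx V) i j" and n: "n \<in> Hom (idx V) j k" for m n i j k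
    using tens_Comp_Id(1)[OF D ar_Hom[OF V m] ar_Hom[OF V n]] ar_Comp[OF V m n] by simp
  then show ?thesis
    using tens_Obj[OF D] ob_Obj[OF V] ar_Id[OF V] tens_Id[OF D] tens_Hom[OF Id_Hom[OF D] ar_Hom[OF V]]
    unfolding is_functor_def by (auto simp: Hom_def)
qed

lemma tens_const:
  assumes V: "ind_object C V" and D: "D \<in> Obj C"
  defines "A \<equiv> ind_tens C (ind_const C D) V"
  shows tens_const_ind_object: "ind_object C A"
    and tens_const_simps: "((), j) \<in> Obj (idx A) \<longleftrightarrow> j \<in> Obj (idx V)"
      "((), m) \<in> Hom (idx A) ((), i) ((), j) \<longleftrightarrow> m \<in> Hom (idx V) i j"
      "ob A ((), j) = D \<otimes>\<^sub>o ob V j" "ar A ((), m) = Id C D \<otimes>\<^sub>a ar V m"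
proof -
  interpret T: transport "Pair ()" "Pair ()" "idx V" by standard (simp_all add: inj_on_def)
  let ?T = "transport_ind (Pair ()) (Pair ()) (idx V) (\<lambda>j. D \<otimes>\<^sub>o ob V j) (\<lambda>m. Id C D \<otimes>\<^sub>a ar V m)"
  have i: "idx A = T.R" by (simp add: A_def ind_tens_def ind_const_def prod_point_cat)
  show o: "ob A ((), j) = D \<otimes>\<^sub>o ob V j" and a: "ar A ((), m) = Id C D \<otimes>\<^sub>a ar V m" for j m
    by (simp_all add: A_def ind_tens_def ind_const_def)
  have "ob A = ob ?T" "ar A = ar ?T"
    using o a T.transport_ind_simps by (auto simp: fun_eq_iff)
  then have "A = ?T" using i T.transport_ind_simps(1) by simp
  then show "ind_object C A"
    using T.transport_ind_object[OF ind_filtered[OF V] tens_Id_functor[OF V D]] by simp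
  show "((), j) \<in> Obj (idx A) \<longleftrightarrow> j \<in> Obj (idx V)"
    "((), m) \<in> Hom (idx A) ((), i) ((), j) \<longleftrightarrow> m \<in> Hom (idx V) i j" for i j m
    unfolding i by (auto simp: T.transport_simps T.transport_Hom_iff)
qed

lemma ind_ihom:
  assumes V: "ind_object C V" and W: "W \<in> Obj C"
  shows "ind_object C (ind_ihom C W V)"
proof -
  interpret I: category "idx V" using V by (rule ind_category)
  have "ihom_arr C W (ar V (n \<cdot>\<^bsub>idx V\<^esub> m)) = ihom_arr C W (ar V n) \<cdot> ihom_arr C W (ar V m)"
    if m: "m \<in> Hom (idx V) i j" and n: "n \<in> Hom (idx V) j k" for m n i j k
    using ihom_arr_Comp[OF W ar_Hom[OF V m] ar_Hom[OF V n]] ar_Comp[OF V m n] by simp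
  then have "is_functor (idx V) C (\<lambda>j. ihom C W (ob V j)) (\<lambda>m. ihom_arr C W (ar V m))"
    using ihom_Obj[OF W] ob_Obj[OF V] ar_Id[OF V] ihom_arr_Id[OF W] ihom_arr_Hom[OF W ar_Hom[OF V]]
    unfolding is_functor_def by (auto simp: Hom_def)
  then show ?thesis using ind_filtered[OF V] by (simp add: ind_object_def ind_ihom_def)
qed

lemma ind_ihom_simps [simp]:
  "idx (ind_ihom C W V) = idx V" "ob (ind_ihom C W V) j = ihom C W (ob V j)"
  "ar (ind_ihom C W V) m = ihom_arr C W (ar V m)"
  by (simp_all add: ind_ihom_def)

text \<open>Injectivity and surjectivity of \<open>W\<^sup>\<or> \<otimes> V \<rightarrow> Hom(W, V)\<close> on arrows from objects \<open>X\<close> of \<open>C\<close>. Both sides are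
  filtered colimits of groups, so an equation may be required only at a later index.\<close>

definition nuc_inj :: "'o \<Rightarrow> ('j, 'o, 'a) ind_obj \<Rightarrow> bool" where
  "nuc_inj W V \<longleftrightarrow> (\<forall>j X a. a \<in> Hom C X (dual C W \<otimes>\<^sub>o ob V j) \<longrightarrow> j \<in> Obj (idx V) \<longrightarrow>
     nuc_arr C W (ob V j) \<cdot> a = zero X (ihom C W (ob V j)) \<longrightarrow>
     (\<exists>k u. u \<in> Hom (idx V) j k \<and> (Id C (dual C W) \<otimes>\<^sub>a ar V u) \<cdot> a = zero X (dual C W \<otimes>\<^sub>o ob V k)))"

definition nuc_surj :: "'o \<Rightarrow> ('j, 'o, 'a) ind_obj \<Rightarrow> bool" where
  "nuc_surj W V \<longleftrightarrow> (\<forall>j X b. b \<in> Hom C X (ihom C W (ob V j)) \<longrightarrow> j \<in> Obj (idx V) \<longrightarrow>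
     (\<exists>k u a. u \<in> Hom (idx V) j k \<and> a \<in> Hom C X (dual C W \<otimes>\<^sub>o ob V k) \<and>
        nuc_arr C W (ob V k) \<cdot> a = ihom_arr C W (ar V u) \<cdot> b))"

lemma nuc_injE:
  assumes "nuc_inj W V" "a \<in> Hom C X (dual C W \<otimes>\<^sub>o ob V j)" "j \<in> Obj (idx V)"
    "nuc_arr C W (ob V j) \<cdot> a = zero X (ihom C W (ob V j))"
  obtains k u where "u \<in> Hom (idx V) j k" "(Id C (dual C W) \<otimes>\<^sub>a ar V u) \<cdot> a = zero X (dual C W \<otimes>\<^sub>o ob V k)"
  using assms unfolding nuc_inj_def by blast

lemma nuc_surjE:
  assumes "nuc_surj W V" "b \<in> Hom C X (ihom C W (ob V j))" "j \<in> Obj (idx V)"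
  obtains k u a where "u \<in> Hom (idx V) j k" "a \<in> Hom C X (dual C W \<otimes>\<^sub>o ob V k)"
    "nuc_arr C W (ob V k) \<cdot> a = ihom_arr C W (ar V u) \<cdot> b"
  using assms unfolding nuc_surj_def by blast

lemma nuc_injE2:
  assumes V: "ind_object C V" and W: "W \<in> Obj C" and i: "nuc_inj W V"
    and a: "a \<in> Hom C X (dual C W \<otimes>\<^sub>o ob V j)" "a' \<in> Hom C X (dual C W \<otimes>\<^sub>o ob V j)" and j: "j \<in> Obj (idx V)"
    and e: "nuc_arr C W (ob V j) \<cdot> a = nuc_arr C W (ob V j) \<cdot> a'"
  obtains k u where "u \<in> Hom (idx V) j k"
    "(Id C (dual C W) \<otimes>\<^sub>a ar V u) \<cdot> a = (Id C (dual C W) \<otimes>\<^sub>a ar V u) \<cdot> a'"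
proof -
  note n = nuc_arr_Hom[OF W ob_Obj[OF V j]]
  have "nuc_arr C W (ob V j) \<cdot> sub a a' = zero X (ihom C W (ob V j))"
    using Comp_sub[OF a n] e sub_eq_zero_iff[OF Comp_Hom[OF a(1) n] Comp_Hom[OF a(2) n]] by simp
  then obtain k u where u: "u \<in> Hom (idx V) j k"
    "(Id C (dual C W) \<otimes>\<^sub>a ar V u) \<cdot> sub a a' = zero X (dual C W \<otimes>\<^sub>o ob V k)"
    using nuc_injE[OF i sub_Hom[OF a] j] by blast
  note F = tens_Hom[OF Id_Hom[OF dual_Obj[OF W]] ar_Hom[OF V u(1)]]
  show ?thesis
    using that[OF u(1)] u(2) Comp_sub[OF a F] sub_eq_zero_iff[OF Comp_Hom[OF a(1) F] Comp_Hom[OF a(2) F]] by simp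
qed

text \<open>A morphism of ind-objects is an isomorphism if and only if it is bijective on arrows from objects
  of \<open>C\<close>; here for the morphism that defines nuclearity.\<close>

lemma nuclear_elementwise:
  assumes V: "ind_object C V" and W: "W \<in> Obj C"
  shows "ind_iso C (ind_tens C (ind_const C (dual C W)) V) (ind_ihom C W V) (ind_nuc C W V) \<longleftrightarrow>
    nuc_inj W V \<and> nuc_surj W V"
proof -
  interpret I: category "idx V" using V by (rule ind_category)
  let ?D = "dual C W"
  let ?n = "\<lambda>j. nuc_arr C W (ob V j)" and ?F = "\<lambda>\<phi>. Id C ?D \<otimes>\<^sub>a \<phi>" and ?G = "ihom_arr C W"
  define A where "A = ind_tens C (ind_const C ?D) V"
  define B where "B = ind_ihom C W V"
  define x where "x = ind_nuc C W V"
  note D = dual_Obj[OF W]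
  have A: "ind_object C A" and A1: "\<And>j. ((), j) \<in> Obj (idx A) \<longleftrightarrow> j \<in> Obj (idx V)"
    and A2: "\<And>m i j. ((), m) \<in> Hom (idx A) ((), i) ((), j) \<longleftrightarrow> m \<in> Hom (idx V) i j"
    and A3: "\<And>j. ob A ((), j) = ?D \<otimes>\<^sub>o ob V j" and A4: "\<And>m. ar A ((), m) = ?F (ar V m)"
    using tens_const[OF V D] unfolding A_def by auto
  have B: "ind_object C B" unfolding B_def using ind_ihom[OF V W] .
  have B1: "idx B = idx V" "\<And>j. ob B j = ihom C W (ob V j)" "\<And>m. ar B m = ?G (ar V m)"
    by (simp_all add: B_def)
  have nH: "?n j \<in> Hom C (?D \<otimes>\<^sub>o ob V j) (ihom C W (ob V j))" if "j \<in> Obj (idx V)" for j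
    using nuc_arr_Hom[OF W ob_Obj[OF V that]] .
  have nat: "?n k \<cdot> ?F (ar V u) = ?G (ar V u) \<cdot> ?n j" if "u \<in> Hom (idx V) j k" for u j k
    using nuc_arr_natural[OF W ar_Hom[OF V that]] .
  note F = tens_Hom[OF Id_Hom[OF D] ar_Hom[OF V]] and G = ihom_arr_Hom[OF W ar_Hom[OF V]]
  have xe: "x = make_hom A B snd (\<lambda>i. ?n (snd i))"
    by (rule ext) (auto simp: x_def ind_nuc_def make_hom_def germ_def A1 A3 B_def)
  have "make_hom A B snd (\<lambda>i. ?n (snd i)) \<in> ind_hom C A B \<and>
    (\<forall>i\<in>Obj (idx A). (snd i, ?n (snd i)) \<in> make_hom A B snd (\<lambda>i. ?n (snd i)) i)"
  proof (intro conjI ballI)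
    have H: "snd i \<in> Obj (idx B)" "?n (snd i) \<in> Hom C (ob A i) (ob B (snd i))" if "i \<in> Obj (idx A)" for i
      using that nH by (cases i; simp add: A1 A3 B1)+
    have c: "same_germ B (snd i') (?n (snd i') \<cdot> ar A m) (snd i) (?n (snd i))" if m: "m \<in> Hom (idx A) i i'" for m i i'
    proof -
      have u: "snd m \<in> Hom (idx V) (snd i) (snd i')" using m by (cases m; cases i; cases i') (simp add: A2)
      have uB: "snd m \<in> Hom (idx B) (snd i) (snd i')" using u by (simp add: B1)
      have "?n (snd i') \<cdot> ar A m = ar B (snd m) \<cdot> ?n (snd i)"
        using nat[OF u] by (cases m) (simp add: A4 B1)
      moreover have "same_germ B (snd i) (?n (snd i)) (snd i') (ar B (snd m) \<cdot> ?n (snd i))"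
        by (rule same_germ_ar[OF B _ uB, of _ "?D \<otimes>\<^sub>o ob V (snd i)"])
          (use nH[OF I.Hom_ObjD(1)[OF u]] in \<open>simp add: B1\<close>)
      ultimately show ?thesis using same_germ_sym by simp
    qed
    note M = make_hom[where n = snd and r = "\<lambda>i. ?n (snd i)", OF A B H c]
    show "make_hom A B snd (\<lambda>i. ?n (snd i)) \<in> ind_hom C A B" by (rule M(1))
    show "(snd i, ?n (snd i)) \<in> make_hom A B snd (\<lambda>i. ?n (snd i)) i" if "i \<in> Obj (idx A)" for i
      using M(2) that by simp
  qed
  then have x: "x \<in> ind_hom C A B" and xm: "(j, ?n j) \<in> x ((), j)" if "j \<in> Obj (idx V)" for j
    unfolding xe using that A1 by force+
  have xB: "x \<in> ind_hom C A B"
    using x ind_filtered[OF V] unfolding filtered_def by blast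
  have "ind_iso C A B x \<longleftrightarrow> nuc_inj W V \<and> nuc_surj W V"
  proof (intro iffI conjI)
    assume "ind_iso C A B x"
    then obtain y where y: "y \<in> ind_hom C B A" and yx: "ind_comp C A A y x = ind_id C A"
      and xy: "ind_comp C B B x y = ind_id C B"
      unfolding ind_iso_def by blast
    have rep: "\<exists>l \<psi>. (((), l), \<psi>) \<in> y j \<and> l \<in> Obj (idx V) \<and> \<psi> \<in> Hom C (ihom C W (ob V j)) (?D \<otimes>\<^sub>o ob V l)"
      if j: "j \<in> Obj (idx V)" for j
    proof -
      obtain p \<psi> where p: "(p, \<psi>) \<in> y j" using ind_hom_rep[OF A y] j B1 by metis
      note pD = ind_hom_memD[OF A y p]
      obtain l where "p = ((), l)" by (cases p) auto
      then show ?thesis using p pD by (auto simp: A1 A3 B1)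
    qed
    show "nuc_inj W V" unfolding nuc_inj_def
    proof (intro allI impI)
      fix j X a assume a: "a \<in> Hom C X (?D \<otimes>\<^sub>o ob V j)" and j: "j \<in> Obj (idx V)"
        and e: "?n j \<cdot> a = zero X (ihom C W (ob V j))"
      obtain l \<psi> where l: "(((), l), \<psi>) \<in> y j" "l \<in> Obj (idx V)" "\<psi> \<in> Hom C (ihom C W (ob V j)) (?D \<otimes>\<^sub>o ob V l)"
        using rep[OF j] by blast
      have "(((), l), \<psi> \<cdot> ?n j) \<in> ind_id C A ((), j)"
        using ind_comp(2)[OF A B A xB y xm[OF j] l(1)] yx by simp
      moreover have "(((), j), Id C (?D \<otimes>\<^sub>o ob V j)) \<in> ind_id C A ((), j)"
        using ind_id(2)[OF A, of "((), j)"] j by (simp add: A1 A3)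
      ultimately obtain k u v where k: "u \<in> Hom (idx A) ((), l) k" "v \<in> Hom (idx A) ((), j) k"
        "ar A u \<cdot> (\<psi> \<cdot> ?n j) = ar A v \<cdot> Id C (?D \<otimes>\<^sub>o ob V j)"
        using ind_hom_same_germ[OF A ind_id(1)[OF A]] unfolding same_germ_def by blast
      obtain k' u' v' where c: "k = ((), k')" "u = ((), u')" "v = ((), v')" by (cases k; cases u; cases v) auto
      have u': "u' \<in> Hom (idx V) l k'" and v': "v' \<in> Hom (idx V) j k'" using k(1,2) c by (simp_all add: A2)
      have e2: "?F (ar V u') \<cdot> \<psi> \<cdot> ?n j = ?F (ar V v')"
        using k(3) c Comp_Id[OF F[OF v']] by (simp add: A4)
      have "?F (ar V v') \<cdot> a = (?F (ar V u') \<cdot> \<psi>) \<cdot> (?n j \<cdot> a)"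
        unfolding e2[symmetric] using Comp_assoc[OF a Comp_Hom[OF nH[OF j] l(3)] F[OF u']]
          Comp_assoc[OF a nH[OF j] l(3)] Comp_assoc[OF Comp_Hom[OF a nH[OF j]] l(3) F[OF u']] by simp
      also have "\<dots> = zero X (?D \<otimes>\<^sub>o ob V k')"
        unfolding e using Comp_zero[OF Comp_Hom[OF l(3) F[OF u']] Hom_ObjD(1)[OF a]] .
      finally show "\<exists>k u. u \<in> Hom (idx V) j k \<and> ?F (ar V u) \<cdot> a = zero X (?D \<otimes>\<^sub>o ob V k)"
        using v' by blast
    qed
    show "nuc_surj W V" unfolding nuc_surj_def
    proof (intro allI impI)
      fix j X b assume b: "b \<in> Hom C X (ihom C W (ob V j))" and j: "j \<in> Obj (idx V)"
      obtain l \<psi> where l: "(((), l), \<psi>) \<in> y j" "l \<in> Obj (idx V)" "\<psi> \<in> Hom C (ihom C W (ob V j)) (?D \<otimes>\<^sub>o ob V l)"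
        using rep[OF j] by blast
      have "(l, ?n l \<cdot> \<psi>) \<in> ind_id C B j"
        using ind_comp(2)[OF B A B y xB l(1) xm[OF l(2)]] xy by simp
      moreover have "(j, Id C (ihom C W (ob V j))) \<in> ind_id C B j"
        using ind_id(2)[OF B, of j] j by (simp add: B1)
      ultimately obtain k u v where k: "u \<in> Hom (idx V) l k" "v \<in> Hom (idx V) j k"
        "?G (ar V u) \<cdot> (?n l \<cdot> \<psi>) = ?G (ar V v) \<cdot> Id C (ihom C W (ob V j))"
        using ind_hom_same_germ[OF B ind_id(1)[OF B]] unfolding same_germ_def B1 by blast
      have kO: "k \<in> Obj (idx V)" using I.Hom_ObjD(2)[OF k(1)] .
      let ?a = "?F (ar V u) \<cdot> \<psi> \<cdot> b"
      note \<psi>b = Comp_Hom[OF b l(3)]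
      have a: "?a \<in> Hom C X (?D \<otimes>\<^sub>o ob V k)" using Comp_Hom[OF \<psi>b F[OF k(1)]] .
      have "?n k \<cdot> ?a = ?G (ar V u) \<cdot> ?n l \<cdot> \<psi> \<cdot> b"
        using Comp_rewrite[OF nat[OF k(1)] F[OF k(1)] nH[OF kO] nH[OF l(2)] G[OF k(1)] \<psi>b] .
      also have "\<dots> = (?G (ar V u) \<cdot> (?n l \<cdot> \<psi>)) \<cdot> b"
        using Comp_assoc[OF b l(3) nH[OF l(2)]] Comp_assoc[OF b Comp_Hom[OF l(3) nH[OF l(2)]] G[OF k(1)]] by simp
      also have "\<dots> = ?G (ar V v) \<cdot> b" unfolding k(3) using Comp_Id[OF G[OF k(2)]] by simp
      finally show "\<exists>k u a. u \<in> Hom (idx V) j k \<and> a \<in> Hom C X (?D \<otimes>\<^sub>o ob V k) \<and>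
          ?n k \<cdot> a = ?G (ar V u) \<cdot> b"
        using k(2) a by blast
    qed
  next
    assume "nuc_inj W V \<and> nuc_surj W V"
    then have inj: "nuc_inj W V" and surj: "nuc_surj W V" by auto
    \<comment> \<open>The inverse is represented at \<open>j\<close> by a preimage of the identity of \<open>Hom(W, V\<^sub>j)\<close>.\<close>
    have "\<forall>j. \<exists>l u \<psi>. j \<in> Obj (idx V) \<longrightarrow> u \<in> Hom (idx V) j l \<and>
        \<psi> \<in> Hom C (ihom C W (ob V j)) (?D \<otimes>\<^sub>o ob V l) \<and> ?n l \<cdot> \<psi> = ?G (ar V u)"
    proof
      fix j
      show "\<exists>l u \<psi>. j \<in> Obj (idx V) \<longrightarrow> u \<in> Hom (idx V) j l \<and>
        \<psi> \<in> Hom C (ihom C W (ob V j)) (?D \<otimes>\<^sub>o ob V l) \<and> ?n l \<cdot> \<psi> = ?G (ar V u)"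
      proof (cases "j \<in> Obj (idx V)")
        case j: True
        obtain l u \<psi> where "u \<in> Hom (idx V) j l" "\<psi> \<in> Hom C (ihom C W (ob V j)) (?D \<otimes>\<^sub>o ob V l)"
          "?n l \<cdot> \<psi> = ?G (ar V u) \<cdot> Id C (ihom C W (ob V j))"
          using nuc_surjE[OF surj Id_Hom[OF ihom_Obj[OF W ob_Obj[OF V j]]] j] .
        then show ?thesis using Comp_Id[OF G] by auto
      qed simp
    qed
    then obtain l u \<psi> where lu: "\<forall>j. j \<in> Obj (idx V) \<longrightarrow> u j \<in> Hom (idx V) j (l j) \<and>
        \<psi> j \<in> Hom C (ihom C W (ob V j)) (?D \<otimes>\<^sub>o ob V (l j)) \<and> ?n (l j) \<cdot> \<psi> j = ?G (ar V (u j))"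
      by metis
    have u: "u j \<in> Hom (idx V) j (l j)" and \<psi>: "\<psi> j \<in> Hom C (ihom C W (ob V j)) (?D \<otimes>\<^sub>o ob V (l j))"
      and ne: "?n (l j) \<cdot> \<psi> j = ?G (ar V (u j))" and lO: "l j \<in> Obj (idx V)" if "j \<in> Obj (idx V)" for j
      using lu that I.Hom_ObjD(2) by blast+
    have H: "((), l j) \<in> Obj (idx A)" "\<psi> j \<in> Hom C (ob B j) (ob A ((), l j))" if "j \<in> Obj (idx B)" for j
      using lO \<psi> that by (simp_all add: A1 A3 B1)
    have c: "same_germ A ((), l j') (\<psi> j' \<cdot> ar B m) ((), l j) (\<psi> j)" if mB: "m \<in> Hom (idx B) j j'" for m j j'
    proof -
      have m: "m \<in> Hom (idx V) j j'" using mB by (simp add: B1)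
      note j = I.Hom_ObjD[OF m]
      obtain q r r' where q: "r \<in> Hom (idx V) (l j) q" "r' \<in> Hom (idx V) (l j') q"
        "r \<cdot>\<^bsub>idx V\<^esub> u j = r' \<cdot>\<^bsub>idx V\<^esub> (u j' \<cdot>\<^bsub>idx V\<^esub> m)"
        using filtered_span[OF ind_filtered[OF V] u[OF j(1)] I.Comp_Hom[OF m u[OF j(2)]]] .
      have qO: "q \<in> Obj (idx V)" using I.Hom_ObjD(2)[OF q(1)] .
      let ?a = "?F (ar V r) \<cdot> \<psi> j" and ?a' = "?F (ar V r') \<cdot> (\<psi> j' \<cdot> ?G (ar V m))"
      note \<psi>m = Comp_Hom[OF G[OF m] \<psi>[OF j(2)]]
      note aH = Comp_Hom[OF \<psi>[OF j(1)] F[OF q(1)]] and aH' = Comp_Hom[OF \<psi>m F[OF q(2)]]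
      have "?n q \<cdot> ?a = ?G (ar V r) \<cdot> ?G (ar V (u j))"
        using Comp_rewrite[OF nat[OF q(1)] F[OF q(1)] nH[OF qO] nH[OF lO[OF j(1)]] G[OF q(1)] \<psi>[OF j(1)]] ne[OF j(1)] by simp
      also have "\<dots> = ?G (ar V (r \<cdot>\<^bsub>idx V\<^esub> u j))"
        using ihom_arr_Comp[OF W ar_Hom[OF V u[OF j(1)]] ar_Hom[OF V q(1)]] ar_Comp[OF V u[OF j(1)] q(1)] by simp
      also have "\<dots> = ?G (ar V r') \<cdot> ?G (ar V (u j')) \<cdot> ?G (ar V m)"
        unfolding q(3) using ar_Comp[OF V I.Comp_Hom[OF m u[OF j(2)]] q(2)] ar_Comp[OF V m u[OF j(2)]]
          ihom_arr_Comp[OF W ar_Hom[OF V m] ar_Hom[OF V u[OF j(2)]]]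
          ihom_arr_Comp[OF W Comp_Hom[OF ar_Hom[OF V m] ar_Hom[OF V u[OF j(2)]]] ar_Hom[OF V q(2)]] by simp
      also have "\<dots> = ?n q \<cdot> ?a'"
        using Comp_rewrite[OF nat[OF q(2)] F[OF q(2)] nH[OF qO] nH[OF lO[OF j(2)]] G[OF q(2)] \<psi>m]
          Comp_rewrite1[OF ne[OF j(2)] \<psi>[OF j(2)] nH[OF lO[OF j(2)]] G[OF m]] by simp
      finally obtain k v where k: "v \<in> Hom (idx V) q k"
        "?F (ar V v) \<cdot> ?a = ?F (ar V v) \<cdot> ?a'"
        using nuc_injE2[OF V W inj aH aH' qO] by blast
      have g: "?F (ar V (v \<cdot>\<^bsub>idx V\<^esub> s)) \<cdot> h = ?F (ar V v) \<cdot> ?F (ar V s) \<cdot> h"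
        if s: "s \<in> Hom (idx V) i q" and h: "h \<in> Hom C X (?D \<otimes>\<^sub>o ob V i)" for s i h X
        using tens_Comp_Id(1)[OF D ar_Hom[OF V s] ar_Hom[OF V k(1)]] ar_Comp[OF V s k(1)]
          Comp_assoc[OF h F[OF s] F[OF k(1)]] by simp
      show ?thesis
      proof (rule same_germI)
        show "((), v \<cdot>\<^bsub>idx V\<^esub> r') \<in> Hom (idx A) ((), l j') ((), k)" "((), v \<cdot>\<^bsub>idx V\<^esub> r) \<in> Hom (idx A) ((), l j) ((), k)"
          using I.Comp_Hom[OF q(1) k(1)] I.Comp_Hom[OF q(2) k(1)] by (simp_all add: A2)
        show "ar A ((), v \<cdot>\<^bsub>idx V\<^esub> r') \<cdot> (\<psi> j' \<cdot> ar B m) = ar A ((), v \<cdot>\<^bsub>idx V\<^esub> r) \<cdot> \<psi> j"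
          unfolding A4 B1 g[OF q(1) \<psi>[OF j(1)]] g[OF q(2) \<psi>m] using k(2) by simp
      qed
    qed
    note M = make_hom[where n = "\<lambda>j. ((), l j)" and r = \<psi>, OF B A H c]
    define y where "y = make_hom B A (\<lambda>j. ((), l j)) \<psi>"
    have y: "y \<in> ind_hom C B A" unfolding y_def by (rule M(1))
    have ym: "(((), l j), \<psi> j) \<in> y j" if "j \<in> Obj (idx V)" for j unfolding y_def using M(2) that by (simp add: B1)
    have "ind_comp C A A y x = ind_id C A"
    proof (rule ind_hom_ext[OF A ind_comp(1)[OF A B A xB y] ind_id(1)[OF A]])
      fix p assume p: "p \<in> Obj (idx A)"
      obtain j where pj: "p = ((), j)" by (cases p) auto
      have j: "j \<in> Obj (idx V)" using p pj by (simp add: A1)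
      note m = ind_comp(2)[OF A B A xB y xm[OF j] ym[OF j]]
      note \<psi>n = Comp_Hom[OF nH[OF j] \<psi>[OF j]]
      have "?n (l j) \<cdot> (\<psi> j \<cdot> ?n j) = ?n (l j) \<cdot> ?F (ar V (u j))"
        using Comp_rewrite1[OF ne[OF j] \<psi>[OF j] nH[OF lO[OF j]] nH[OF j]] nat[OF u[OF j]] by simp
      then obtain k v where k: "v \<in> Hom (idx V) (l j) k"
        "?F (ar V v) \<cdot> (\<psi> j \<cdot> ?n j) = ?F (ar V v) \<cdot> ?F (ar V (u j))"
        using nuc_injE2[OF V W inj \<psi>n F[OF u[OF j]] lO[OF j]] by blast
      have "same_germ A ((), l j) (\<psi> j \<cdot> ?n j) ((), j) (Id C (?D \<otimes>\<^sub>o ob V j))"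
      proof (rule same_germI)
        show "((), v) \<in> Hom (idx A) ((), l j) ((), k)" "((), v \<cdot>\<^bsub>idx V\<^esub> u j) \<in> Hom (idx A) ((), j) ((), k)"
          using k(1) I.Comp_Hom[OF u[OF j] k(1)] by (simp_all add: A2)
        show "ar A ((), v) \<cdot> (\<psi> j \<cdot> ?n j) = ar A ((), v \<cdot>\<^bsub>idx V\<^esub> u j) \<cdot> Id C (?D \<otimes>\<^sub>o ob V j)"
          using k(2) tens_Comp_Id(1)[OF D ar_Hom[OF V u[OF j]] ar_Hom[OF V k(1)]] ar_Comp[OF V u[OF j] k(1)]
            Comp_Id[OF Comp_Hom[OF F[OF u[OF j]] F[OF k(1)]]] by (simp add: A4)
      qed
      from same_germ_sym[OF this] have "(((), l j), \<psi> j \<cdot> ?n j) \<in> ind_id C A p"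
        using ind_hom_mem_same_germ[OF A ind_id(1)[OF A] ind_id(2)[OF A p], of "((), l j)" "\<psi> j \<cdot> ?n j"]
          lO[OF j] \<psi>n by (simp add: pj A1 A3)
      then show "\<exists>k \<phi>. (k, \<phi>) \<in> ind_comp C A A y x p \<and> (k, \<phi>) \<in> ind_id C A p" using m pj by blast
    qed
    moreover have "ind_comp C B B x y = ind_id C B"
    proof (rule ind_hom_ext[OF B ind_comp(1)[OF B A B y xB] ind_id(1)[OF B]])
      fix j assume jB: "j \<in> Obj (idx B)"
      then have j: "j \<in> Obj (idx V)" by (simp add: B1)
      note m = ind_comp(2)[OF B A B y xB ym[OF j] xm[OF lO[OF j]]]
      have uB: "u j \<in> Hom (idx B) j (l j)" using u[OF j] by (simp add: B1)
      have "(l j, ar B (u j) \<cdot> Id C (ob B j)) \<in> ind_id C B j"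
        using ind_hom_post[OF B ind_id(1)[OF B] ind_id(2)[OF B jB] uB] .
      then have "(l j, ?n (l j) \<cdot> \<psi> j) \<in> ind_id C B j"
        using Comp_Id[OF G[OF u[OF j]]] ne[OF j] by (simp add: B1)
      then show "\<exists>k \<phi>. (k, \<phi>) \<in> ind_comp C B B x y j \<and> (k, \<phi>) \<in> ind_id C B j" using m by blast
    qed
    ultimately show "ind_iso C A B x" unfolding ind_iso_def using xB y by blast
  qed
  then show ?thesis unfolding A_def B_def x_def .
qed

end

section \<open>Extensions of nuclear objects\<close>

context quasi_abelian_monoidal
begin

text \<open>The kernel property of \<open>f\<close> carried over to \<open>Hom(W, _)\<close> by transposing arrows.\<close>

lemma ihom_kernel_factor:
  fixes V1 V2 V3 :: "('i, 'o, 'a) ind_obj"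
  assumes I: "ind_object C V1" "ind_object C V2" "ind_object C V3"
    and f: "f \<in> ind_hom C V1 V2" and g: "g \<in> ind_hom C V2 V3"
    and ker: "is_kernel (Ind C) (V2, V3, g) (V1, V2, f)" and W: "W \<in> Obj C"
    and p: "(k, p) \<in> g j" and b: "b \<in> Hom C X (ihom C W (ob V2 j))"
    and z: "ihom_arr C W p \<cdot> b = zero X (ihom C W (ob V3 k))"
  obtains i \<gamma> j' \<phi> t where "\<gamma> \<in> Hom C X (ihom C W (ob V1 i))" "(j', \<phi>) \<in> f i" "t \<in> Hom (idx V2) j j'"
    "ihom_arr C W \<phi> \<cdot> \<gamma> = ihom_arr C W (ar V2 t) \<cdot> b"
proof -
  note pD = ind_hom_memD[OF I(3) g p]
  note X = Hom_ObjD(1)[OF b] and O2 = ob_Obj[OF I(2) pD(1)] and O3 = ob_Obj[OF I(3) pD(2)]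
  have pz: "p \<cdot> untranspose W (ob V2 j) b = zero (X \<otimes>\<^sub>o W) (ob V3 k)"
    using untranspose_ihom_arr_Comp[OF W pD(3) b] z untranspose_zero[OF W O3 X] by simp
  obtain i \<delta> j' \<phi> t where d: "\<delta> \<in> Hom C (X \<otimes>\<^sub>o W) (ob V1 i)" and \<phi>: "(j', \<phi>) \<in> f i"
    and t: "t \<in> Hom (idx V2) j j'" and e: "\<phi> \<cdot> \<delta> = ar V2 t \<cdot> untranspose W (ob V2 j) b"
    by (rule ind_kernel_factor[OF I f g ker p untranspose_Hom[OF W O2 b] pz])
  note \<phi>D = ind_hom_memD[OF I(2) f \<phi>]
  note O1 = Hom_ObjD(2)[OF d] and O2' = ob_Obj[OF I(2) \<phi>D(2)]
  note c = transpose_ihom[OF W O1 X d] and tH = ar_Hom[OF I(2) t]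
  have "untranspose W (ob V2 j') (ihom_arr C W \<phi> \<cdot> transpose C W (ob V1 i) X \<delta>) =
      untranspose W (ob V2 j') (ihom_arr C W (ar V2 t) \<cdot> b)"
    using untranspose_ihom_arr_Comp[OF W \<phi>D(3) c(1)] c(2) e untranspose_ihom_arr_Comp[OF W tH b] by simp
  then have "ihom_arr C W \<phi> \<cdot> transpose C W (ob V1 i) X \<delta> = ihom_arr C W (ar V2 t) \<cdot> b"
    using untranspose_inj[OF W O2' Comp_Hom[OF c(1) ihom_arr_Hom[OF W \<phi>D(3)]] Comp_Hom[OF b ihom_arr_Hom[OF W tH]]]
    by simp
  then show ?thesis using that[OF c(1) \<phi> t] by simp
qed

text \<open>After enlarging its target, a representative at \<open>i\<close> extends along a transition arrow to a representative
  at \<open>i'\<close>.\<close>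

lemma ind_hom_align:
  assumes E: "ind_object C E" and F: "ind_object C F" and x: "x \<in> ind_hom C E F"
    and \<phi>: "(j, \<phi>) \<in> x i" and u: "u \<in> Hom (idx E) i i'"
  obtains k \<phi>' s where "(k, \<phi>') \<in> x i'" "s \<in> Hom (idx F) j k" "\<phi>' \<cdot> ar E u = ar F s \<cdot> \<phi>"
proof -
  interpret I: category "idx E" using E by (rule ind_category)
  obtain j' \<chi> where c: "(j', \<chi>) \<in> x i'" using ind_hom_rep[OF F x I.Hom_ObjD(2)[OF u]] .
  note cD = ind_hom_memD[OF F x c]
  obtain k r s where k: "r \<in> Hom (idx F) j' k" "s \<in> Hom (idx F) j k" "ar F r \<cdot> (\<chi> \<cdot> ar E u) = ar F s \<cdot> \<phi>"
    using ind_hom_same_germ[OF F x ind_hom_pre[OF x c u] \<phi>] by (rule same_germE)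
  show ?thesis
    using that[OF ind_hom_post[OF F x c k(1)] k(2)] k(3) Comp_assoc[OF ar_Hom[OF E u] cD(3) ar_Hom[OF F k(1)]] by simp
qed

text \<open>This is where strict monomorphisms have to be stable under push-out. The tensor product with \<open>W\<^sup>\<or>\<close> does
  not preserve kernels, so an arrow \<open>a'\<close> into \<open>W\<^sup>\<or> \<otimes> V\<^sub>2\<close> that is killed by \<open>W\<^sup>\<or> \<otimes> \<pi>\<close> need not come from
  \<open>W\<^sup>\<or> \<otimes> N\<close>, where \<open>N\<close> is the kernel of \<open>\<pi>\<close>. Instead, \<open>W\<^sup>\<or> \<otimes> V\<^sub>2\<close> is mapped into a push-out \<open>P\<close> in two ways
  that agree on \<open>W\<^sup>\<or> \<otimes> N\<close>. Their difference factors through \<open>W\<^sup>\<or> \<otimes> \<pi>\<close>, so they agree on \<open>a'\<close>; one of them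
  kills \<open>a'\<close>, and the other one is a transition arrow followed by a monomorphism.\<close>

lemma nuc_inj_extension:
  fixes V1 V2 V3 :: "('i, 'o, 'a) ind_obj"
  assumes inf: "infinite (UNIV :: 'i set)"
    and I: "ind_object C V1" "ind_object C V2" "ind_object C V3"
    and f: "f \<in> ind_hom C V1 V2" and g: "g \<in> ind_hom C V2 V3"
    and ex: "strict_short_exact (Ind C) (V1, V2, f) (V2, V3, g)" and W: "W \<in> Obj C"
    and inj1: "nuc_inj W V1" and surj1: "nuc_surj W V1" and inj3: "nuc_inj W V3"
  shows "nuc_inj W V2"
  unfolding nuc_inj_def
proof (intro allI impI)
  interpret M: ind_morphism C add zero V2 V3 g
    using I g inf by unfold_locales auto
  interpret I1: category "idx V1" using I(1) by (rule ind_category)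
  interpret I2: category "idx V2" using I(2) by (rule ind_category)
  interpret I3: category "idx V3" using I(3) by (rule ind_category)
  let ?D = "dual C W"
  let ?n = "nuc_arr C W" and ?F = "\<lambda>\<phi>. Id C ?D \<otimes>\<^sub>a \<phi>" and ?G = "ihom_arr C W"
  note D = dual_Obj[OF W]
  note FH = tens_Hom[OF Id_Hom[OF D]] and FC = tens_Comp_Id(1)[OF D] and GH = ihom_arr_Hom[OF W]
    and GC = ihom_arr_Comp[OF W] and nH = nuc_arr_Hom[OF W] and nat = nuc_arr_natural[OF W]
  note A1 = ar_Hom[OF I(1)] and A2 = ar_Hom[OF I(2)] and A3 = ar_Hom[OF I(3)]
  have ker: "is_kernel (Ind C) (V2, V3, g) (V1, V2, f)" and ck: "is_cokernel (Ind C) (V1, V2, f) (V2, V3, g)"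
    using ex unfolding strict_short_exact_def by auto
  fix j X a assume a: "a \<in> Hom C X (?D \<otimes>\<^sub>o ob V2 j)" and j: "j \<in> Obj (idx V2)"
    and na: "?n (ob V2 j) \<cdot> a = zero X (ihom C W (ob V2 j))"
  note X = Hom_ObjD(1)[OF a]
  \<comment> \<open>The image of \<open>a\<close> in \<open>W\<^sup>\<or> \<otimes> V3\<close> vanishes.\<close>
  obtain k0 p0 where p0: "(k0, p0) \<in> g j" using ind_hom_rep[OF I(3) g j] .
  note p0D = ind_hom_memD[OF I(3) g p0]
  note n2 = nH[OF ob_Obj[OF I(2) j]] and n3 = nH[OF ob_Obj[OF I(3) p0D(2)]]
  have "?n (ob V3 k0) \<cdot> (?F p0 \<cdot> a) = ?G p0 \<cdot> ?n (ob V2 j) \<cdot> a"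
    using Comp_rewrite[OF nat[OF p0D(3)] FH[OF p0D(3)] n3 n2 GH[OF p0D(3)] a] .
  also have "\<dots> = zero X (ihom C W (ob V3 k0))" unfolding na using Comp_zero[OF GH[OF p0D(3)] X] .
  finally obtain k r where r: "r \<in> Hom (idx V3) k0 k" "?F (ar V3 r) \<cdot> (?F p0 \<cdot> a) = zero X (?D \<otimes>\<^sub>o ob V3 k)"
    using nuc_injE[OF inj3 Comp_Hom[OF a FH[OF p0D(3)]] p0D(2)] by blast
  define p where "p = ar V3 r \<cdot> p0"
  have p: "(k, p) \<in> g j" unfolding p_def using ind_hom_post[OF I(3) g p0 r(1)] .
  note pD = ind_hom_memD[OF I(3) g p]
  have pa: "?F p \<cdot> a = zero X (?D \<otimes>\<^sub>o ob V3 k)"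
    unfolding p_def using FC[OF p0D(3) A3[OF r(1)]] Comp_assoc[OF a FH[OF p0D(3)] FH[OF A3[OF r(1)]]] r(2) by simp
  obtain j' t k' t' \<nu> \<pi> \<xi> v where t: "t \<in> Hom (idx V2) j j'" and "t' \<in> Hom (idx V3) k k'"
    and c\<pi>: "is_cokernel C \<nu> \<pi>" and k\<nu>: "is_kernel C \<pi> \<nu>"
    and \<nu>: "\<nu> \<in> Hom C (Dom C \<nu>) (ob V2 j')" and \<pi>: "\<pi> \<in> Hom C (ob V2 j') (Cod C \<pi>)"
    and \<xi>: "\<xi> \<in> Hom C (ob V3 k) (Cod C \<pi>)" and v: "v \<in> Hom C (Cod C \<pi>) (ob V3 k')"
    and vp: "(k', v \<cdot> \<pi>) \<in> g j'" and \<xi>p: "\<xi> \<cdot> p = \<pi> \<cdot> ar V2 t" and "v \<cdot> \<xi> = ar V3 t'"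
    by (rule M.ind_cokernel_presentation[OF I(1) f ck p])
  let ?N = "Dom C \<nu>" and ?Q = "Cod C \<pi>"
  note NO = Hom_ObjD(1)[OF \<nu>] and j' = I2.Hom_ObjD(2)[OF t] and QO = Hom_ObjD(2)[OF \<pi>]
  note n2' = nH[OF ob_Obj[OF I(2) j']] and nN = nH[OF NO]
  define a' where "a' = ?F (ar V2 t) \<cdot> a"
  have a': "a' \<in> Hom C X (?D \<otimes>\<^sub>o ob V2 j')" unfolding a'_def using Comp_Hom[OF a FH[OF A2[OF t]]] .
  have \<pi>a: "?F \<pi> \<cdot> a' = zero X (?D \<otimes>\<^sub>o ?Q)"
  proof -
    have "?F \<pi> \<cdot> a' = ?F (\<pi> \<cdot> ar V2 t) \<cdot> a"
      unfolding a'_def using FC[OF A2[OF t] \<pi>] Comp_assoc[OF a FH[OF A2[OF t]] FH[OF \<pi>]] by simp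
    also have "\<dots> = ?F \<xi> \<cdot> (?F p \<cdot> a)"
      unfolding \<xi>p[symmetric] using FC[OF pD(3) \<xi>] Comp_assoc[OF a FH[OF pD(3)] FH[OF \<xi>]] by simp
    finally show ?thesis unfolding pa using Comp_zero[OF FH[OF \<xi>] X] by simp
  qed
  have na': "?n (ob V2 j') \<cdot> a' = zero X (ihom C W (ob V2 j'))"
    unfolding a'_def
    using Comp_rewrite[OF nat[OF A2[OF t]] FH[OF A2[OF t]] n2' n2 GH[OF A2[OF t]] a] na Comp_zero[OF GH[OF A2[OF t]] X] by simp
  \<comment> \<open>The kernel of \<open>\<pi>\<close> lands in \<open>V1\<close>.\<close>
  have vz: "(v \<cdot> \<pi>) \<cdot> \<nu> = zero ?N (ob V3 k')"
  proof -
    have "\<pi> \<cdot> \<nu> = zero ?N ?Q" using k\<nu> is_kernel_iff[OF \<pi>] by blast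
    then show ?thesis using Comp_assoc[OF \<nu> \<pi> v] Comp_zero[OF v NO] by simp
  qed
  obtain i \<delta> j2 \<phi> t2 where \<delta>: "\<delta> \<in> Hom C ?N (ob V1 i)" and \<phi>: "(j2, \<phi>) \<in> f i" and t2: "t2 \<in> Hom (idx V2) j' j2"
    and \<phi>\<delta>: "\<phi> \<cdot> \<delta> = ar V2 t2 \<cdot> \<nu>"
    by (rule ind_kernel_factor[OF I f g ker vp \<nu> vz])
  note \<phi>D = ind_hom_memD[OF I(2) f \<phi>]
  note O1 = ob_Obj[OF I(1)]
  \<comment> \<open>By nuclearity of \<open>V1\<close> the arrow \<open>W\<^sup>\<or> \<otimes> N \<rightarrow> W\<^sup>\<or> \<otimes> V1\<close> factors through \<open>Hom(W, N)\<close>.\<close>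
  obtain i1 u c0 where u: "u \<in> Hom (idx V1) i i1" and c0: "c0 \<in> Hom C (ihom C W ?N) (?D \<otimes>\<^sub>o ob V1 i1)"
    and nc: "?n (ob V1 i1) \<cdot> c0 = ?G (ar V1 u) \<cdot> ?G \<delta>"
    by (rule nuc_surjE[OF surj1 GH[OF \<delta>] \<phi>D(1)])
  note i1 = I1.Hom_ObjD(2)[OF u]
  note n1 = nH[OF O1[OF i1]]
  define \<delta>1 where "\<delta>1 = ar V1 u \<cdot> \<delta>"
  have \<delta>1: "\<delta>1 \<in> Hom C ?N (ob V1 i1)" unfolding \<delta>1_def using Comp_Hom[OF \<delta> A1[OF u]] .
  note cn = Comp_Hom[OF nN c0]
  have "?n (ob V1 i1) \<cdot> (c0 \<cdot> ?n ?N) = ?n (ob V1 i1) \<cdot> ?F \<delta>1"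
    using Comp_assoc[OF nN c0 n1] nc GC[OF \<delta> A1[OF u]] nat[OF \<delta>1] unfolding \<delta>1_def by simp
  then obtain i2 u2 where u2: "u2 \<in> Hom (idx V1) i1 i2" and cu: "?F (ar V1 u2) \<cdot> (c0 \<cdot> ?n ?N) = ?F (ar V1 u2) \<cdot> ?F \<delta>1"
    using nuc_injE2[OF I(1) W inj1 cn FH[OF \<delta>1] i1] by blast
  note uu = I1.Comp_Hom[OF u u2]
  obtain j4 \<phi>4 s where \<phi>4: "(j4, \<phi>4) \<in> f i2" and s: "s \<in> Hom (idx V2) j2 j4"
    and \<phi>4u: "\<phi>4 \<cdot> ar V1 (u2 \<cdot>\<^bsub>idx V1\<^esub> u) = ar V2 s \<cdot> \<phi>"
    by (rule ind_hom_align[OF I(1,2) f \<phi> uu])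
  note \<phi>4D = ind_hom_memD[OF I(2) f \<phi>4]
  define w where "w = s \<cdot>\<^bsub>idx V2\<^esub> t2"
  have w: "w \<in> Hom (idx V2) j' j4" unfolding w_def using I2.Comp_Hom[OF t2 s] .
  define \<chi> where "\<chi> = ?F (\<phi>4 \<cdot> ar V1 u2) \<cdot> c0"
  note \<phi>4u2 = Comp_Hom[OF A1[OF u2] \<phi>4D(3)]
  have \<chi>: "\<chi> \<in> Hom C (ihom C W ?N) (?D \<otimes>\<^sub>o ob V2 j4)" unfolding \<chi>_def using Comp_Hom[OF c0 FH[OF \<phi>4u2]] .
  have \<chi>n: "\<chi> \<cdot> ?n ?N = ?F (ar V2 w) \<cdot> ?F \<nu>"
  proof -
    have "\<chi> \<cdot> ?n ?N = ?F \<phi>4 \<cdot> (?F (ar V1 u2) \<cdot> (c0 \<cdot> ?n ?N))"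
      unfolding \<chi>_def using Comp_assoc[OF nN c0 FH[OF \<phi>4u2]] FC[OF A1[OF u2] \<phi>4D(3)]
        Comp_assoc[OF cn FH[OF A1[OF u2]] FH[OF \<phi>4D(3)]] by simp
    also have "\<dots> = ?F (\<phi>4 \<cdot> (ar V1 u2 \<cdot> \<delta>1))"
      unfolding cu using FC[OF \<delta>1 A1[OF u2]] FC[OF Comp_Hom[OF \<delta>1 A1[OF u2]] \<phi>4D(3)] by simp
    also have "\<phi>4 \<cdot> (ar V1 u2 \<cdot> \<delta>1) = (\<phi>4 \<cdot> ar V1 (u2 \<cdot>\<^bsub>idx V1\<^esub> u)) \<cdot> \<delta>"
      unfolding \<delta>1_def using ar_Comp[OF I(1) u u2] Comp_assoc[OF \<delta> A1[OF u] A1[OF u2]]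
        Comp_assoc[OF \<delta> A1[OF uu] \<phi>4D(3)] by simp
    also have "\<dots> = ar V2 w \<cdot> \<nu>"
      unfolding \<phi>4u w_def using Comp_assoc[OF \<delta> \<phi>D(3) A2[OF s]] \<phi>\<delta> ar_Comp[OF I(2) t2 s]
        Comp_assoc[OF \<nu> A2[OF t2] A2[OF s]] by simp
    also have "?F (ar V2 w \<cdot> \<nu>) = ?F (ar V2 w) \<cdot> ?F \<nu>" using FC[OF \<nu> A2[OF w]] .
    finally show ?thesis .
  qed
  \<comment> \<open>The push-out of the strict monomorphism \<open>Hom(W, N) \<rightarrow> Hom(W, V2)\<close> along \<open>\<chi>\<close>.\<close>
  obtain P \<mu> \<eta> where \<mu>: "\<mu> \<in> Hom C (?D \<otimes>\<^sub>o ob V2 j4) P" and \<eta>: "\<eta> \<in> Hom C (ihom C W (ob V2 j')) P"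
    and sq: "\<eta> \<cdot> ?G \<nu> = \<mu> \<cdot> \<chi>" and \<mu>m: "is_mono C \<mu>"
    by (rule pushout_kernel[OF ihom_arr_kernel[OF W \<pi> k\<nu>] GH[OF \<nu>] \<chi>])
  note PO = Hom_ObjD(2)[OF \<mu>]
  note wH = FH[OF A2[OF w]]
  note y1 = Comp_Hom[OF n2' \<eta>] and y2 = Comp_Hom[OF wH \<mu>]
  have "(\<eta> \<cdot> ?n (ob V2 j')) \<cdot> ?F \<nu> = (\<mu> \<cdot> ?F (ar V2 w)) \<cdot> ?F \<nu>"
  proof -
    have "(\<eta> \<cdot> ?n (ob V2 j')) \<cdot> ?F \<nu> = \<eta> \<cdot> (?G \<nu> \<cdot> ?n ?N)"
      using Comp_assoc[OF FH[OF \<nu>] n2' \<eta>] nat[OF \<nu>] by simp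
    also have "\<dots> = \<mu> \<cdot> (\<chi> \<cdot> ?n ?N)" using Comp_rewrite[OF sq GH[OF \<nu>] \<eta> \<chi> \<mu> nN] .
    also have "\<dots> = (\<mu> \<cdot> ?F (ar V2 w)) \<cdot> ?F \<nu>" unfolding \<chi>n using Comp_assoc[OF FH[OF \<nu>] wH \<mu>] by simp
    finally show ?thesis .
  qed
  then have "sub (\<eta> \<cdot> ?n (ob V2 j')) (\<mu> \<cdot> ?F (ar V2 w)) \<cdot> ?F \<nu> = zero (?D \<otimes>\<^sub>o ?N) P"
    using sub_Comp[OF FH[OF \<nu>] y1 y2] sub_eq_zero_iff[OF Comp_Hom[OF FH[OF \<nu>] y1] Comp_Hom[OF FH[OF \<nu>] y2]] by simp
  then obtain d where d: "d \<in> Hom C (Cod C (?F \<pi>)) P" "d \<cdot> ?F \<pi> = sub (\<eta> \<cdot> ?n (ob V2 j')) (\<mu> \<cdot> ?F (ar V2 w))"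
    using cokernel_factor[OF tens_cokernel[OF D \<nu> c\<pi>] FH[OF \<nu>] sub_Hom[OF y1 y2]] by blast
  have d1: "d \<in> Hom C (?D \<otimes>\<^sub>o ?Q) P" using d(1) FH[OF \<pi>] by (simp add: Hom_def)
  have "sub (\<eta> \<cdot> ?n (ob V2 j')) (\<mu> \<cdot> ?F (ar V2 w)) \<cdot> a' = zero X P"
    unfolding d(2)[symmetric] using Comp_assoc[OF a' FH[OF \<pi>] d1] \<pi>a Comp_zero[OF d1 X] by simp
  then have "(\<mu> \<cdot> ?F (ar V2 w)) \<cdot> a' = (\<eta> \<cdot> ?n (ob V2 j')) \<cdot> a'"
    using sub_Comp[OF a' y1 y2] sub_eq_zero_iff[OF Comp_Hom[OF a' y1] Comp_Hom[OF a' y2]] by simp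
  then have "\<mu> \<cdot> (?F (ar V2 w) \<cdot> a') = \<mu> \<cdot> zero X (?D \<otimes>\<^sub>o ob V2 j4)"
    using Comp_assoc[OF a' wH \<mu>] Comp_assoc[OF a' n2' \<eta>] na' Comp_zero[OF \<eta> X] Comp_zero[OF \<mu> X] by simp
  then have "?F (ar V2 w) \<cdot> a' = zero X (?D \<otimes>\<^sub>o ob V2 j4)"
    using mono_cancel[OF \<mu>m \<mu> Comp_Hom[OF a' wH] zero_Hom[OF X Hom_ObjD(1)[OF \<mu>]]] by simp
  then have "?F (ar V2 (w \<cdot>\<^bsub>idx V2\<^esub> t)) \<cdot> a = zero X (?D \<otimes>\<^sub>o ob V2 j4)"
    unfolding a'_def using ar_Comp[OF I(2) t w] FC[OF A2[OF t] A2[OF w]] Comp_assoc[OF a FH[OF A2[OF t]] wH] by simp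
  then show "\<exists>k u. u \<in> Hom (idx V2) j k \<and> ?F (ar V2 u) \<cdot> a = zero X (?D \<otimes>\<^sub>o ob V2 k)"
    using I2.Comp_Hom[OF t w] by blast
qed

text \<open>The diagram chase of the five lemma, on arrows from objects of \<open>C\<close> and up to a strict epimorphism.\<close>

lemma nuc_surj_extension:
  fixes V1 V2 V3 :: "('i, 'o, 'a) ind_obj"
  assumes inf: "infinite (UNIV :: 'i set)"
    and I: "ind_object C V1" "ind_object C V2" "ind_object C V3"
    and f: "f \<in> ind_hom C V1 V2" and g: "g \<in> ind_hom C V2 V3"
    and ex: "strict_short_exact (Ind C) (V1, V2, f) (V2, V3, g)" and W: "W \<in> Obj C"
    and surj1: "nuc_surj W V1" and inj2: "nuc_inj W V2" and surj3: "nuc_surj W V3"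
  shows "nuc_surj W V2"
  unfolding nuc_surj_def
proof (intro allI impI)
  interpret M: ind_morphism C add zero V2 V3 g
    using I g inf by unfold_locales auto
  interpret I1: category "idx V1" using I(1) by (rule ind_category)
  interpret I2: category "idx V2" using I(2) by (rule ind_category)
  interpret I3: category "idx V3" using I(3) by (rule ind_category)
  let ?D = "dual C W"
  let ?n = "nuc_arr C W" and ?F = "\<lambda>\<phi>. Id C ?D \<otimes>\<^sub>a \<phi>" and ?G = "ihom_arr C W"
  note D = dual_Obj[OF W]
  note FH = tens_Hom[OF Id_Hom[OF D]] and FC = tens_Comp_Id(1)[OF D] and GH = ihom_arr_Hom[OF W]
    and GC = ihom_arr_Comp[OF W] and nH = nuc_arr_Hom[OF W] and nat = nuc_arr_natural[OF W]
  note A1 = ar_Hom[OF I(1)] and A2 = ar_Hom[OF I(2)] and A3 = ar_Hom[OF I(3)]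
  note O1 = ob_Obj[OF I(1)] and O2 = ob_Obj[OF I(2)] and O3 = ob_Obj[OF I(3)]
  have ker: "is_kernel (Ind C) (V2, V3, g) (V1, V2, f)" and ck: "is_cokernel (Ind C) (V1, V2, f) (V2, V3, g)"
    using ex unfolding strict_short_exact_def by auto
  have nF: "?n Y' \<cdot> (?F \<phi> \<cdot> h) = ?G \<phi> \<cdot> (?n Y \<cdot> h)"
    if "\<phi> \<in> Hom C Y Y'" "h \<in> Hom C Z (?D \<otimes>\<^sub>o Y)" for \<phi> Y Y' h Z
    using Comp_rewrite[OF nat[OF that(1)] FH[OF that(1)] nH[OF Hom_ObjD(2)[OF that(1)]]
        nH[OF Hom_ObjD(1)[OF that(1)]] GH[OF that(1)] that(2)] .
  have GCC: "?G \<psi> \<cdot> (?G \<phi> \<cdot> h) = ?G (\<psi> \<cdot> \<phi>) \<cdot> h"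
    if "\<phi> \<in> Hom C Y Y'" "\<psi> \<in> Hom C Y' Y''" "h \<in> Hom C Z (ihom C W Y)" for \<phi> \<psi> Y Y' Y'' h Z
    using Comp_rewrite1[OF GC[OF that(1,2), symmetric] GH[OF that(1)] GH[OF that(2)] that(3)] .
  fix j X b assume b: "b \<in> Hom C X (ihom C W (ob V2 j))" and j: "j \<in> Obj (idx V2)"
  note X = Hom_ObjD(1)[OF b]
  \<comment> \<open>A preimage \<open>a3\<close> in \<open>W\<^sup>\<or> \<otimes> V3\<close> of the image of \<open>b\<close> in \<open>Hom(W, V3)\<close>.\<close>
  obtain k0 p0 where p0: "(k0, p0) \<in> g j" using ind_hom_rep[OF I(3) g j] .
  note p0D = ind_hom_memD[OF I(3) g p0]
  obtain k r a3 where r: "r \<in> Hom (idx V3) k0 k" and a3: "a3 \<in> Hom C X (?D \<otimes>\<^sub>o ob V3 k)"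
    and na3: "?n (ob V3 k) \<cdot> a3 = ?G (ar V3 r) \<cdot> (?G p0 \<cdot> b)"
    by (rule nuc_surjE[OF surj3 Comp_Hom[OF b GH[OF p0D(3)]] p0D(2)])
  define p where "p = ar V3 r \<cdot> p0"
  have p: "(k, p) \<in> g j" unfolding p_def using ind_hom_post[OF I(3) g p0 r] .
  note pD = ind_hom_memD[OF I(3) g p]
  have na3': "?n (ob V3 k) \<cdot> a3 = ?G p \<cdot> b" unfolding na3 p_def using GCC[OF p0D(3) A3[OF r] b] .
  obtain j' t k' t' \<nu> \<pi> \<xi> v where t: "t \<in> Hom (idx V2) j j'" and t': "t' \<in> Hom (idx V3) k k'"
    and c\<pi>: "is_cokernel C \<nu> \<pi>" and "is_kernel C \<pi> \<nu>"
    and \<nu>: "\<nu> \<in> Hom C (Dom C \<nu>) (ob V2 j')" and \<pi>: "\<pi> \<in> Hom C (ob V2 j') (Cod C \<pi>)"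
    and \<xi>: "\<xi> \<in> Hom C (ob V3 k) (Cod C \<pi>)" and v: "v \<in> Hom C (Cod C \<pi>) (ob V3 k')"
    and vp: "(k', v \<cdot> \<pi>) \<in> g j'" and \<xi>p: "\<xi> \<cdot> p = \<pi> \<cdot> ar V2 t" and v\<xi>: "v \<cdot> \<xi> = ar V3 t'"
    by (rule M.ind_cokernel_presentation[OF I(1) f ck p])
  let ?Q = "Cod C \<pi>"
  note j' = I2.Hom_ObjD(2)[OF t] and k' = I3.Hom_ObjD(2)[OF t'] and QO = Hom_ObjD(2)[OF \<pi>]
  note vpH = Comp_Hom[OF \<pi> v]
  \<comment> \<open>Lift \<open>a3\<close> to \<open>W\<^sup>\<or> \<otimes> V2\<close> along a strict epimorphism \<open>s\<close>.\<close>
  note cF = tens_cokernel[OF D \<nu> c\<pi>]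
  obtain X' s a2 where s: "s \<in> Hom C X' X" and a2: "a2 \<in> Hom C X' (?D \<otimes>\<^sub>o ob V2 j')"
    and sq: "?F \<pi> \<cdot> a2 = (?F \<xi> \<cdot> a3) \<cdot> s" and ss: "is_strict C s" and se: "is_epi C s"
    by (rule pullback_strict_epi[OF FH[OF \<pi>] cokernel_strict[OF cF] cokernel_epi[OF cF] Comp_Hom[OF a3 FH[OF \<xi>]]])
  note X' = Hom_ObjD(1)[OF s]
  note n2' = nH[OF O2[OF j']]
  define b' where "b' = ?G (ar V2 t) \<cdot> b \<cdot> s"
  note bs = Comp_Hom[OF s b]
  have b': "b' \<in> Hom C X' (ihom C W (ob V2 j'))" unfolding b'_def using Comp_Hom[OF bs GH[OF A2[OF t]]] .
  note na2H = Comp_Hom[OF a2 n2']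
  have "?G (v \<cdot> \<pi>) \<cdot> b' = ?G (v \<cdot> \<pi>) \<cdot> (?n (ob V2 j') \<cdot> a2)"
  proof -
    have e: "(v \<cdot> \<pi>) \<cdot> ar V2 t = ar V3 t' \<cdot> p"
      using Comp_assoc[OF A2[OF t] \<pi> v] \<xi>p[symmetric] Comp_assoc[OF pD(3) \<xi> v] v\<xi> by simp
    have a3s: "a3 \<cdot> s \<in> Hom C X' (?D \<otimes>\<^sub>o ob V3 k)" using Comp_Hom[OF s a3] .
    have "?G (v \<cdot> \<pi>) \<cdot> (?n (ob V2 j') \<cdot> a2) = ?n (ob V3 k') \<cdot> (?F (v \<cdot> \<pi>) \<cdot> a2)"
      using nF[OF vpH a2] by simp
    also have "?F (v \<cdot> \<pi>) \<cdot> a2 = ?F v \<cdot> (?F \<xi> \<cdot> (a3 \<cdot> s))"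
      using FC[OF \<pi> v] Comp_assoc[OF a2 FH[OF \<pi>] FH[OF v]] sq Comp_assoc[OF s a3 FH[OF \<xi>]] by simp
    also have "\<dots> = ?F (ar V3 t') \<cdot> (a3 \<cdot> s)"
      using Comp_assoc[OF a3s FH[OF \<xi>] FH[OF v]] FC[OF \<xi> v] v\<xi> by simp
    also have "?n (ob V3 k') \<cdot> \<dots> = ?G (ar V3 t') \<cdot> (?n (ob V3 k) \<cdot> (a3 \<cdot> s))" using nF[OF A3[OF t'] a3s] .
    also have "?n (ob V3 k) \<cdot> (a3 \<cdot> s) = ?G p \<cdot> (b \<cdot> s)"
      using Comp_rewrite[OF na3' a3 nH[OF O3[OF pD(2)]] b GH[OF pD(3)] s] .
    also have "?G (ar V3 t') \<cdot> \<dots> = ?G (v \<cdot> \<pi>) \<cdot> b'"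
      unfolding b'_def using GCC[OF pD(3) A3[OF t'] bs] GCC[OF A2[OF t] vpH bs] e by simp
    finally show ?thesis by simp
  qed
  then have bz: "?G (v \<cdot> \<pi>) \<cdot> sub b' (?n (ob V2 j') \<cdot> a2) = zero X' (ihom C W (ob V3 k'))"
    using Comp_sub[OF b' na2H GH[OF vpH]]
      sub_eq_zero_iff[OF Comp_Hom[OF b' GH[OF vpH]] Comp_Hom[OF na2H GH[OF vpH]]] by simp
  \<comment> \<open>The difference comes from \<open>Hom(W, V1)\<close>, hence from \<open>W\<^sup>\<or> \<otimes> V1\<close>.\<close>
  obtain i \<gamma> j2 \<phi> t2 where \<gamma>: "\<gamma> \<in> Hom C X' (ihom C W (ob V1 i))" and \<phi>: "(j2, \<phi>) \<in> f i"
    and t2: "t2 \<in> Hom (idx V2) j' j2" and \<phi>\<gamma>: "?G \<phi> \<cdot> \<gamma> = ?G (ar V2 t2) \<cdot> sub b' (?n (ob V2 j') \<cdot> a2)"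
    by (rule ihom_kernel_factor[OF I f g ker W vp sub_Hom[OF b' na2H] bz])
  note \<phi>D = ind_hom_memD[OF I(2) f \<phi>]
  obtain i1 u a1 where u: "u \<in> Hom (idx V1) i i1" and a1: "a1 \<in> Hom C X' (?D \<otimes>\<^sub>o ob V1 i1)"
    and na1: "?n (ob V1 i1) \<cdot> a1 = ?G (ar V1 u) \<cdot> \<gamma>"
    by (rule nuc_surjE[OF surj1 \<gamma> \<phi>D(1)])
  obtain j4 \<phi>4 s4 where \<phi>4: "(j4, \<phi>4) \<in> f i1" and s4: "s4 \<in> Hom (idx V2) j2 j4"
    and \<phi>4u: "\<phi>4 \<cdot> ar V1 u = ar V2 s4 \<cdot> \<phi>"
    by (rule ind_hom_align[OF I(1,2) f \<phi> u])
  note \<phi>4D = ind_hom_memD[OF I(2) f \<phi>4]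
  define w where "w = s4 \<cdot>\<^bsub>idx V2\<^esub> t2"
  have w: "w \<in> Hom (idx V2) j' j4" unfolding w_def using I2.Comp_Hom[OF t2 s4] .
  note n4 = nH[OF O2[OF \<phi>4D(2)]]
  note x1 = Comp_Hom[OF a1 FH[OF \<phi>4D(3)]] and x2 = Comp_Hom[OF a2 FH[OF A2[OF w]]]
  define a where "a = add (?F \<phi>4 \<cdot> a1) (?F (ar V2 w) \<cdot> a2)"
  have a: "a \<in> Hom C X' (?D \<otimes>\<^sub>o ob V2 j4)" unfolding a_def using add_Hom[OF x1 x2] .
  define z where "z = w \<cdot>\<^bsub>idx V2\<^esub> t"
  have z: "z \<in> Hom (idx V2) j j4" unfolding z_def using I2.Comp_Hom[OF t w] .
  have na: "?n (ob V2 j4) \<cdot> a = (?G (ar V2 z) \<cdot> b) \<cdot> s"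
  proof -
    note d = sub_Hom[OF b' na2H]
    have "?n (ob V2 j4) \<cdot> (?F \<phi>4 \<cdot> a1) = ?G \<phi>4 \<cdot> (?G (ar V1 u) \<cdot> \<gamma>)" using nF[OF \<phi>4D(3) a1] na1 by simp
    also have "\<dots> = ?G (ar V2 s4) \<cdot> (?G \<phi> \<cdot> \<gamma>)"
      using GCC[OF A1[OF u] \<phi>4D(3) \<gamma>] GCC[OF \<phi>D(3) A2[OF s4] \<gamma>] \<phi>4u by simp
    also have "\<dots> = ?G (ar V2 w) \<cdot> sub b' (?n (ob V2 j') \<cdot> a2)"
      unfolding \<phi>\<gamma> w_def using GCC[OF A2[OF t2] A2[OF s4] d] ar_Comp[OF I(2) t2 s4] by simp
    finally have 1: "?n (ob V2 j4) \<cdot> (?F \<phi>4 \<cdot> a1) = ?G (ar V2 w) \<cdot> sub b' (?n (ob V2 j') \<cdot> a2)" .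
    have "?n (ob V2 j4) \<cdot> a = add (?G (ar V2 w) \<cdot> sub b' (?n (ob V2 j') \<cdot> a2)) (?G (ar V2 w) \<cdot> (?n (ob V2 j') \<cdot> a2))"
      unfolding a_def using add_Comp[OF x1 x2 n4] 1 nF[OF A2[OF w] a2] by simp
    also have "\<dots> = ?G (ar V2 w) \<cdot> b'"
      using add_Comp[OF d na2H GH[OF A2[OF w]]] add_sub[OF b' na2H] by simp
    also have "\<dots> = (?G (ar V2 z) \<cdot> b) \<cdot> s"
      unfolding b'_def z_def using GCC[OF A2[OF t] A2[OF w] bs] ar_Comp[OF I(2) t w]
        Comp_assoc[OF s b GH[OF A2[OF z[unfolded z_def]]]] by simp
    finally show ?thesis .
  qed
  \<comment> \<open>Injectivity for \<open>V2\<close> lets the solution descend along \<open>s\<close>.\<close>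
  obtain \<kappa> where \<kappa>: "\<kappa> \<in> Hom C (Dom C \<kappa>) X'" and c\<kappa>: "is_cokernel C \<kappa> s"
    using strict_epi_cokernel[OF ss se s] .
  note KO = Hom_ObjD(1)[OF \<kappa>]
  have s\<kappa>: "s \<cdot> \<kappa> = zero (Dom C \<kappa>) X"
  proof -
    have "Cod C s = X" using s by (simp add: Hom_def)
    then show ?thesis using c\<kappa> is_cokernel_iff[OF \<kappa>] by auto
  qed
  note zb = Comp_Hom[OF b GH[OF A2[OF z]]]
  have "?n (ob V2 j4) \<cdot> (a \<cdot> \<kappa>) = zero (Dom C \<kappa>) (ihom C W (ob V2 j4))"
    using Comp_rewrite[OF na a n4 s zb \<kappa>] s\<kappa> Comp_zero[OF zb KO] by simp
  then obtain j5 u5 where u5: "u5 \<in> Hom (idx V2) j4 j5" "?F (ar V2 u5) \<cdot> (a \<cdot> \<kappa>) = zero (Dom C \<kappa>) (?D \<otimes>\<^sub>o ob V2 j5)"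
    using nuc_injE[OF inj2 Comp_Hom[OF \<kappa> a] \<phi>4D(2)] by blast
  note F5 = FH[OF A2[OF u5(1)]]
  have "(?F (ar V2 u5) \<cdot> a) \<cdot> \<kappa> = zero (Dom C \<kappa>) (?D \<otimes>\<^sub>o ob V2 j5)" using Comp_assoc[OF \<kappa> a F5] u5(2) by simp
  then obtain a5 where a5: "a5 \<in> Hom C (Cod C s) (?D \<otimes>\<^sub>o ob V2 j5)" "a5 \<cdot> s = ?F (ar V2 u5) \<cdot> a"
    using cokernel_factor[OF c\<kappa> \<kappa> Comp_Hom[OF a F5]] by blast
  have a5H: "a5 \<in> Hom C X (?D \<otimes>\<^sub>o ob V2 j5)" using a5(1) s by (simp add: Hom_def)
  have n5: "?n (ob V2 j5) \<in> Hom C (?D \<otimes>\<^sub>o ob V2 j5) (ihom C W (ob V2 j5))"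
    using nH[OF O2[OF I2.Hom_ObjD(2)[OF u5(1)]]] .
  let ?y = "u5 \<cdot>\<^bsub>idx V2\<^esub> z"
  have y: "?y \<in> Hom (idx V2) j j5" using I2.Comp_Hom[OF z u5(1)] .
  have "(?n (ob V2 j5) \<cdot> a5) \<cdot> s = ?G (ar V2 u5) \<cdot> (?n (ob V2 j4) \<cdot> a)"
    using Comp_assoc[OF s a5H n5] a5(2) nF[OF A2[OF u5(1)] a] by simp
  also have "\<dots> = (?G (ar V2 ?y) \<cdot> b) \<cdot> s"
    unfolding na using Comp_assoc[OF s zb GH[OF A2[OF u5(1)]]] GCC[OF A2[OF z] A2[OF u5(1)] b] ar_Comp[OF I(2) z u5(1)] by simp
  finally have "?n (ob V2 j5) \<cdot> a5 = ?G (ar V2 ?y) \<cdot> b"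
    using epi_cancel[OF se s Comp_Hom[OF a5H n5] Comp_Hom[OF b GH[OF A2[OF y]]]] by simp
  then show "\<exists>k u a. u \<in> Hom (idx V2) j k \<and> a \<in> Hom C X (?D \<otimes>\<^sub>o ob V2 k) \<and> ?n (ob V2 k) \<cdot> a = ?G (ar V2 u) \<cdot> b"
    using y a5H by blast
qed

end

theorem lemma4p11:
  fixes C :: "('o, 'a) csm_cat"
    and V\<^sub>1 V\<^sub>2 V\<^sub>3 :: "('i, 'o, 'a) ind_obj"
  assumes "infinite (UNIV :: 'i set)"
    and "closed_symmetric_monoidal_category C"
    and "quasi_abelian C"
    and "f \<in> Hom (Ind C) V\<^sub>1 V\<^sub>2"
    and "g \<in> Hom (Ind C) V\<^sub>2 V\<^sub>3"
    and "strict_short_exact (Ind C) f g"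
    and "nuclear C V\<^sub>1"
    and "nuclear C V\<^sub>3"
  shows "nuclear C V\<^sub>2"
proof -
  obtain add zero where pa: "preadditive_category C add zero"
    using assms(3) unfolding quasi_abelian_def additive_category_def by (elim conjE exE)
  interpret quasi_abelian_monoidal C add zero
    using pa assms(2,3) by (simp add: quasi_abelian_monoidal_def quasi_abelian_category_def quasi_abelian_category_axioms_def)
  obtain f' where f: "f = (V\<^sub>1, V\<^sub>2, f')" "f' \<in> ind_hom C V\<^sub>1 V\<^sub>2" and I1: "ind_object C V\<^sub>1" and I2: "ind_object C V\<^sub>2"
    using assms(4) unfolding Ind_Hom_iff by blast
  obtain g' where g: "g = (V\<^sub>2, V\<^sub>3, g')" "g' \<in> ind_hom C V\<^sub>2 V\<^sub>3" and I3: "ind_object C V\<^sub>3"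
    using assms(5) unfolding Ind_Hom_iff by blast
  have ex: "strict_short_exact (Ind C) (V\<^sub>1, V\<^sub>2, f') (V\<^sub>2, V\<^sub>3, g')" using assms(6) f(1) g(1) by simp
  show ?thesis unfolding nuclear_def
  proof
    fix W assume W: "W \<in> Obj C"
    have 1: "nuc_inj W V\<^sub>1" "nuc_surj W V\<^sub>1" and 3: "nuc_inj W V\<^sub>3" "nuc_surj W V\<^sub>3"
      using assms(7,8) nuclear_elementwise[OF I1 W] nuclear_elementwise[OF I3 W] W unfolding nuclear_def by auto
    have i: "nuc_inj W V\<^sub>2" using nuc_inj_extension[OF assms(1) I1 I2 I3 f(2) g(2) ex W 1 3(1)] .
    have "nuc_surj W V\<^sub>2" using nuc_surj_extension[OF assms(1) I1 I2 I3 f(2) g(2) ex W 1(2) i 3(2)] .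
    then show "ind_iso C (ind_tens C (ind_const C (dual C W)) V\<^sub>2) (ind_ihom C W V\<^sub>2) (ind_nuc C W V\<^sub>2)"
      using i nuclear_elementwise[OF I2 W] by blast
  qed
qed

end
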